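(* Let $N\in\mathbb N$, $f\in C^{2N}_p(\mathbb R)$, and let $c=(c_I)_{|I|\le M}$ be a finite family of ($\mathcal F_0$-measurable) coefficients indexed by words. Then, as $t\downarrow 0$, $$\mathbb E_0\big[f(\langle c,\widehat{\mathbb W}_t\rangle)\big]=f(c_\emptyset)+\sum_{n=1}^N\frac{1}{n!}\bigg(\sum_{k_1,\ldots,k_n=0}^2f^{(k_1+\cdots+k_n)}(c_\emptyset)\,\langle\emptyset,\mathcal G_{c,k_1,\ldots,k_n}(\emptyset)\rangle\bigg)t^n+o(t^N).$$
   Context: Setting: a filtered probability space carrying a $d$-dimensional standard Brownian motion $W=(W^1,\ldots,W^d)$; $\mathbb E_0$ is conditional expectation given $\mathcal F_0$. $\widehat W^0_t:=t$, $\widehat W^i_t:=W^i_t$. Words: $I=(i_1,\ldots,i_k)\in\{0,\ldots,d\}^k$, $k\ge 0$, $\emptyset$ empty word, $|I|=k$, $I'=(i_1,\ldots,i_{k-1})$ for $I\ne\emptyset$, $\emptyset':=0$ (zero vector). Finite linear combinations $x=\sum_Hx_HH$ of words form a vector space; $xa:=\sum_Hx_H(H,a)$ appends letter $a$; $\langle\emptyset,x\rangle:=x_\emptyset$. Signature: $\langle\emptyset,\widehat{\mathbb W}_t\rangle=1$, $\langle I,\widehat{\mathbb W}_t\rangle=\int_0^t\int_0^{t_k}\cdots\int_0^{t_2}1\,d\widehat W^{i_1}_{t_1}\cdots d\widehat W^{i_k}_{t_k}$ (iterated Itô integrals); $\langle c,\widehat{\mathbb W}_t\rangle:=\sum_Ic_I\langle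 I,\widehat{\mathbb W}_t\rangle$; $c_\emptyset$ is the coefficient of $\emptyset$. Star product: $\rho_{ij}:=1_{\{i=j>0\}}$; $\emptyset\star I=I\star\emptyset=I$ and for nonempty $I,J$: $I\star J=(I'\star J)i_{|I|}+(I\star J')j_{|J|}+\rho_{i_{|I|}j_{|J|}}(I'\star J')(0)$ (last term appends the letter $0$); extended bilinearly. Operators, for linear combination $d=\sum_Hd_HH$: $\mathcal G_{c,0}(d)=\sum_Hd_H1_{\{h_{|H|}=0\}}H'$; $\mathcal G_{c,1}(d)=\sum_{I,H}c_Id_H\,I'\star(H1_{\{i_{|I|}=0\}}+\rho_{i_{|I|},h_{|H|}}H')$; $\mathcal G_{c,2}(d)=\sum_{I,J,H}c_Ic_Jd_H\frac{\rho_{i_{|I|},j_{|J|}}}{2}I'\star J'\star H$ (terms referring to the last letter of the empty word vanish); $\mathcal G_{c,k_1,\ldots,k_n}:=\mathcal G_{c,k_n}\circ\mathcal G_{c,k_1,\ldots,k_{n-1}}$. $C^k_p(\mathbb R):=\{f\in C^k(\mathbb R):|f^{(j)}(x)|\le C(1+|x|^p)$ for some $C>0$, $p\in\mathbb N$, all $j\le k\}$. *)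

theory Defs
  imports "HOL-Probability.Probability"
begin

definition is_filtration :: "'a measure \<Rightarrow> (real \<Rightarrow> 'a measure) \<Rightarrow> bool" where
  "is_filtration M F \<longleftrightarrow>
     (\<forall>t. subalgebra M (F t)) \<and> (\<forall>s t. s \<le> t \<longrightarrow> sets (F s) \<subseteq> sets (F t))"

definition is_std_BM ::
  "'a measure \<Rightarrow> (real \<Rightarrow> 'a measure) \<Rightarrow> nat \<Rightarrow> (nat \<Rightarrow> real \<Rightarrow> 'a \<Rightarrow> real) \<Rightarrow> bool" where
  "is_std_BM M F d W \<longleftrightarrow>
     (\<forall>i\<in>{1..d}. \<forall>t\<ge>0. W i t \<in> borel_measurable (F t)) \<and>
     (\<forall>i\<in>{1..d}. \<forall>\<omega>\<in>space M. W i 0 \<omega> = 0 \<and> continuous_on {0..} (\<lambda>t. W i t \<omega>)) \<and>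
     (\<forall>s t. 0 \<le> s \<longrightarrow> s < t \<longrightarrow>
        (\<forall>A\<in>sets (F s). \<forall>B::nat \<Rightarrow> real set. (\<forall>i. B i \<in> sets borel) \<longrightarrow>
           measure M (A \<inter> {\<omega>\<in>space M. \<forall>i\<in>{1..d}. W i t \<omega> - W i s \<omega> \<in> B i})
           = measure M A *
             (\<Prod>i=1..d. measure (density lborel (normal_density 0 (sqrt (t - s)))) (B i))))"

definition hatW :: "(nat \<Rightarrow> real \<Rightarrow> 'a \<Rightarrow> real) \<Rightarrow> nat \<Rightarrow> real \<Rightarrow> 'a \<Rightarrow> real" where
  "hatW W a t \<omega> = (if a = 0 then t else W a t \<omega>)"

definition conv_in_prob :: "'a measure \<Rightarrow> (nat \<Rightarrow> 'a \<Rightarrow> real) \<Rightarrow> ('a \<Rightarrow> real) \<Rightarrow> bool" where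
  "conv_in_prob M X Y \<longleftrightarrow>
     (\<forall>\<epsilon>>0. (\<lambda>n. measure M {\<omega>\<in>space M. \<epsilon> < \<bar>X n \<omega> - Y \<omega>\<bar>}) \<longlonglongrightarrow> 0)"

text \<open>Words are lists of letters in {0..d}, written in order (i_1,...,i_k), last letter at the end.
  S I t is (a continuous version of) the iterated Ito integral; the Ito integral of a
  continuous adapted integrand is the limit in probability of left-point Riemann sums
  along dyadic partitions of [0,t].\<close>
definition is_signature ::
  "'a measure \<Rightarrow> nat \<Rightarrow> (nat \<Rightarrow> real \<Rightarrow> 'a \<Rightarrow> real) \<Rightarrow> (nat list \<Rightarrow> real \<Rightarrow> 'a \<Rightarrow> real) \<Rightarrow> bool" where
  "is_signature M d W S \<longleftrightarrow>
     (\<forall>t \<omega>. S [] t \<omega> = 1) \<and>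
     (\<forall>I. set I \<subseteq> {0..d} \<longrightarrow>
        (\<forall>\<omega>\<in>space M. continuous_on {0..} (\<lambda>t. S I t \<omega>)) \<and>
        (\<forall>t\<ge>0. S I t \<in> borel_measurable M)) \<and>
     (\<forall>I a t. set I \<subseteq> {0..d} \<longrightarrow> a \<le> d \<longrightarrow> 0 \<le> t \<longrightarrow>
        conv_in_prob M
          (\<lambda>n \<omega>. \<Sum>k<2^n. S I (t * real k / 2^n) \<omega> *
                   (hatW W a (t * real (Suc k) / 2^n) \<omega> - hatW W a (t * real k / 2^n) \<omega>))
          (S (I @ [a]) t))"

definition words :: "nat \<Rightarrow> nat \<Rightarrow> nat list list" where
  "words d L = concat (map (\<lambda>k. List.n_lists k [0..<Suc d]) [0..<Suc L])"

definition sigval :: "nat \<Rightarrow> nat \<Rightarrow> (nat list \<Rightarrow> 'a \<Rightarrow> real) \<Rightarrow> (nat list \<Rightarrow> real \<Rightarrow> 'a \<Rightarrow> real)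
    \<Rightarrow> real \<Rightarrow> 'a \<Rightarrow> real" where
  "sigval d L c S t \<omega> = (\<Sum>I\<leftarrow>words d L. c I \<omega> * S I t \<omega>)"

text \<open>A linear combination of words is represented as a formal sum: a finite list of
  (coefficient, word) pairs.  All operations below are linear, hence well defined.\<close>
type_synonym lc = "(real \<times> nat list) list"

definition emptycoef :: "lc \<Rightarrow> real" where
  "emptycoef x = (\<Sum>(r,w)\<leftarrow>x. if w = [] then r else 0)"

definition rho :: "nat \<Rightarrow> nat \<Rightarrow> bool" where
  "rho i j \<longleftrightarrow> i = j \<and> 0 < i"

definition lscale :: "real \<Rightarrow> lc \<Rightarrow> lc" where
  "lscale a x = map (\<lambda>(r,w). (a * r, w)) x"

definition lprep :: "nat \<Rightarrow> lc \<Rightarrow> lc" where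
  "lprep a x = map (\<lambda>(r,w). (r, a # w)) x"

text \<open>Star product on reversed words (last letter first).\<close>
fun rstar :: "nat list \<Rightarrow> nat list \<Rightarrow> lc" where
  "rstar [] J = [(1, J)]"
| "rstar (i # I) [] = [(1, i # I)]"
| "rstar (i # I) (j # J) =
     lprep i (rstar I (j # J)) @ lprep j (rstar (i # I) J) @
     (if rho i j then lprep 0 (rstar I J) else [])"

definition wstar :: "nat list \<Rightarrow> nat list \<Rightarrow> lc" where
  "wstar I J = map (\<lambda>(r,w). (r, rev w)) (rstar (rev I) (rev J))"

definition lstar :: "lc \<Rightarrow> lc \<Rightarrow> lc" where
  "lstar x y = concat (map (\<lambda>(a,u). concat (map (\<lambda>(b,v). lscale (a * b) (wstar u v)) y)) x)"

definition G0 :: "lc \<Rightarrow> lc" where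
  "G0 x = concat (map (\<lambda>(r,h). if h \<noteq> [] \<and> last h = 0 then [(r, butlast h)] else []) x)"

definition G1 :: "nat \<Rightarrow> nat \<Rightarrow> (nat list \<Rightarrow> real) \<Rightarrow> lc \<Rightarrow> lc" where
  "G1 d L cf x = concat (map (\<lambda>(r,h). concat (map (\<lambda>I.
      if I = [] then []
      else lstar [(cf I * r, butlast I)]
             ((if last I = 0 then [(1, h)] else []) @
              (if h \<noteq> [] \<and> rho (last I) (last h) then [(1, butlast h)] else [])))
      (words d L))) x)"

definition G2 :: "nat \<Rightarrow> nat \<Rightarrow> (nat list \<Rightarrow> real) \<Rightarrow> lc \<Rightarrow> lc" where
  "G2 d L cf x = concat (map (\<lambda>(r,h). concat (map (\<lambda>I. concat (map (\<lambda>J.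
      if I \<noteq> [] \<and> J \<noteq> [] \<and> rho (last I) (last J)
      then lstar (lstar [(cf I * cf J * r / 2, butlast I)] [(1, butlast J)]) [(1, h)]
      else [])
      (words d L))) (words d L))) x)"

definition Gk :: "nat \<Rightarrow> nat \<Rightarrow> (nat list \<Rightarrow> real) \<Rightarrow> nat \<Rightarrow> lc \<Rightarrow> lc" where
  "Gk d L cf k x = (if k = 0 then G0 x else if k = 1 then G1 d L cf x else G2 d L cf x)"

text \<open>G_{c,k_1,...,k_n} = G_{c,k_n} o ... o G_{c,k_1}: k_1 is applied first.\<close>
definition Gseq :: "nat \<Rightarrow> nat \<Rightarrow> (nat list \<Rightarrow> real) \<Rightarrow> nat list \<Rightarrow> lc \<Rightarrow> lc" where
  "Gseq d L cf ks x = fold (Gk d L cf) ks x"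

definition Ckp :: "nat \<Rightarrow> (real \<Rightarrow> real) \<Rightarrow> bool" where
  "Ckp k f \<longleftrightarrow>
     (\<forall>j<k. \<forall>x. ((deriv ^^ j) f has_real_derivative (deriv ^^ Suc j) f x) (at x)) \<and>
     continuous_on UNIV ((deriv ^^ k) f) \<and>
     (\<exists>C>0. \<exists>p::nat. \<forall>j\<le>k. \<forall>x. \<bar>(deriv ^^ j) f x\<bar> \<le> C * (1 + \<bar>x\<bar> ^ p))"

text \<open>Y is a version of the (generalized) conditional expectation of X given the
  sub-sigma-algebra G (X need only be integrable on a G-measurable exhausting sequence).\<close>
definition is_cond_exp :: "'a measure \<Rightarrow> 'a measure \<Rightarrow> ('a \<Rightarrow> real) \<Rightarrow> ('a \<Rightarrow> real) \<Rightarrow> bool" where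
  "is_cond_exp M G X Y \<longleftrightarrow>
     Y \<in> borel_measurable G \<and>
     (\<exists>A::nat \<Rightarrow> 'a set. (\<forall>n. A n \<in> sets G) \<and> incseq A \<and> (\<Union>n. A n) = space M \<and>
        (\<forall>n. integrable M (\<lambda>\<omega>. indicator (A n) \<omega> * X \<omega>)) \<and>
        (\<forall>n. integrable M (\<lambda>\<omega>. indicator (A n) \<omega> * Y \<omega>)) \<and>
        (\<forall>n. \<forall>B\<in>sets G. (\<integral>\<omega>. indicator (A n \<inter> B) \<omega> * X \<omega> \<partial>M)
                        = (\<integral>\<omega>. indicator (A n \<inter> B) \<omega> * Y \<omega> \<partial>M)))"

definition expansion ::
  "nat \<Rightarrow> nat \<Rightarrow> nat \<Rightarrow> (real \<Rightarrow> real) \<Rightarrow> (nat list \<Rightarrow> real) \<Rightarrow> real \<Rightarrow> real" where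
  "expansion d L N f cf t =
     f (cf []) + (\<Sum>n=1..N. (1 / fact n) *
        (\<Sum>ks\<in>{ks. length ks = n \<and> set ks \<subseteq> {0..2}}.
            (deriv ^^ sum_list ks) f (cf []) * emptycoef (Gseq d L cf ks [(1, [])])) * t ^ n)"

end

theory Submission
  imports Defs
begin

text \<open>
  No stochastic calculus is used. On a grid of mesh \<open>h\<close> the iterated integrals are replaced by
  iterated left-point sums. Because Brownian increments are centred and independent of the past,
  these sums satisfy \<open>L\<^sup>2\<close> estimates of order \<open>h\<close>: they are Cauchy under refinement, they converge
  to the iterated Ito integrals, and they satisfy the product rule of the star product up to an
  error that vanishes with \<open>h\<close>. Hence, at a fixed time, the signature is almost surely a character
  of the star algebra. So powers of \<open>Y = \<langle>c, W\<rangle> - c\<^sub>\<emptyset>\<close> are again linear in the signature, all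
  moments are finite, and \<open>E \<langle>x, W\<^sub>t\<rangle>\<close> is the polynomial in \<open>t\<close> whose \<open>n\<close>-th derivative at \<open>0\<close>
  is the empty coefficient of \<open>G\<^sub>0\<^sup>n x\<close>. Since deleting a last letter acts on star products like
  a derivation (with an Ito correction for the letter \<open>0\<close>), \<open>G\<^sub>0\<close> applied to \<open>Y\<^sup>m \<star> x\<close> produces
  exactly the operators \<open>G\<^sub>1\<close> and \<open>G\<^sub>2\<close>; this identifies the moments of \<open>Y\<close> and gives
  \<open>E Y\<^bsup>2m\<^esup> = O(t\<^sup>m)\<close>. The expansion is then the Taylor expansion of \<open>f\<close> at \<open>c\<^sub>\<emptyset>\<close> to order \<open>2N\<close>.
  Finally the signature at time \<open>t\<close> is a limit of functions of increments independent of \<open>F\<^sub>0\<close>, so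
  the conditional expectation is the unconditional one with the coefficients frozen.
\<close>

subsection \<open>Random variables with finite moments\<close>

text \<open>Linear combinations are lists, and for lists the star product is commutative and
  associative only up to rearranging and collecting terms. No normal form is introduced: identities
  are checked after evaluation at a character, where the star product becomes multiplication of
  reals. One such evaluation does not determine the empty coefficient of an iterate of
  \<open>G0\<close>. The expectation as a function of time does: a polynomial vanishing for all
  positive \<open>t\<close> has zero coefficients, which is how \<open>ecoef_cong\<close> returns
  from evaluations to coefficients. On a grid of mesh \<open>h\<close> the mean-square errors are
  O(h). Along the meshes \<open>t / 4^n\<close> they are summable, which gives almost sure
  convergence of all words on one null set. As \<open>f\<close> has just \<open>2 * N\<close>
  continuous derivatives, its Taylor remainder is only o(y^(2N)) near 0; since the moment of
  \<open>Y\<close> of order \<open>2 * N\<close> is O(t^N), this is the precision claimed. The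
  coefficients are frozen before \<open>t\<close> tends to 0, so the expansion holds at every sample
  point and no null set depends on \<open>t\<close>.\<close>

context prob_space begin

text \<open>Asking for all moments makes the class closed under products, so integrability in the
  discrete estimates follows from the shape of the terms alone.\<close>

definition fin_mom :: "('a \<Rightarrow> real) \<Rightarrow> bool" where
  "fin_mom X \<longleftrightarrow> X \<in> borel_measurable M \<and> (\<forall>p::nat. integrable M (\<lambda>\<omega>. \<bar>X \<omega>\<bar> ^ p))"

lemma fin_mom_measurable: "fin_mom X \<Longrightarrow> X \<in> borel_measurable M"
  by (simp add: fin_mom_def)

lemma fin_mom_integrable: assumes "fin_mom X" shows "integrable M X"
proof -
  have "integrable M (\<lambda>\<omega>. \<bar>X \<omega>\<bar> ^ 1)" using assms unfolding fin_mom_def by blast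
  then have "integrable M (\<lambda>\<omega>. \<bar>X \<omega>\<bar>)" by simp
  then show ?thesis by (rule integrable_abs_cancel) (use assms in \<open>simp add: fin_mom_def\<close>)
qed

lemma fin_mom_const: "fin_mom (\<lambda>\<omega>. a)"
  by (auto simp: fin_mom_def)

lemma fin_mom_mult: assumes "fin_mom X" "fin_mom Y" shows "fin_mom (\<lambda>\<omega>. X \<omega> * Y \<omega>)"
  unfolding fin_mom_def
proof (intro conjI allI)
  have [measurable]: "X \<in> borel_measurable M" "Y \<in> borel_measurable M"
    using assms by (auto simp: fin_mom_def)
  show "(\<lambda>\<omega>. X \<omega> * Y \<omega>) \<in> borel_measurable M" by measurable
  fix p :: nat
  show "integrable M (\<lambda>\<omega>. \<bar>X \<omega> * Y \<omega>\<bar> ^ p)"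
  proof (rule Bochner_Integration.integrable_bound)
    show "integrable M (\<lambda>\<omega>. \<bar>X \<omega>\<bar> ^ (2*p) + \<bar>Y \<omega>\<bar> ^ (2*p))"
      using assms by (auto simp: fin_mom_def)
    have "a * b \<le> a^2 + b^2" for a b :: real
      using sum_squares_bound[of a b] zero_le_power2[of a] zero_le_power2[of b] by linarith
    note sq = this
    have "\<bar>x * y\<bar>^p \<le> \<bar>x\<bar>^(2*p) + \<bar>y\<bar>^(2*p)" for x y :: real
      using sq[of "\<bar>x\<bar>^p" "\<bar>y\<bar>^p"]
      by (simp add: abs_mult power_mult_distrib power_mult[symmetric] mult.commute[of p])
    then show "AE \<omega> in M. norm (\<bar>X \<omega> * Y \<omega>\<bar> ^ p) \<le> norm (\<bar>X \<omega>\<bar> ^ (2*p) + \<bar>Y \<omega>\<bar> ^ (2*p))"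
      by simp
  qed measurable
qed

lemma fin_mom_add: assumes "fin_mom X" "fin_mom Y" shows "fin_mom (\<lambda>\<omega>. X \<omega> + Y \<omega>)"
  unfolding fin_mom_def
proof (intro conjI allI)
  have [measurable]: "X \<in> borel_measurable M" "Y \<in> borel_measurable M"
    using assms by (auto simp: fin_mom_def)
  show "(\<lambda>\<omega>. X \<omega> + Y \<omega>) \<in> borel_measurable M" by measurable
  fix p :: nat
  show "integrable M (\<lambda>\<omega>. \<bar>X \<omega> + Y \<omega>\<bar> ^ p)"
  proof (rule Bochner_Integration.integrable_bound)
    show "integrable M (\<lambda>\<omega>. 2^p * (\<bar>X \<omega>\<bar> ^ p + \<bar>Y \<omega>\<bar> ^ p))"
      using assms by (auto simp: fin_mom_def)
    have "\<bar>a + b\<bar>^p \<le> 2^p * (\<bar>a\<bar>^p + \<bar>b\<bar>^p)" for a b :: real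
    proof -
      have "\<bar>a + b\<bar> ^ p \<le> (2 * max \<bar>a\<bar> \<bar>b\<bar>) ^ p" by (intro power_mono) auto
      also have "\<dots> \<le> 2^p * (\<bar>a\<bar>^p + \<bar>b\<bar>^p)"
        by (auto simp: power_mult_distrib max_def)
      finally show ?thesis .
    qed
    then show "AE \<omega> in M. norm (\<bar>X \<omega> + Y \<omega>\<bar> ^ p) \<le> norm (2^p * (\<bar>X \<omega>\<bar> ^ p + \<bar>Y \<omega>\<bar> ^ p))"
      by auto
  qed measurable
qed

lemma fin_mom_minus: "fin_mom X \<Longrightarrow> fin_mom (\<lambda>\<omega>. - X \<omega>)"
  using fin_mom_mult[OF fin_mom_const[of "-1"], of X] by simp

lemma fin_mom_diff: "fin_mom X \<Longrightarrow> fin_mom Y \<Longrightarrow> fin_mom (\<lambda>\<omega>. X \<omega> - Y \<omega>)"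
  using fin_mom_add[OF _ fin_mom_minus, of X Y] by simp

lemma fin_mom_power: "fin_mom X \<Longrightarrow> fin_mom (\<lambda>\<omega>. X \<omega> ^ n)"
  by (induction n) (simp_all add: fin_mom_const fin_mom_mult)

lemma fin_mom_sum: "(\<And>i. i \<in> A \<Longrightarrow> fin_mom (X i)) \<Longrightarrow> fin_mom (\<lambda>\<omega>. \<Sum>i\<in>A. X i \<omega>)"
  by (induction A rule: infinite_finite_induct) (simp_all add: fin_mom_const fin_mom_add)

lemmas fin_mom_intros = fin_mom_const fin_mom_mult fin_mom_add fin_mom_minus fin_mom_diff fin_mom_power fin_mom_sum



section \<open>Almost sure limits from moment bounds\<close>

abbreviation nsq :: "('a \<Rightarrow> real) \<Rightarrow> real" where
  "nsq X \<equiv> expectation (\<lambda>\<omega>. (X \<omega>)^2)"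

text \<open>A Borel-Cantelli argument: the expectations are summable, so the series of absolute
  values is almost surely finite and its terms tend to 0.\<close>

lemma geometric_L1_imp_AE_tendsto:
  assumes "\<And>n. integrable M (U n)" and "\<And>n. expectation (\<lambda>\<omega>. \<bar>U n \<omega>\<bar>) \<le> K * q ^ n"
    and "0 \<le> q" "q < 1"
  shows "AE \<omega> in M. (\<lambda>n. U n \<omega> :: real) \<longlonglongrightarrow> 0"
proof -
  have [measurable]: "U n \<in> borel_measurable M" for n using assms(1)[of n] by auto
  have K: "0 \<le> K" using order_trans[OF _ assms(2)[of 0]] by (simp add: integral_nonneg_AE)
  have "(\<integral>\<^sup>+\<omega>. (\<Sum>n. ennreal \<bar>U n \<omega>\<bar>) \<partial>M) = (\<Sum>n. \<integral>\<^sup>+\<omega>. ennreal \<bar>U n \<omega>\<bar> \<partial>M)"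
    by (rule nn_integral_suminf) auto
  also have "\<dots> = (\<Sum>n. ennreal (expectation (\<lambda>\<omega>. \<bar>U n \<omega>\<bar>)))"
    using assms(1) by (subst nn_integral_eq_integral) auto
  also have "\<dots> \<le> (\<Sum>n. ennreal (K * q^n))"
    by (intro suminf_le ennreal_leI assms) auto
  also have "\<dots> = ennreal (\<Sum>n. K * q^n)"
    using assms(3,4) K by (intro suminf_ennreal_eq summable_sums) (auto intro!: summable_mult)
  also have "\<dots> < \<infinity>" by simp
  finally have "AE \<omega> in M. (\<Sum>n. ennreal \<bar>U n \<omega>\<bar>) \<noteq> \<infinity>"
    by (intro nn_integral_PInf_AE) (auto simp: less_top)
  then show ?thesis
  proof eventually_elim
    case (elim \<omega>)
    then have "summable (\<lambda>n. \<bar>U n \<omega>\<bar>)"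
      by (intro summable_suminf_not_top) auto
    then show ?case
      using summable_LIMSEQ_zero tendsto_rabs_zero_iff by blast
  qed
qed

lemma geometric_L2_imp_AE_tendsto:
  assumes "\<And>n. U n \<in> borel_measurable M"
    and "\<And>n. integrable M (\<lambda>\<omega>. (U n \<omega>)^2)" and "\<And>n. nsq (U n) \<le> K * q ^ n"
    and "0 \<le> q" "q < 1"
  shows "AE \<omega> in M. (\<lambda>n. U n \<omega> :: real) \<longlonglongrightarrow> 0"
proof -
  have "AE \<omega> in M. (\<lambda>n. (U n \<omega>)^2) \<longlonglongrightarrow> 0"
    by (rule geometric_L1_imp_AE_tendsto[where K=K and q=q]) (use assms in auto)
  then show ?thesis
    by eventually_elim (auto dest!: tendsto_real_sqrt simp: tendsto_rabs_zero_iff)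
qed

lemma conv_in_prob_imp_AE_subseq:
  assumes [measurable]: "\<And>n. X n \<in> borel_measurable M" "Y \<in> borel_measurable M"
    and c: "conv_in_prob M X Y"
  shows "\<exists>r. strict_mono r \<and> (AE \<omega> in M. (\<lambda>n. X (r n) \<omega>) \<longlonglongrightarrow> Y \<omega>)"
proof -
  \<comment> \<open>Truncation at 1 turns convergence in probability into convergence in mean, which
    supplies the subsequence; once the truncated differences are small the truncation is
    inactive.\<close>
  define u where "u n \<omega> = min 1 \<bar>X n \<omega> - Y \<omega>\<bar>" for n \<omega>
  have [measurable]: "u n \<in> borel_measurable M" for n unfolding u_def by measurable
  have int: "integrable M (u n)" for n
    by (rule integrable_const_bound[where B=1]) (auto simp: u_def)
  have "(\<lambda>n. expectation (\<lambda>\<omega>. norm (u n \<omega>))) \<longlonglongrightarrow> 0"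
  proof (rule LIMSEQ_I)
    fix e :: real assume e: "0 < e"
    define A where "A n = {\<omega> \<in> space M. e/2 < \<bar>X n \<omega> - Y \<omega>\<bar>}" for n
    have [measurable]: "A n \<in> sets M" for n unfolding A_def by measurable
    have "(\<lambda>n. measure M (A n)) \<longlonglongrightarrow> 0"
      using c[unfolded conv_in_prob_def, rule_format, of "e/2"] e unfolding A_def by simp
    then obtain n0 where n0: "\<And>n. n \<ge> n0 \<Longrightarrow> measure M (A n) < e/2"
      using LIMSEQ_D[of "\<lambda>n. measure M (A n)" 0 "e/2"] e by auto
    show "\<exists>no. \<forall>n\<ge>no. norm (expectation (\<lambda>\<omega>. norm (u n \<omega>)) - 0) < e"
    proof (intro exI allI impI)
      fix n assume "n \<ge> n0"
      have "expectation (\<lambda>\<omega>. norm (u n \<omega>)) \<le> expectation (\<lambda>\<omega>. e/2 + indicator (A n) \<omega>)"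
      proof (rule integral_mono)
        show "integrable M (\<lambda>\<omega>. e/2 + indicator (A n) \<omega> :: real)"
          by (intro Bochner_Integration.integrable_add integrable_real_indicator)
            (auto simp: emeasure_eq_measure)
        show "integrable M (\<lambda>\<omega>. norm (u n \<omega>))" using int by (rule integrable_norm)
      qed (use e in \<open>auto simp: u_def A_def indicator_def min_def\<close>)
      also have "\<dots> = e/2 + measure M (A n)"
        by (subst Bochner_Integration.integral_add)
          (auto simp: prob_space emeasure_eq_measure intro!: integrable_real_indicator)
      also have "\<dots> < e" using n0[OF \<open>n \<ge> n0\<close>] by simp
      finally show "norm (expectation (\<lambda>\<omega>. norm (u n \<omega>)) - 0) < e"
        by (simp add: integral_nonneg_AE)
    qed
  qed
  from tendsto_L1_AE_subseq[OF int this] obtain r where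
    r: "strict_mono r" "AE \<omega> in M. (\<lambda>n. u (r n) \<omega>) \<longlonglongrightarrow> 0" by auto
  from r(2) have "AE \<omega> in M. (\<lambda>n. X (r n) \<omega>) \<longlonglongrightarrow> Y \<omega>"
  proof eventually_elim
    case (elim \<omega>)
    have "eventually (\<lambda>n. u (r n) \<omega> < 1) sequentially"
      using order_tendstoD(2)[OF elim] by auto
    then have "eventually (\<lambda>n. u (r n) \<omega> = \<bar>X (r n) \<omega> - Y \<omega>\<bar>) sequentially"
      by eventually_elim (auto simp: u_def)
    with elim have "(\<lambda>n. \<bar>X (r n) \<omega> - Y \<omega>\<bar>) \<longlonglongrightarrow> 0" by (simp add: tendsto_cong)
    then show ?case using LIM_zero_iff tendsto_rabs_zero_iff by blast
  qed
  with r(1) show ?thesis by auto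
qed

text \<open>Fatou's lemma: a mean-square bound uniform in \<open>n\<close> passes to an almost sure
  limit \<open>S\<close>, whose integrability is not known in advance.\<close>

lemma L2_bound_limit:
  assumes [measurable]: "\<And>n. Z n \<in> borel_measurable M" "S \<in> borel_measurable M" "D \<in> borel_measurable M"
    and "AE \<omega> in M. (\<lambda>n. Z n \<omega>) \<longlonglongrightarrow> S \<omega>"
    and int: "\<And>n. integrable M (\<lambda>\<omega>. (D \<omega> - Z n \<omega>)^2)"
    and "\<And>n. expectation (\<lambda>\<omega>. (D \<omega> - Z n \<omega>)^2) \<le> K" and "0 \<le> K"
  shows "integrable M (\<lambda>\<omega>. (D \<omega> - S \<omega>)^2)" "expectation (\<lambda>\<omega>. (D \<omega> - S \<omega>)^2) \<le> (K::real)"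
proof -
  have "(\<integral>\<^sup>+\<omega>. ennreal ((D \<omega> - S \<omega>)^2) \<partial>M) = (\<integral>\<^sup>+\<omega>. liminf (\<lambda>n. ennreal ((D \<omega> - Z n \<omega>)^2)) \<partial>M)"
    using assms(4) by (intro nn_integral_cong_AE, eventually_elim)
      (auto intro!: lim_imp_Liminf[symmetric] tendsto_intros)
  also have "\<dots> \<le> liminf (\<lambda>n. \<integral>\<^sup>+\<omega>. ennreal ((D \<omega> - Z n \<omega>)^2) \<partial>M)"
    by (rule nn_integral_liminf) auto
  also have "\<dots> \<le> ennreal K"
  proof (rule order_trans[OF Liminf_mono Liminf_const[THEN order_eq_refl]])
    show "\<forall>\<^sub>F n in sequentially. (\<integral>\<^sup>+\<omega>. ennreal ((D \<omega> - Z n \<omega>)^2) \<partial>M) \<le> ennreal K"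
      by (intro always_eventually allI) (subst nn_integral_eq_integral, auto intro: int assms ennreal_leI)
  qed auto
  finally have *: "(\<integral>\<^sup>+\<omega>. ennreal ((D \<omega> - S \<omega>)^2) \<partial>M) \<le> ennreal K" .
  show int: "integrable M (\<lambda>\<omega>. (D \<omega> - S \<omega>)^2)"
  proof (rule integrableI_bounded)
    show "(\<integral>\<^sup>+\<omega>. ennreal (norm ((D \<omega> - S \<omega>)^2)) \<partial>M) < \<infinity>"
      using order.strict_trans1[OF *, of \<infinity>] by simp
  qed measurable
  show "expectation (\<lambda>\<omega>. (D \<omega> - S \<omega>)^2) \<le> K"
    using * nn_integral_eq_integral[OF int] assms by simp
qed

text \<open>The algebra of words controls squares of linear combinations, hence even powers; the
  others follow because |x|^p is at most 1 + x^(2p).\<close>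

lemma fin_mom_of_even_powers:
  assumes "\<And>n. integrable M (\<lambda>\<omega>. (X \<omega>) ^ (2 * n))" "X \<in> borel_measurable M"
  shows "fin_mom X"
  unfolding fin_mom_def
proof (intro conjI allI)
  fix p :: nat
  have [measurable]: "X \<in> borel_measurable M" by fact
  show "integrable M (\<lambda>\<omega>. \<bar>X \<omega>\<bar> ^ p)"
  proof (rule Bochner_Integration.integrable_bound)
    show "integrable M (\<lambda>\<omega>. 1 + X \<omega> ^ (2*p))" using assms by auto
    have "\<bar>x\<bar>^p \<le> 1 + x^(2*p)" for x :: real
    proof -
      have "\<bar>x\<bar>^p \<le> 1 + (\<bar>x\<bar>^p)^2"
        using sum_squares_bound[of 1 "\<bar>x\<bar>^p"] zero_le_power[of "\<bar>x\<bar>" p, OF abs_ge_zero]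
        unfolding power_one by linarith
      then show ?thesis by (simp add: power_mult[symmetric] mult.commute power_even_abs)
    qed
    then show "AE \<omega> in M. norm (\<bar>X \<omega>\<bar> ^ p) \<le> norm (1 + X \<omega> ^ (2*p))"
      by (auto intro: order_trans)
  qed measurable
qed fact

end

subsection \<open>Brownian increments\<close>

locale brownian_motion = prob_space M
  for M :: "'a measure" +
  fixes F :: "real \<Rightarrow> 'a measure" and d :: nat and W :: "nat \<Rightarrow> real \<Rightarrow> 'a \<Rightarrow> real"
  assumes filt: "is_filtration M F" and BM: "is_std_BM M F d W"
begin

lemma space_F: "space (F s) = space M"
  using filt by (auto simp: is_filtration_def subalgebra_def)

lemma sets_F: "A \<in> sets (F s) \<Longrightarrow> A \<in> sets M"
  using filt by (auto simp: is_filtration_def subalgebra_def)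

lemma measurable_F: "X \<in> measurable (F s) N \<Longrightarrow> X \<in> measurable M N"
  using filt by (auto simp: is_filtration_def intro: measurable_from_subalg)

lemma measurable_F_mono:
  assumes "X \<in> measurable (F s) N" "s \<le> t" shows "X \<in> measurable (F t) N"
proof -
  have "sets (F s) \<subseteq> sets (F t)" using filt assms by (simp add: is_filtration_def)
  then show ?thesis using assms(1) unfolding measurable_def space_F by blast
qed

lemma W_measurable_F:
  assumes "i \<in> {1..d}" "0 \<le> s" "s \<le> t" shows "W i s \<in> borel_measurable (F t)"
proof (rule measurable_F_mono)
  show "W i s \<in> borel_measurable (F s)" using BM assms unfolding is_std_BM_def by blast
qed fact

definition inc :: "real \<Rightarrow> real \<Rightarrow> nat \<Rightarrow> 'a \<Rightarrow> real" where
  "inc s t i \<omega> = W i t \<omega> - W i s \<omega>"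

lemma inc_measurable: "i \<in> {1..d} \<Longrightarrow> 0 \<le> s \<Longrightarrow> s \<le> t \<Longrightarrow> inc s t i \<in> borel_measurable (F t)"
  unfolding inc_def[abs_def]
  by (intro borel_measurable_diff W_measurable_F) auto

lemma inc_joint:
  assumes "0 \<le> s" "s < t" "A \<in> sets (F s)" "\<And>i. B i \<in> sets borel"
  shows "prob (A \<inter> {\<omega>\<in>space M. \<forall>i\<in>{1..d}. inc s t i \<omega> \<in> B i}) = prob A *
     (\<Prod>i=1..d. measure (density lborel (normal_density 0 (sqrt (t - s)))) (B i))"
  using BM assms unfolding is_std_BM_def inc_def by blast

lemma prob_normal: "0 < h \<Longrightarrow> prob_space (density lborel (normal_density 0 (sqrt h)))"
  by (rule prob_space_normal_density) simp

lemma measure_normal_UNIV: "0 < h \<Longrightarrow> measure (density lborel (normal_density 0 (sqrt h))) UNIV = 1"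
  using prob_space.prob_space[OF prob_normal] by simp

lemma inc_marginal:
  assumes "0 \<le> s" "s < t" "i \<in> {1..d}" "B \<in> sets borel"
  shows "prob {\<omega>\<in>space M. inc s t i \<omega> \<in> B} = measure (density lborel (normal_density 0 (sqrt (t - s)))) B"
proof -
  \<comment> \<open>The other coordinates are left free by the whole line, which has measure
    1.\<close>
  define B' where "B' j = (if j = i then B else UNIV)" for j
  have "space M \<in> sets (F s)" using sets.top[of "F s"] space_F by simp
  moreover have "B' j \<in> sets borel" for j using assms by (simp add: B'_def)
  ultimately have "prob (space M \<inter> {\<omega>\<in>space M. \<forall>j\<in>{1..d}. inc s t j \<omega> \<in> B' j}) =
     (\<Prod>j=1..d. measure (density lborel (normal_density 0 (sqrt (t - s)))) (B' j))"
    using inc_joint[OF assms(1,2), of "space M" B'] unfolding prob_space by simp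
  also have "space M \<inter> {\<omega>\<in>space M. \<forall>j\<in>{1..d}. inc s t j \<omega> \<in> B' j} = {\<omega>\<in>space M. inc s t i \<omega> \<in> B}"
    using assms by (auto simp: B'_def)
  also have "(\<Prod>j=1..d. measure (density lborel (normal_density 0 (sqrt (t - s)))) (B' j)) =
    (\<Prod>j=1..d. if j = i then measure (density lborel (normal_density 0 (sqrt (t - s)))) B else 1)"
    using assms measure_normal_UNIV[of "t-s"] by (intro prod.cong) (auto simp: B'_def)
  also have "\<dots> = measure (density lborel (normal_density 0 (sqrt (t - s)))) B"
    using assms by (subst prod.delta) auto
  finally show ?thesis .
qed

lemma inc_distr:
  assumes "0 \<le> s" "s < t" "i \<in> {1..d}"
  shows "distr M borel (inc s t i) = density lborel (normal_density 0 (sqrt (t - s)))"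
proof (rule measure_eqI)
  have [measurable]: "inc s t i \<in> borel_measurable M"
    using inc_measurable[of i s t] assms measurable_F by auto
  fix B assume "B \<in> sets (distr M borel (inc s t i))"
  then have B: "B \<in> sets borel" by simp
  interpret N: prob_space "density lborel (normal_density 0 (sqrt (t - s)))"
    using assms by (intro prob_normal) auto
  show "emeasure (distr M borel (inc s t i)) B = emeasure (density lborel (normal_density 0 (sqrt (t - s)))) B"
    using B inc_marginal[OF assms B]
    by (simp add: emeasure_distr emeasure_eq_measure N.emeasure_eq_measure vimage_def Int_def conj_commute)
qed simp

text \<open>Letter 0 names time and not a Brownian coordinate, so its index is free to carry the
  past variable \<open>Z\<close>. Independence of the increments from the past and from each other
  becomes that of a single family.\<close>

lemma inc_indep:
  assumes "0 \<le> s" "s < t" and Z: "Z \<in> borel_measurable (F s)"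
  shows "indep_vars (\<lambda>_. borel) (\<lambda>i. if i = 0 then Z else inc s t i) {0..d}"
proof -
  define X where "X = (\<lambda>i. if i = 0 then Z else inc s t i)"
  have rv: "X i \<in> borel_measurable M" if "i \<in> {0..d}" for i
  proof (cases "i = 0")
    case True
    then show ?thesis using measurable_F[OF Z] by (simp add: X_def)
  next
    case False
    with that have "inc s t i \<in> borel_measurable (F t)" using assms by (intro inc_measurable) auto
    from measurable_F[OF this] show ?thesis using False by (simp add: X_def)
  qed
  have "prob (\<Inter>i\<in>{0..d}. A i) = (\<Prod>i\<in>{0..d}. prob (A i))"
    if A: "A \<in> (\<Pi> i\<in>{0..d}. {X i -` A \<inter> space M |A. A \<in> sets borel})" for A
  proof -
    have "\<exists>B. \<forall>i\<in>{0..d}. B i \<in> sets borel \<and> A i = X i -` B i \<inter> space M"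
      using A unfolding Pi_iff by (intro bchoice) auto
    then obtain B0 where B0: "\<And>i. i\<in>{0..d} \<Longrightarrow> B0 i \<in> sets borel \<and> A i = X i -` B0 i \<inter> space M" by blast
    \<comment> \<open>\<open>inc_joint\<close> wants Borel sets at every index, hence the extension
      by the whole line.\<close>
    define B where "B i = (if i \<in> {0..d} then B0 i else UNIV)" for i
    have B: "B i \<in> sets borel" for i using B0 by (auto simp: B_def)
    have A: "A i = X i -` B i \<inter> space M" if "i \<in> {0..d}" for i using B0 that by (auto simp: B_def)
    have A0: "A 0 \<in> sets (F s)"
      using A[of 0] B[of 0] measurable_sets[OF Z B[of 0]] by (simp add: X_def space_F)
    have "(\<Inter>i\<in>{0..d}. A i) = A 0 \<inter> {\<omega>\<in>space M. \<forall>i\<in>{1..d}. inc s t i \<omega> \<in> B i}"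
    proof -
      have "A i = {\<omega>\<in>space M. inc s t i \<omega> \<in> B i}" if "i \<in> {1..d}" for i
        using A[of i] that by (auto simp: X_def)
      moreover have "{0..d} = insert 0 {1..d}" by auto
      moreover have "A 0 \<subseteq> space M" using A[of 0] by auto
      ultimately show ?thesis by auto
    qed
    then have "prob (\<Inter>i\<in>{0..d}. A i) = prob (A 0) *
        (\<Prod>i=1..d. measure (density lborel (normal_density 0 (sqrt (t - s)))) (B i))"
      using inc_joint[OF assms(1,2) A0 B] by simp
    also have "(\<Prod>i=1..d. measure (density lborel (normal_density 0 (sqrt (t - s)))) (B i)) = (\<Prod>i=1..d. prob (A i))"
    proof (intro prod.cong refl)
      fix i assume i: "i \<in> {1..d}"
      have "A i = {\<omega>\<in>space M. inc s t i \<omega> \<in> B i}" using A[of i] i by (auto simp: X_def)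
      then show "measure (density lborel (normal_density 0 (sqrt (t - s)))) (B i) = prob (A i)"
        using inc_marginal[OF assms(1,2) i B[of i]] by simp
    qed
    also have "prob (A 0) * (\<Prod>i=1..d. prob (A i)) = (\<Prod>i\<in>{0..d}. prob (A i))"
      by (simp add: prod.atLeast_Suc_atMost)
    finally show ?thesis .
  qed
  moreover have "space M \<in> {X i -` A \<inter> space M |A. A \<in> sets borel}" for i
    by (auto intro!: exI[of _ UNIV])
  moreover have "{X i -` A \<inter> space M |A. A \<in> sets borel} \<subseteq> events" if "i \<in> {0..d}" for i
    using rv[OF that] measurable_sets by auto
  ultimately have "indep_sets (\<lambda>i. {X i -` A \<inter> space M |A. A \<in> sets borel}) {0..d}"
    by (subst indep_sets_finite) auto
  then have "indep_vars (\<lambda>_. borel) X {0..d}"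
    using rv unfolding indep_vars_def2 by blast
  then show ?thesis unfolding X_def .
qed

lemma inc_has_moment:
  assumes "0 \<le> s" "s < t" "i \<in> {1..d}"
    and "has_bochner_integral lborel (\<lambda>x. normal_density 0 (sqrt (t - s)) x * g x) c"
    and [measurable]: "g \<in> borel_measurable borel"
  shows "integrable M (\<lambda>\<omega>. g (inc s t i \<omega>))" "expectation (\<lambda>\<omega>. g (inc s t i \<omega>)) = (c::real)"
proof -
  have [measurable]: "inc s t i \<in> borel_measurable M"
    using inc_measurable[of i s t] assms measurable_F by auto
  have "has_bochner_integral (distr M borel (inc s t i)) g c"
    unfolding inc_distr[OF assms(1-3)]
    using assms(4) by (intro has_bochner_integral_density) auto
  then show "integrable M (\<lambda>\<omega>. g (inc s t i \<omega>))" "expectation (\<lambda>\<omega>. g (inc s t i \<omega>)) = c"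
    using integrable_distr_eq[of "inc s t i" M borel g] integral_distr[of "inc s t i" M borel g]
    by (simp_all add: has_bochner_integral_iff)
qed

lemma fin_mom_inc:
  assumes "0 \<le> s" "s < t" "i \<in> {1..d}"
  shows "fin_mom (inc s t i)"
  unfolding fin_mom_def
proof (intro conjI allI)
  show "inc s t i \<in> borel_measurable M"
    using inc_measurable[of i s t] assms measurable_F by auto
  fix p
  have "integrable lborel (\<lambda>x. normal_density 0 (sqrt (t - s)) x * \<bar>x - 0\<bar> ^ p)"
    using assms by (intro integrable_normal_moment_abs) auto
  then have "has_bochner_integral lborel (\<lambda>x. normal_density 0 (sqrt (t - s)) x * \<bar>x\<bar> ^ p)
     (\<integral>x. normal_density 0 (sqrt (t - s)) x * \<bar>x\<bar> ^ p \<partial>lborel)"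
    by (simp add: has_bochner_integral_iff)
  from inc_has_moment(1)[OF assms this] show "integrable M (\<lambda>\<omega>. \<bar>inc s t i \<omega>\<bar> ^ p)" by simp
qed

lemma inc_moments:
  assumes "0 \<le> s" "s < t" "i \<in> {1..d}"
  shows "expectation (inc s t i) = 0" "nsq (inc s t i) = t - s"
    "expectation (\<lambda>\<omega>. (inc s t i \<omega>)^4) = 3 * (t - s)^2"
proof -
  have s: "sqrt (t - s) > 0" using assms by simp
  show "expectation (inc s t i) = 0"
    using inc_has_moment(2)[OF assms, of "\<lambda>x. x" 0] normal_moment_odd[OF s, of 0 0] by simp
  show "nsq (inc s t i) = t - s"
    using inc_has_moment(2)[OF assms, of "\<lambda>x. x^2" "t-s"] normal_moment_even[OF s, of 0 1] assms
    by (simp add: fact_numeral diff_divide_distrib)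
  show "expectation (\<lambda>\<omega>. (inc s t i \<omega>)^4) = 3 * (t - s)^2"
    using inc_has_moment(2)[OF assms, of "\<lambda>x. x^4" "3*(t-s)^2"] normal_moment_even[OF s, of 0 2] assms
    by (simp add: fact_numeral power_divide field_simps)
qed

lemma inc_product1:
  assumes "0 \<le> s" "s < t" "i \<in> {1..d}" "Z \<in> borel_measurable (F s)" "fin_mom Z"
  shows "expectation (\<lambda>\<omega>. Z \<omega> * inc s t i \<omega> ^ p) = expectation Z * expectation (\<lambda>\<omega>. inc s t i \<omega> ^ p)"
proof -
  let ?X = "\<lambda>i. if i = 0 then Z else inc s t i"
  have "indep_vars (\<lambda>_. borel) ?X {0..d}" by (rule inc_indep[OF assms(1,2,4)])
  then have "indep_vars (\<lambda>_. borel) ?X {0,i}"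
    by (rule indep_vars_subset) (use assms in auto)
  then have "indep_vars (\<lambda>_. borel) (\<lambda>j \<omega>. (if j = 0 then id else (\<lambda>x. x ^ p)) (?X j \<omega>)) {0,i}"
    by (rule indep_vars_compose2) auto
  moreover have "integrable M (\<lambda>\<omega>. (if k = 0 then id else (\<lambda>x. x ^ p)) (?X k \<omega>))" if "k \<in> {0,i}" for k
    using that fin_mom_integrable[OF fin_mom_power[OF fin_mom_inc[OF assms(1-3)]]] fin_mom_integrable[OF assms(5)] by auto
  ultimately show ?thesis
    using indep_vars_lebesgue_integral[of "{0,i}" "\<lambda>j \<omega>. (if j = 0 then id else (\<lambda>x. x ^ p)) (?X j \<omega>)"] assms(3)
    by auto
qed

lemma inc_product2:
  assumes "0 \<le> s" "s < t" "i \<in> {1..d}" "j \<in> {1..d}" "i \<noteq> j" "Z \<in> borel_measurable (F s)" "fin_mom Z"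
  shows "expectation (\<lambda>\<omega>. Z \<omega> * (inc s t i \<omega> ^ p * inc s t j \<omega> ^ p)) =
    expectation Z * (expectation (\<lambda>\<omega>. inc s t i \<omega> ^ p) * expectation (\<lambda>\<omega>. inc s t j \<omega> ^ p))"
proof -
  let ?X = "\<lambda>i. if i = 0 then Z else inc s t i"
  have "indep_vars (\<lambda>_. borel) ?X {0..d}" by (rule inc_indep[OF assms(1,2,6)])
  then have "indep_vars (\<lambda>_. borel) ?X {0,i,j}"
    by (rule indep_vars_subset) (use assms in auto)
  then have "indep_vars (\<lambda>_. borel) (\<lambda>j \<omega>. (if j = 0 then id else (\<lambda>x. x ^ p)) (?X j \<omega>)) {0,i,j}"
    by (rule indep_vars_compose2) auto
  moreover have "integrable M (\<lambda>\<omega>. (if k = 0 then id else (\<lambda>x. x ^ p)) (?X k \<omega>))" if "k \<in> {0,i,j}" for k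
    using that fin_mom_integrable[OF fin_mom_power[OF fin_mom_inc[OF assms(1,2,3)]]] fin_mom_integrable[OF assms(7)]
      fin_mom_integrable[OF fin_mom_power[OF fin_mom_inc[OF assms(1,2,4)]]] by auto
  ultimately show ?thesis
    using indep_vars_lebesgue_integral[of "{0,i,j}" "\<lambda>j \<omega>. (if j = 0 then id else (\<lambda>x. x ^ p)) (?X j \<omega>)"] assms(3-5)
    by auto
qed

section \<open>Adapted variables and martingale sums\<close>

definition adapted :: "real \<Rightarrow> ('a \<Rightarrow> real) \<Rightarrow> bool" where
  "adapted s X \<longleftrightarrow> X \<in> borel_measurable (F s) \<and> fin_mom X"

lemma adapted_fin_mom: "adapted s X \<Longrightarrow> fin_mom X" by (simp add: adapted_def)

lemma adapted_mono: "adapted s X \<Longrightarrow> s \<le> t \<Longrightarrow> adapted t X"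
  by (auto simp: adapted_def intro: measurable_F_mono)

lemma adapted_const: "adapted s (\<lambda>\<omega>. a)" by (simp add: adapted_def fin_mom_const)

lemma adapted_mult: "adapted s X \<Longrightarrow> adapted s Y \<Longrightarrow> adapted s (\<lambda>\<omega>. X \<omega> * Y \<omega>)"
  by (auto simp: adapted_def fin_mom_mult)

lemma adapted_add: "adapted s X \<Longrightarrow> adapted s Y \<Longrightarrow> adapted s (\<lambda>\<omega>. X \<omega> + Y \<omega>)"
  by (auto simp: adapted_def fin_mom_add)

lemma adapted_diff: "adapted s X \<Longrightarrow> adapted s Y \<Longrightarrow> adapted s (\<lambda>\<omega>. X \<omega> - Y \<omega>)"
  by (auto simp: adapted_def fin_mom_diff)

lemma adapted_power: "adapted s X \<Longrightarrow> adapted s (\<lambda>\<omega>. X \<omega> ^ n)"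
  by (auto simp: adapted_def fin_mom_power)

lemma adapted_sum: "(\<And>i. i \<in> A \<Longrightarrow> adapted s (X i)) \<Longrightarrow> adapted s (\<lambda>\<omega>. \<Sum>i\<in>A. X i \<omega>)"
  unfolding adapted_def by (intro conjI borel_measurable_sum fin_mom_sum) blast+

lemma adapted_inc: "0 \<le> s \<Longrightarrow> s < t \<Longrightarrow> i \<in> {1..d} \<Longrightarrow> adapted t (inc s t i)"
  by (simp add: adapted_def fin_mom_inc inc_measurable)

text \<open>The two hypotheses on \<open>U\<close> say that it is conditionally centred with conditional
  second moment at most \<open>v\<close>.\<close>
lemma martingale_L2_bound:
  assumes "\<And>j::nat. adapted (\<tau> j) (Z j)" "\<And>j. adapted (\<tau> (Suc j)) (U j)" "\<And>j. \<tau> j \<le> \<tau> (Suc j)"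
    and "\<And>j Y. adapted (\<tau> j) Y \<Longrightarrow> expectation (\<lambda>\<omega>. Y \<omega> * U j \<omega>) = 0"
    and "\<And>j Y. adapted (\<tau> j) Y \<Longrightarrow> expectation (\<lambda>\<omega>. (Y \<omega>)^2 * (U j \<omega>)^2) \<le> v * nsq Y"
  shows "expectation (\<lambda>\<omega>. (\<Sum>j<k. Z j \<omega> * U j \<omega>)^2) \<le> v * (\<Sum>j<k. nsq (Z j))"
proof -
  let ?P = "\<lambda>k \<omega>. \<Sum>j<k. Z j \<omega> * U j \<omega>"
  have P: "adapted (\<tau> k) (?P k)" for k
  proof (induction k)
    case (Suc k)
    have "adapted (\<tau> (Suc k)) (\<lambda>\<omega>. ?P k \<omega> + Z k \<omega> * U k \<omega>)"
      by (intro adapted_add adapted_mult assms(2) adapted_mono[OF Suc] adapted_mono[OF assms(1)] assms(3))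
    then show ?case by simp
  qed (simp add: adapted_const)
  show ?thesis
  proof (induction k)
    case (Suc k)
    have fZ: "fin_mom (Z k)" "fin_mom (U k)" "fin_mom (?P k)"
      using assms(1,2) P adapted_fin_mom by blast+
    have int: "integrable M (\<lambda>\<omega>. (?P k \<omega>)^2)" "integrable M (\<lambda>\<omega>. (?P k \<omega> * Z k \<omega>) * U k \<omega>)"
       "integrable M (\<lambda>\<omega>. (Z k \<omega>)^2 * (U k \<omega>)^2)"
      by (intro fin_mom_integrable fin_mom_mult fin_mom_power fZ)+
    have "nsq (?P (Suc k)) =
      expectation (\<lambda>\<omega>. (?P k \<omega>)^2 + 2 * ((?P k \<omega> * Z k \<omega>) * U k \<omega>) + (Z k \<omega>)^2 * (U k \<omega>)^2)"
      by (intro Bochner_Integration.integral_cong) (auto simp: power2_eq_square algebra_simps)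
    also have "\<dots> = nsq (?P k) + 2 * expectation (\<lambda>\<omega>. (?P k \<omega> * Z k \<omega>) * U k \<omega>)
       + expectation (\<lambda>\<omega>. (Z k \<omega>)^2 * (U k \<omega>)^2)"
      using int by simp
    \<comment> \<open>The partial sum times \<open>Z k\<close> is adapted as well, so centredness of
      \<open>U k\<close> removes the mixed term.\<close>
    also have "expectation (\<lambda>\<omega>. (?P k \<omega> * Z k \<omega>) * U k \<omega>) = 0"
      by (intro assms(4) adapted_mult P assms(1))
    also have "nsq (?P k) + 2 * 0 + expectation (\<lambda>\<omega>. (Z k \<omega>)^2 * (U k \<omega>)^2) \<le>
      v * (\<Sum>j<k. nsq (Z j)) + v * nsq (Z k)"
      using Suc assms(5)[OF assms(1), of k] by simp
    finally show ?case by (simp add: algebra_simps)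
  qed simp
qed

end

subsection \<open>The discrete signature\<close>

context brownian_motion begin

definition Del :: "real \<Rightarrow> nat \<Rightarrow> nat \<Rightarrow> 'a \<Rightarrow> real" where
  "Del h a j \<omega> = hatW W a (h * real (Suc j)) \<omega> - hatW W a (h * real j) \<omega>"

lemma Del_0: "Del h 0 j \<omega> = h"
  by (simp add: Del_def hatW_def algebra_simps)

lemma Del_inc: "a \<noteq> 0 \<Longrightarrow> Del h a j = inc (h * real j) (h * real (Suc j)) a"
  by (auto simp: Del_def hatW_def inc_def)

lemma Del_refine:
  assumes "0 < r"
  shows "Del h a j \<omega> = (\<Sum>i<r. Del (h / real r) a (j * r + i) \<omega>)"
proof -
  let ?f = "\<lambda>i. hatW W a (h / real r * real (j * r + i)) \<omega>"
  have "(\<Sum>i<r. Del (h / real r) a (j * r + i) \<omega>) = (\<Sum>i<r. ?f (Suc i) - ?f i)"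
    by (simp add: Del_def)
  also have "\<dots> = ?f r - ?f 0" by (rule sum_lessThan_telescope)
  also have "\<dots> = Del h a j \<omega>"
  proof -
    have "h / real r * real (j * r + r) = h * real (Suc j)" "h / real r * real (j * r + 0) = h * real j"
      using assms by (simp_all add: field_simps)
    then show ?thesis by (simp only: Del_def)
  qed
  finally show ?thesis ..
qed

lemma adapted_Del:
  assumes "0 < h" "a \<le> d" shows "adapted (h * real (Suc j)) (Del h a j)"
proof (cases "a = 0")
  case True
  then have "Del h a j = (\<lambda>\<omega>. h)" by (simp add: Del_0 fun_eq_iff)
  then show ?thesis by (simp add: adapted_const)
next
  case False
  have "adapted (h * real (Suc j)) (inc (h * real j) (h * real (Suc j)) a)"
    by (rule adapted_inc) (use assms False in auto)
  then show ?thesis using False by (simp only: Del_inc not_False_eq_True)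
qed

lemma expectation_Del:
  assumes "0 < h" "a \<le> d" "adapted (h * real j) Z"
  shows "expectation (\<lambda>\<omega>. Z \<omega> * Del h a j \<omega>) = (if a = 0 then h * expectation Z else 0)"
proof (cases "a = 0")
  case True then show ?thesis by (simp add: Del_0 mult.commute)
next
  case False
  then show ?thesis
    using inc_product1[of "h * real j" "h * real (Suc j)" a Z 1] inc_moments[of "h * real j" "h * real (Suc j)" a] assms
    by (simp add: Del_inc adapted_def)
qed

lemma expectation_Del_sq:
  assumes "0 < h" "a \<in> {1..d}" "adapted (h * real j) Z"
  shows "expectation (\<lambda>\<omega>. Z \<omega> * (Del h a j \<omega>)^2) = h * expectation Z"
proof -
  have "h * real (Suc j) - h * real j = h" by (simp add: algebra_simps)
  then show ?thesis
    using inc_product1[of "h * real j" "h * real (Suc j)" a Z 2] inc_moments(2)[of "h * real j" "h * real (Suc j)" a] assms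
    by (simp add: Del_inc adapted_def)
qed

text \<open>For a Brownian letter orthogonality gives \<open>h\<close> times the sum; for time,
  Cauchy-Schwarz over \<open>k\<close> terms gives \<open>h^2 * k\<close> times it. The constant
  covers both, so later inductions need no case split on letters.\<close>

lemma discrete_integral_bound:
  assumes "0 < h" "a \<le> d" "\<And>j. adapted (h * real j) (Z j)"
  shows "expectation (\<lambda>\<omega>. (\<Sum>j<k. Z j \<omega> * Del h a j \<omega>)^2) \<le> (1 + h * real k) * h * (\<Sum>j<k. nsq (Z j))"
proof (cases "a = 0")
  case True
  have fZ: "fin_mom (Z j)" for j using assms(3) adapted_fin_mom by blast
  have nn: "0 \<le> (\<Sum>j<k. nsq (Z j))" by (intro sum_nonneg) auto
  have "expectation (\<lambda>\<omega>. (\<Sum>j<k. Z j \<omega> * Del h a j \<omega>)^2) \<le> expectation (\<lambda>\<omega>. h^2 * real k * (\<Sum>j<k. (Z j \<omega>)^2))"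
  proof (rule integral_mono)
    show "integrable M (\<lambda>\<omega>. (\<Sum>j<k. Z j \<omega> * Del h a j \<omega>)^2)"
      unfolding True Del_0 by (intro fin_mom_integrable fin_mom_intros fZ)
    show "integrable M (\<lambda>\<omega>. h^2 * real k * (\<Sum>j<k. (Z j \<omega>)^2))"
      by (intro fin_mom_integrable fin_mom_intros fZ)
    fix \<omega>
    have "(\<Sum>j<k. Z j \<omega> * 1)^2 \<le> (\<Sum>j<k. (Z j \<omega>)^2) * (\<Sum>j<k. 1^2)"
      by (rule Cauchy_Schwarz_ineq_sum)
    then have "h^2 * (\<Sum>j<k. Z j \<omega>)^2 \<le> h^2 * ((\<Sum>j<k. (Z j \<omega>)^2) * real k)"
      by (intro mult_left_mono) auto
    then show "(\<Sum>j<k. Z j \<omega> * Del h a j \<omega>)^2 \<le> h^2 * real k * (\<Sum>j<k. (Z j \<omega>)^2)"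
      unfolding True Del_0 sum_distrib_right[symmetric] power_mult_distrib by (simp add: algebra_simps)
  qed
  also have "\<dots> = h^2 * real k * (\<Sum>j<k. nsq (Z j))"
    using fin_mom_integrable[OF fin_mom_power[OF fZ]] by simp
  also have "\<dots> \<le> (1 + h * real k) * h * (\<Sum>j<k. nsq (Z j))"
    using assms(1) nn by (intro mult_right_mono) (auto simp: power2_eq_square algebra_simps)
  finally show ?thesis .
next
  case False
  then have a: "a \<in> {1..d}" using assms by auto
  have nn: "0 \<le> (\<Sum>j<k. nsq (Z j))" by (intro sum_nonneg) auto
  have "expectation (\<lambda>\<omega>. (\<Sum>j<k. Z j \<omega> * Del h a j \<omega>)^2) \<le> h * (\<Sum>j<k. nsq (Z j))"
  proof (rule martingale_L2_bound[where \<tau>="\<lambda>j. h * real j"])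
    fix j Y assume Y: "adapted (h * real j) Y"
    show "expectation (\<lambda>\<omega>. Y \<omega> * Del h a j \<omega>) = 0"
      using expectation_Del[OF assms(1,2) Y] False by simp
    show "expectation (\<lambda>\<omega>. (Y \<omega>)^2 * (Del h a j \<omega>)^2) \<le> h * nsq Y"
      using expectation_Del_sq[OF assms(1) a adapted_power[OF Y]] by simp
  qed (use assms adapted_Del in auto)
  also have "\<dots> \<le> (1 + h * real k) * h * (\<Sum>j<k. nsq (Z j))"
    using assms(1) nn by (intro mult_right_mono) auto
  finally show ?thesis .
qed

text \<open>The compensated product of increments is a martingale difference. Its conditional second
  moment is \<open>3 * h^2 - 2 * h^2 + h^2 = 2 * h^2\<close> for equal letters, by the Gaussian
  fourth moment, and \<open>h^2\<close> for different ones.\<close>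

lemma quadratic_variation_bound:
  assumes "0 < h" "a \<in> {1..d}" "b \<in> {1..d}" "\<And>j. adapted (h * real j) (Z j)"
  shows "expectation (\<lambda>\<omega>. (\<Sum>j<k. Z j \<omega> * (Del h a j \<omega> * Del h b j \<omega> - (if a = b then h else 0)))^2)
    \<le> 2 * h^2 * (\<Sum>j<k. nsq (Z j))"
proof (rule martingale_L2_bound[where \<tau>="\<lambda>j. h * real j"])
  fix j
  have D: "adapted (h * real (Suc j)) (Del h a j)" "adapted (h * real (Suc j)) (Del h b j)"
    using assms adapted_Del by auto
  show "adapted (h * real (Suc j)) (\<lambda>\<omega>. Del h a j \<omega> * Del h b j \<omega> - (if a = b then h else 0))"
    by (intro adapted_diff adapted_mult adapted_const D)
  have fD: "fin_mom (Del h a j)" "fin_mom (Del h b j)" using D adapted_fin_mom by auto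
  fix Y assume Y: "adapted (h * real j) Y"
  then have fY: "fin_mom Y" by (rule adapted_fin_mom)
  have h: "h * real (Suc j) - h * real j = h" by (simp add: algebra_simps)
  have s: "0 \<le> h * real j" "h * real j < h * real (Suc j)" using assms by auto
  have Y2: "adapted (h * real j) (\<lambda>\<omega>. (Y \<omega>)^2)" by (rule adapted_power[OF Y])
  show "expectation (\<lambda>\<omega>. Y \<omega> * (Del h a j \<omega> * Del h b j \<omega> - (if a = b then h else 0))) = 0"
  proof (cases "a = b")
    case True
    have "expectation (\<lambda>\<omega>. Y \<omega> * (Del h a j \<omega> * Del h b j \<omega> - (if a = b then h else 0))) =
      expectation (\<lambda>\<omega>. Y \<omega> * (Del h a j \<omega>)^2 - h * Y \<omega>)"
      using True by (intro Bochner_Integration.integral_cong) (auto simp: power2_eq_square algebra_simps)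
    also have "\<dots> = expectation (\<lambda>\<omega>. Y \<omega> * (Del h a j \<omega>)^2) - expectation (\<lambda>\<omega>. h * Y \<omega>)"
      by (rule Bochner_Integration.integral_diff) (intro fin_mom_integrable fin_mom_intros fY fD)+
    also have "\<dots> = 0" using expectation_Del_sq[OF assms(1,2) Y] by simp
    finally show ?thesis .
  next
    case False
    then show ?thesis
      using inc_product2[OF s assms(2,3) False, of Y 1] inc_moments(1)[OF s assms(2)] Y assms(2,3)
      by (simp add: Del_inc adapted_def)
  qed
  show "expectation (\<lambda>\<omega>. (Y \<omega>)^2 * (Del h a j \<omega> * Del h b j \<omega> - (if a = b then h else 0))^2)
      \<le> 2 * h^2 * nsq Y"
  proof (cases "a = b")
    case True
    have "expectation (\<lambda>\<omega>. (Y \<omega>)^2 * (Del h a j \<omega> * Del h b j \<omega> - (if a = b then h else 0))^2) =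
      expectation (\<lambda>\<omega>. (Y \<omega>)^2 * (Del h a j \<omega>)^4 - (2 * h) * ((Y \<omega>)^2 * (Del h a j \<omega>)^2) + h^2 * (Y \<omega>)^2)"
      using True by (intro Bochner_Integration.integral_cong)
        (auto simp: power2_eq_square power4_eq_xxxx algebra_simps)
    also have "\<dots> = expectation (\<lambda>\<omega>. (Y \<omega>)^2 * (Del h a j \<omega>)^4) - expectation (\<lambda>\<omega>. (2 * h) * ((Y \<omega>)^2 * (Del h a j \<omega>)^2))
        + expectation (\<lambda>\<omega>. h^2 * (Y \<omega>)^2)"
      by (subst Bochner_Integration.integral_add, (intro fin_mom_integrable fin_mom_intros fY fD)+,
          subst Bochner_Integration.integral_diff, (intro fin_mom_integrable fin_mom_intros fY fD)+) simp
    also have "expectation (\<lambda>\<omega>. (2 * h) * ((Y \<omega>)^2 * (Del h a j \<omega>)^2)) = 2 * h^2 * nsq Y"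
      using expectation_Del_sq[OF assms(1,2) Y2] by (simp add: power2_eq_square[of h])
    also have "expectation (\<lambda>\<omega>. (Y \<omega>)^2 * (Del h a j \<omega>)^4) = 3 * h^2 * nsq Y"
      using inc_product1[OF s assms(2), of "\<lambda>\<omega>. (Y \<omega>)^2" 4] inc_moments(3)[OF s assms(2)] Y2 assms(2) h
      by (simp add: Del_inc adapted_def)
    finally show ?thesis by simp
  next
    case False
    have "expectation (\<lambda>\<omega>. (Y \<omega>)^2 * (Del h a j \<omega> * Del h b j \<omega> - (if a = b then h else 0))^2)
      = h^2 * nsq Y"
      using False inc_product2[OF s assms(2,3) False, of "\<lambda>\<omega>. (Y \<omega>)^2" 2] inc_moments(2)[OF s assms(2)]
        inc_moments(2)[OF s assms(3)] Y2 assms(2,3) h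
      by (simp add: Del_inc adapted_def power_mult_distrib power2_eq_square[of h])
    also have "\<dots> \<le> 2 * h^2 * nsq Y"
      by (intro mult_right_mono) auto
    finally show ?thesis .
  qed
qed (use assms in auto)

text \<open>Words are reversed here, last letter first.\<close>
fun Dsig :: "real \<Rightarrow> nat list \<Rightarrow> nat \<Rightarrow> 'a \<Rightarrow> real" where
  "Dsig h [] k \<omega> = 1"
| "Dsig h (a # w) k \<omega> = (\<Sum>j<k. Dsig h w j \<omega> * Del h a j \<omega>)"

section \<open>Mean-square bounds for discrete iterated integrals\<close>

lemma adapted_Dsig:
  assumes "0 < h" "set w \<subseteq> {0..d}"
  shows "adapted (h * real k) (Dsig h w k)"
  using assms(2)
proof (induction w arbitrary: k)
  case Nil
  have "Dsig h [] k = (\<lambda>\<omega>. 1)" by (simp add: fun_eq_iff)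
  then show ?case by (simp add: adapted_const)
next
  case (Cons a w)
  have "Dsig h (a # w) k = (\<lambda>\<omega>. \<Sum>j<k. Dsig h w j \<omega> * Del h a j \<omega>)" by (simp add: fun_eq_iff)
  moreover have "adapted (h * real k) (\<lambda>\<omega>. \<Sum>j<k. Dsig h w j \<omega> * Del h a j \<omega>)"
  proof (intro adapted_sum adapted_mult)
    fix j assume "j \<in> {..<k}"
    then have le: "h * real j \<le> h * real k" "h * real (Suc j) \<le> h * real k" using assms(1) by auto
    show "adapted (h * real k) (Dsig h w j)" by (rule adapted_mono[OF Cons.IH le(1)]) (use Cons in auto)
    show "adapted (h * real k) (Del h a j)" by (rule adapted_mono[OF adapted_Del le(2)]) (use Cons assms in auto)
  qed
  ultimately show ?case by simp
qed

lemma fin_mom_Dsig: "0 < h \<Longrightarrow> set w \<subseteq> {0..d} \<Longrightarrow> fin_mom (Dsig h w k)"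
  using adapted_Dsig adapted_fin_mom by blast

lemma discrete_integral_uniform_bound:
  assumes "0 < h" "a \<le> d" "\<And>j. adapted (h * real j) (Z j)" "\<And>j. j < k \<Longrightarrow> nsq (Z j) \<le> B"
    "h * real k \<le> T" "0 \<le> B"
  shows "expectation (\<lambda>\<omega>. (\<Sum>j<k. Z j \<omega> * Del h a j \<omega>)^2) \<le> (1 + T) * T * B"
proof -
  have "0 \<le> h * real k" using assms(1) by simp
  have "expectation (\<lambda>\<omega>. (\<Sum>j<k. Z j \<omega> * Del h a j \<omega>)^2) \<le> (1 + h * real k) * h * (\<Sum>j<k. nsq (Z j))"
    by (rule discrete_integral_bound) (use assms in auto)
  also have "\<dots> \<le> (1 + h * real k) * h * (\<Sum>j<k. B)"
    using assms \<open>0 \<le> h * real k\<close> by (intro mult_left_mono sum_mono) auto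
  also have "\<dots> = (1 + h * real k) * (h * real k) * B" by simp
  also have "\<dots> \<le> (1 + T) * T * B"
    using assms(5,6) \<open>0 \<le> h * real k\<close> by (intro mult_right_mono mult_mono) linarith+
  finally show ?thesis .
qed

lemma Dsig_L2_bound:
  assumes "set w \<subseteq> {0..d}" "0 \<le> T"
  shows "\<exists>K\<ge>0. \<forall>h k. 0 < h \<longrightarrow> h * real k \<le> T \<longrightarrow> nsq (Dsig h w k) \<le> K"
  using assms(1)
proof (induction w)
  case Nil
  then show ?case by (auto simp: prob_space intro!: exI[of _ 1])
next
  case (Cons a w)
  then obtain K where K: "K \<ge> 0" "\<And>h k. 0 < h \<Longrightarrow> h * real k \<le> T \<Longrightarrow> nsq (Dsig h w k) \<le> K"
    by auto
  show ?case
  proof (intro exI[of _ "(1 + T) * T * K"] conjI allI impI)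
    fix h k assume h: "0 < h" "h * real k \<le> T"
    have "expectation (\<lambda>\<omega>. (\<Sum>j<k. Dsig h w j \<omega> * Del h a j \<omega>)^2) \<le> (1 + T) * T * K"
    proof (rule discrete_integral_uniform_bound)
      fix j assume "j < k"
      then have "h * real j \<le> h * real k" using h by simp
      then show "nsq (Dsig h w j) \<le> K" using h by (intro K(2)) linarith+
    qed (use h K Cons adapted_Dsig in auto)
    then show "nsq (Dsig h (a # w) k) \<le> (1 + T) * T * K" by simp
  qed (use K assms in auto)
qed

text \<open>The factor \<open>h * real (k - l)\<close> is the elapsed time, as for a diffusion. It
  measures how far an integrand moves inside one cell of a coarser grid.\<close>

lemma Dsig_increment_bound:
  assumes "set w \<subseteq> {0..d}" "0 \<le> T"
  shows "\<exists>K\<ge>0. \<forall>h k l. 0 < h \<longrightarrow> l \<le> k \<longrightarrow> h * real k \<le> T \<longrightarrow>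
    expectation (\<lambda>\<omega>. (Dsig h w k \<omega> - Dsig h w l \<omega>)^2) \<le> K * h * real (k - l)"
proof (cases w)
  case Nil
  then show ?thesis by (auto intro!: exI[of _ 0])
next
  case (Cons a v)
  then have v: "set v \<subseteq> {0..d}" "a \<le> d" using assms by auto
  obtain K where K: "K \<ge> 0" "\<And>h k. 0 < h \<Longrightarrow> h * real k \<le> T \<Longrightarrow> nsq (Dsig h v k) \<le> K"
    using Dsig_L2_bound[OF v(1) assms(2)] by blast
  show ?thesis
  proof (intro exI[of _ "(1 + T) * K"] conjI allI impI)
    fix h k l assume h: "0 < h" "h * real k \<le> T" "l \<le> k"
    \<comment> \<open>Annulling the integrand before \<open>l\<close> keeps it adapted and turns the
      increment into one full discrete integral.\<close>
    define Z where "Z j = (if j < l then (\<lambda>\<omega>. 0) else Dsig h v j)" for j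
    have Z: "adapted (h * real j) (Z j)" for j
      using adapted_Dsig[OF h(1) v(1)] adapted_const by (simp add: Z_def)
    have "Dsig h w k \<omega> - Dsig h w l \<omega> = (\<Sum>j<k. Z j \<omega> * Del h a j \<omega>)" for \<omega>
    proof -
      have "(\<Sum>j<k. Z j \<omega> * Del h a j \<omega>) = (\<Sum>j\<in>{l..<k}. Z j \<omega> * Del h a j \<omega>) + (\<Sum>j<l. Z j \<omega> * Del h a j \<omega>)"
        using sum.atLeastLessThan_concat[OF le0 h(3), of "\<lambda>j. Z j \<omega> * Del h a j \<omega>"]
        by (simp add: lessThan_atLeast0)
      also have "(\<Sum>j<l. Z j \<omega> * Del h a j \<omega>) = 0" by (simp add: Z_def)
      also have "(\<Sum>j\<in>{l..<k}. Z j \<omega> * Del h a j \<omega>) = (\<Sum>j\<in>{l..<k}. Dsig h v j \<omega> * Del h a j \<omega>)"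
        by (intro sum.cong) (auto simp: Z_def)
      also have "\<dots> = (\<Sum>j<k. Dsig h v j \<omega> * Del h a j \<omega>) - (\<Sum>j<l. Dsig h v j \<omega> * Del h a j \<omega>)"
        using h(3) sum_diff_nat_ivl[of 0 l k "\<lambda>j. Dsig h v j \<omega> * Del h a j \<omega>"] by (simp add: lessThan_atLeast0)
      finally show ?thesis using Cons by simp
    qed
    then have "expectation (\<lambda>\<omega>. (Dsig h w k \<omega> - Dsig h w l \<omega>)^2) = expectation (\<lambda>\<omega>. (\<Sum>j<k. Z j \<omega> * Del h a j \<omega>)^2)"
      by simp
    also have "\<dots> \<le> (1 + h * real k) * h * (\<Sum>j<k. nsq (Z j))"
      by (rule discrete_integral_bound) (use h v Z in auto)
    also have "\<dots> \<le> (1 + T) * h * (\<Sum>j<k. if j < l then 0 else K)"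
    proof (intro mult_mono sum_mono)
      fix j assume "j \<in> {..<k}"
      then have "h * real j \<le> h * real k" using h by simp
      then have "h * real j \<le> T" using h by linarith
      then show "nsq (Z j) \<le> (if j < l then 0 else K)"
        using K(2)[OF h(1), of j] by (auto simp: Z_def)
    qed (use h assms in \<open>auto intro!: sum_nonneg\<close>)
    also have "(\<Sum>j<k. if j < l then 0 else K) = (\<Sum>j\<in>{l..<k}. K)"
      by (rule sum.mono_neutral_cong_right) auto
    finally show "expectation (\<lambda>\<omega>. (Dsig h w k \<omega> - Dsig h w l \<omega>)^2) \<le> (1 + T) * K * h * real (k - l)"
      using h(3) by (simp add: algebra_simps)
  qed (use K assms in auto)
qed

section \<open>Refinement of the grid\<close>

lemma expectation_sq_add:
  assumes "fin_mom X" "fin_mom Y"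
  shows "expectation (\<lambda>\<omega>. (X \<omega> + Y \<omega>)^2) \<le> 2 * nsq X + 2 * nsq Y"
proof -
  have "expectation (\<lambda>\<omega>. (X \<omega> + Y \<omega>)^2) \<le> expectation (\<lambda>\<omega>. 2 * (X \<omega>)^2 + 2 * (Y \<omega>)^2)"
  proof (rule integral_mono)
    show "integrable M (\<lambda>\<omega>. (X \<omega> + Y \<omega>)^2)" "integrable M (\<lambda>\<omega>. 2 * (X \<omega>)^2 + 2 * (Y \<omega>)^2)"
      by (intro fin_mom_integrable fin_mom_intros assms)+
    fix \<omega> show "(X \<omega> + Y \<omega>)^2 \<le> 2 * (X \<omega>)^2 + 2 * (Y \<omega>)^2"
      using zero_le_power2[of "X \<omega> - Y \<omega>"] unfolding power2_diff power2_sum by linarith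
  qed
  also have "\<dots> = 2 * nsq X + 2 * nsq Y"
    using fin_mom_integrable[OF fin_mom_power[OF assms(1)]] fin_mom_integrable[OF fin_mom_power[OF assms(2)]] by simp
  finally show ?thesis .
qed

text \<open>A sum over the coarse grid is a sum over the fine one whose integrand is frozen at the
  left end of its coarse cell. Coarse and fine integrals can then be subtracted term by
  term.\<close>

lemma sum_Del_refine:
  assumes "0 < r"
  shows "(\<Sum>j<k. f j * Del h a j \<omega>) = (\<Sum>i<k * r. f (i div r) * Del (h / real r) a i \<omega>)"
proof -
  have "(\<Sum>i<k * r. f (i div r) * Del (h / real r) a i \<omega>) =
     (\<Sum>j<k. \<Sum>i\<in>{j * r..<j * r + r}. f (i div r) * Del (h / real r) a i \<omega>)"
    by (rule sum.nat_group[symmetric])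
  also have "\<dots> = (\<Sum>j<k. \<Sum>i<r. f ((j * r + i) div r) * Del (h / real r) a (j * r + i) \<omega>)"
  proof (rule sum.cong[OF refl])
    fix j
    show "(\<Sum>i\<in>{j * r..<j * r + r}. f (i div r) * Del (h / real r) a i \<omega>) =
      (\<Sum>i<r. f ((j * r + i) div r) * Del (h / real r) a (j * r + i) \<omega>)"
      using sum.shift_bounds_nat_ivl[of "\<lambda>i. f (i div r) * Del (h / real r) a i \<omega>" 0 "j * r" r]
      by (simp add: lessThan_atLeast0 add.commute)
  qed
  also have "\<dots> = (\<Sum>j<k. \<Sum>i<r. f j * Del (h / real r) a (j * r + i) \<omega>)"
    by (intro sum.cong) auto
  also have "\<dots> = (\<Sum>j<k. f j * Del h a j \<omega>)"
    by (simp only: Del_refine[OF assms, of h a] sum_distrib_left)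
  finally show ?thesis ..
qed

lemma adapted_coarse:
  assumes "0 < h" "0 < r" "\<And>j. adapted (h * real j) (Z j)"
  shows "adapted (h / real r * real i) (Z (i div r))"
proof (rule adapted_mono[OF assms(3)])
  have "real (i div r) * real r \<le> real i"
    by (metis of_nat_mult of_nat_le_iff div_times_less_eq_dividend)
  then show "h * real (i div r) \<le> h / real r * real i"
    using assms by (simp add: field_simps)
qed

text \<open>Written on the fine grid, the two integrals differ only in the integrand. Its error is
  that of the shorter word at the start of the coarse cell plus the movement inside the cell, both
  O(h) in mean square. The bound is free of \<open>r\<close>, so the refinement may later go to
  infinity.\<close>

lemma Dsig_refine_bound:
  assumes "set w \<subseteq> {0..d}" "0 \<le> T"
  shows "\<exists>K\<ge>0. \<forall>h k r. 0 < h \<longrightarrow> h * real k \<le> T \<longrightarrow> 0 < r \<longrightarrow>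
    expectation (\<lambda>\<omega>. (Dsig h w k \<omega> - Dsig (h / real r) w (k * r) \<omega>)^2) \<le> K * h"
  using assms(1)
proof (induction w)
  case Nil
  then show ?case by (auto intro!: exI[of _ 0])
next
  case (Cons a w)
  then have w: "set w \<subseteq> {0..d}" "a \<le> d" by auto
  from Cons obtain K where K: "K \<ge> 0"
    "\<And>h k r. 0 < h \<Longrightarrow> h * real k \<le> T \<Longrightarrow> 0 < r \<Longrightarrow>
      expectation (\<lambda>\<omega>. (Dsig h w k \<omega> - Dsig (h / real r) w (k * r) \<omega>)^2) \<le> K * h" by auto
  obtain K' where K': "K' \<ge> 0" "\<And>h k l. 0 < h \<Longrightarrow> l \<le> k \<Longrightarrow> h * real k \<le> T \<Longrightarrow>
    expectation (\<lambda>\<omega>. (Dsig h w k \<omega> - Dsig h w l \<omega>)^2) \<le> K' * h * real (k - l)"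
    using Dsig_increment_bound[OF w(1) assms(2)] by blast
  show ?case
  proof (intro exI[of _ "(1 + T) * T * (2 * K + 2 * K')"] conjI allI impI)
    fix h k r assume h: "0 < h" "h * real k \<le> T" "0 < (r::nat)"
    define g where "g = h / real r"
    have g: "0 < g" "g * real r = h" using h by (auto simp: g_def)
    define Z where "Z i \<omega> = Dsig h w (i div r) \<omega> - Dsig g w i \<omega>" for i \<omega>
    have "Dsig h (a # w) k \<omega> - Dsig g (a # w) (k * r) \<omega> = (\<Sum>i<k * r. Z i \<omega> * Del g a i \<omega>)" for \<omega>
      unfolding Dsig.simps using sum_Del_refine[OF h(3), of "\<lambda>j. Dsig h w j \<omega>" h a \<omega> k]
      by (simp add: Z_def g_def sum_subtractf left_diff_distrib)
    then have "expectation (\<lambda>\<omega>. (Dsig h (a # w) k \<omega> - Dsig g (a # w) (k * r) \<omega>)^2) =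
      expectation (\<lambda>\<omega>. (\<Sum>i<k * r. Z i \<omega> * Del g a i \<omega>)^2)" by simp
    also have "\<dots> \<le> (1 + T) * T * ((2 * K + 2 * K') * h)"
    proof (rule discrete_integral_uniform_bound)
      show "adapted (g * real j) (Z j)" for j
        unfolding Z_def[abs_def] using adapted_coarse[OF h(1,3) adapted_Dsig[OF h(1) w(1)]] adapted_Dsig[OF g(1) w(1)]
        by (intro adapted_diff) (auto simp: g_def)
      show "g * real (k * r) \<le> T" using h(2) unfolding g(2)[symmetric] by (simp add: mult_ac)
      fix i assume i: "i < k * r"
      define j where "j = i div r"
      have jr: "j * r \<le> i" "i - j * r < r" 
        using h(3) by (auto simp: j_def minus_div_mult_eq_mod)
      have "j < k" using i h(3) by (simp add: j_def div_less_iff_less_mult)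
      then have jT: "h * real j \<le> T" using h by (meson less_imp_le mult_left_mono of_nat_mono order_trans)
      have "real i \<le> real (k * r)" using i by (simp only: of_nat_le_iff)
      then have iT: "g * real i \<le> T"
        using \<open>g * real (k * r) \<le> T\<close> g by (meson less_imp_le mult_left_mono order_trans)
      have "nsq (Z i) =
        expectation (\<lambda>\<omega>. ((Dsig h w j \<omega> - Dsig g w (j * r) \<omega>) + (- (Dsig g w i \<omega> - Dsig g w (j * r) \<omega>)))^2)"
        by (simp add: Z_def j_def)
      also have "\<dots> \<le> 2 * expectation (\<lambda>\<omega>. (Dsig h w j \<omega> - Dsig g w (j * r) \<omega>)^2) +
        2 * expectation (\<lambda>\<omega>. (- (Dsig g w i \<omega> - Dsig g w (j * r) \<omega>))^2)"
        by (intro expectation_sq_add fin_mom_intros fin_mom_Dsig h g w)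
      also have "\<dots> \<le> 2 * (K * h) + 2 * (K' * g * real (i - j * r))"
        using K(2)[OF h(1) jT h(3)] K'(2)[OF g(1) jr(1) iT] unfolding power2_minus g_def by linarith
      also have "\<dots> \<le> 2 * (K * h) + 2 * (K' * g * real r)"
        using jr(2) K' g by (intro add_left_mono mult_left_mono) auto
      also have "\<dots> = (2 * K + 2 * K') * h" using g by (simp add: algebra_simps)
      finally show "nsq (Z i) \<le> (2 * K + 2 * K') * h" .
    qed (use g w K K' h in auto)
    finally show "expectation (\<lambda>\<omega>. (Dsig h (a # w) k \<omega> - Dsig (h / real r) (a # w) (k * r) \<omega>)^2)
       \<le> (1 + T) * T * (2 * K + 2 * K') * h" by (simp add: g_def mult.assoc)
  qed (use K K' assms in auto)
qed

text \<open>These mixed sums have the shape of the Riemann sums in \<open>is_signature\<close>: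
  increments of mesh \<open>h\<close>, integrand computed on a finer grid. Only the movement of the
  integrand inside a coarse cell enters the error.\<close>

lemma Dsig_coarse_integrand_bound:
  assumes "set w \<subseteq> {0..d}" "a \<le> d" "0 \<le> T"
  shows "\<exists>K\<ge>0. \<forall>h k r. 0 < h \<longrightarrow> h * real k \<le> T \<longrightarrow> 0 < r \<longrightarrow>
    expectation (\<lambda>\<omega>. ((\<Sum>j<k. Dsig (h / real r) w (j * r) \<omega> * Del h a j \<omega>)
       - Dsig (h / real r) (a # w) (k * r) \<omega>)^2) \<le> K * h"
proof -
  obtain K' where K': "K' \<ge> 0" "\<And>h k l. 0 < h \<Longrightarrow> l \<le> k \<Longrightarrow> h * real k \<le> T \<Longrightarrow>
    expectation (\<lambda>\<omega>. (Dsig h w k \<omega> - Dsig h w l \<omega>)^2) \<le> K' * h * real (k - l)"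
    using Dsig_increment_bound[OF assms(1,3)] by blast
  show ?thesis
  proof (intro exI[of _ "(1 + T) * T * K'"] conjI allI impI)
    fix h k r assume h: "0 < h" "h * real k \<le> T" "0 < (r::nat)"
    define g where "g = h / real r"
    have g: "0 < g" "g * real r = h" using h by (auto simp: g_def)
    define Z where "Z i \<omega> = Dsig g w (i div r * r) \<omega> - Dsig g w i \<omega>" for i \<omega>
    have "(\<Sum>j<k. Dsig g w (j * r) \<omega> * Del h a j \<omega>) - Dsig g (a # w) (k * r) \<omega>
       = (\<Sum>i<k * r. Z i \<omega> * Del g a i \<omega>)" for \<omega>
      unfolding Dsig.simps using sum_Del_refine[OF h(3), of "\<lambda>j. Dsig g w (j * r) \<omega>" h a \<omega> k]
      by (simp add: Z_def g_def sum_subtractf left_diff_distrib)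
    then have "expectation (\<lambda>\<omega>. ((\<Sum>j<k. Dsig g w (j * r) \<omega> * Del h a j \<omega>) - Dsig g (a # w) (k * r) \<omega>)^2) =
      expectation (\<lambda>\<omega>. (\<Sum>i<k * r. Z i \<omega> * Del g a i \<omega>)^2)" by simp
    also have "\<dots> \<le> (1 + T) * T * (K' * h)"
    proof (rule discrete_integral_uniform_bound)
      show "adapted (g * real j) (Z j)" for j
        unfolding Z_def[abs_def]
        using adapted_mono[OF adapted_Dsig[OF g(1) assms(1), of "j div r * r"], of "g * real j"] adapted_Dsig[OF g(1) assms(1)] g
        by (intro adapted_diff) (auto simp del: of_nat_mult)
      show "g * real (k * r) \<le> T" using h(2) unfolding g(2)[symmetric] by (simp add: mult_ac)
      fix i assume i: "i < k * r"
      have jr: "i div r * r \<le> i" "i - i div r * r < r" 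
        using h(3) by (auto simp: minus_div_mult_eq_mod)
      have "real i \<le> real (k * r)" using i by (simp only: of_nat_le_iff)
      then have iT: "g * real i \<le> T"
        using \<open>g * real (k * r) \<le> T\<close> g by (meson less_imp_le mult_left_mono order_trans)
      have "nsq (Z i) = expectation (\<lambda>\<omega>. (Dsig g w i \<omega> - Dsig g w (i div r * r) \<omega>)^2)"
        by (simp add: Z_def power2_commute)
      also have "\<dots> \<le> K' * g * real (i - i div r * r)" by (rule K'(2)[OF g(1) jr(1) iT])
      also have "\<dots> \<le> K' * g * real r"
        using jr(2) K'(1) g(1) by (intro mult_left_mono of_nat_mono) auto
      finally show "nsq (Z i) \<le> K' * h" using g by (simp add: mult.assoc)
    qed (use g K' h assms in auto)
    finally show "expectation (\<lambda>\<omega>. ((\<Sum>j<k. Dsig (h / real r) w (j * r) \<omega> * Del h a j \<omega>)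
       - Dsig (h / real r) (a # w) (k * r) \<omega>)^2) \<le> (1 + T) * T * K' * h" by (simp add: g_def mult.assoc)
  qed (use K' assms in auto)
qed

end

subsection \<open>Convergence of the discrete signature\<close>

context prob_space begin

text \<open>Young's inequality with a free weight. The later choice \<open>c = 2^n\<close> plays a
  very small factor \<open>X\<close> off against a larger factor \<open>Y\<close>.\<close>

lemma integral_abs_mult_le:
  assumes "X \<in> borel_measurable M" "Y \<in> borel_measurable M"
    and "integrable M (\<lambda>\<omega>. (X \<omega>)^2)" "integrable M (\<lambda>\<omega>. (Y \<omega>)^2)" and "0 < (c::real)"
  shows "integrable M (\<lambda>\<omega>. X \<omega> * Y \<omega>)"
    "expectation (\<lambda>\<omega>. \<bar>X \<omega> * Y \<omega>\<bar>) \<le> c * nsq X + nsq Y / c"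
proof -
  have [measurable]: "X \<in> borel_measurable M" "Y \<in> borel_measurable M" by fact+
  have le: "\<bar>x * y\<bar> \<le> c * x^2 + y^2 / c" for x y :: real
  proof -
    have "0 \<le> (c * \<bar>x\<bar> - \<bar>y\<bar>)^2 + c * \<bar>x * y\<bar> * 1" using assms(5) by (intro add_nonneg_nonneg) auto
    also have "\<dots> = c * (c * x^2 + y^2 / c - \<bar>x * y\<bar>)"
      using assms(5) by (simp add: power2_diff power_mult_distrib abs_mult algebra_simps power2_eq_square)
    finally show ?thesis using assms(5) by (simp add: zero_le_mult_iff)
  qed
  show int: "integrable M (\<lambda>\<omega>. X \<omega> * Y \<omega>)"
  proof (rule Bochner_Integration.integrable_bound)
    show "integrable M (\<lambda>\<omega>. c * (X \<omega>)^2 + (Y \<omega>)^2 / c)" using assms by auto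
    show "AE \<omega> in M. norm (X \<omega> * Y \<omega>) \<le> norm (c * (X \<omega>)^2 + (Y \<omega>)^2 / c)"
      using order_trans[OF le abs_ge_self] by simp
  qed measurable
  have "expectation (\<lambda>\<omega>. \<bar>X \<omega> * Y \<omega>\<bar>) \<le> expectation (\<lambda>\<omega>. c * (X \<omega>)^2 + (Y \<omega>)^2 / c)"
    using assms int le by (intro integral_mono) auto
  also have "\<dots> = c * nsq X + nsq Y / c"
    using assms by simp
  finally show "expectation (\<lambda>\<omega>. \<bar>X \<omega> * Y \<omega>\<bar>) \<le> c * nsq X + nsq Y / c" .
qed

end

lemma (in brownian_motion) Del_L2_bound:
  assumes "0 < h" "a \<le> d" shows "nsq (Del h a j) \<le> (1 + h) * h"
proof (cases "a = 0")
  case True then show ?thesis using assms by (simp add: Del_0 prob_space power2_eq_square algebra_simps)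
next
  case False
  then have "nsq (Del h a j) = h"
    using expectation_Del_sq[OF assms(1) _ adapted_const[of "h * real j" 1], of a] assms by (simp add: prob_space)
  then show ?thesis using assms by (simp add: algebra_simps)
qed

locale ito_signature = brownian_motion M F d W
  for M :: "'a measure" and F :: "real \<Rightarrow> 'a measure" and d :: nat and W :: "nat \<Rightarrow> real \<Rightarrow> 'a \<Rightarrow> real" +
  fixes S :: "nat list \<Rightarrow> real \<Rightarrow> 'a \<Rightarrow> real"
  assumes sig: "is_signature M d W S"
begin

text \<open>Reversal puts the last letter at the head, matching the recursions of
  \<open>Dsig\<close> and \<open>rstar\<close>.\<close>

definition Sr :: "nat list \<Rightarrow> real \<Rightarrow> 'a \<Rightarrow> real" where "Sr w t = S (rev w) t"

lemma Sr_Nil: "Sr [] t \<omega> = 1"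
  using sig by (simp add: is_signature_def Sr_def)

lemma Sr_measurable:
  assumes "set w \<subseteq> {0..d}" "0 \<le> t" shows "Sr w t \<in> borel_measurable M"
proof -
  have "\<forall>I. set I \<subseteq> {0..d} \<longrightarrow> (\<forall>t\<ge>0. S I t \<in> borel_measurable M)"
    using sig unfolding is_signature_def by blast
  then show ?thesis using assms by (simp add: Sr_def)
qed

lemma Sr_Cons_conv:
  assumes "set w \<subseteq> {0..d}" "a \<le> d" "0 \<le> t"
  shows "conv_in_prob M (\<lambda>n \<omega>. \<Sum>j<2^n. Sr w (t / 2^n * real j) \<omega> * Del (t / 2^n) a j \<omega>) (Sr (a # w) t)"
proof -
  have "conv_in_prob M
          (\<lambda>n \<omega>. \<Sum>k<2^n. S (rev w) (t * real k / 2^n) \<omega> *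
                   (hatW W a (t * real (Suc k) / 2^n) \<omega> - hatW W a (t * real k / 2^n) \<omega>))
          (S (rev w @ [a]) t)"
  proof -
    have "\<forall>I a t. set I \<subseteq> {0..d} \<longrightarrow> a \<le> d \<longrightarrow> 0 \<le> t \<longrightarrow>
        conv_in_prob M
          (\<lambda>n \<omega>. \<Sum>k<2^n. S I (t * real k / 2^n) \<omega> *
                   (hatW W a (t * real (Suc k) / 2^n) \<omega> - hatW W a (t * real k / 2^n) \<omega>))
          (S (I @ [a]) t)"
      using sig unfolding is_signature_def by blast
    then show ?thesis using assms by simp
  qed
  then show ?thesis by (simp add: Sr_def Del_def)
qed

text \<open>The integrands in the given Riemann sums are not known to be adapted, so the isometry does
  not apply to them. They are first replaced by discrete sums on a grid refined by the factor
  \<open>k * 8^n\<close>, which is so fine that a bound summing the errors of all \<open>2^n\<close> terms suffices.\<close>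
lemma Dsig_Sr_L2:
  assumes "set w \<subseteq> {0..d}" "0 \<le> T"
  shows "\<exists>K\<ge>0. \<forall>h k. 0 < h \<longrightarrow> h * real k \<le> T \<longrightarrow>
    integrable M (\<lambda>\<omega>. (Dsig h w k \<omega> - Sr w (h * real k) \<omega>)^2) \<and>
    expectation (\<lambda>\<omega>. (Dsig h w k \<omega> - Sr w (h * real k) \<omega>)^2) \<le> K * h"
  using assms(1)
proof (induction w)
  case Nil
  then show ?case by (auto simp: Sr_Nil intro!: exI[of _ 0])
next
  case (Cons a w)
  then have w: "set w \<subseteq> {0..d}" "a \<le> d" "set (a # w) \<subseteq> {0..d}" by auto
  from Cons obtain K where K: "K \<ge> 0" and Kint: "\<And>h k. 0 < h \<Longrightarrow> h * real k \<le> T \<Longrightarrow>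
      integrable M (\<lambda>\<omega>. (Dsig h w k \<omega> - Sr w (h * real k) \<omega>)^2)"
    and Kle: "\<And>h k. 0 < h \<Longrightarrow> h * real k \<le> T \<Longrightarrow>
      expectation (\<lambda>\<omega>. (Dsig h w k \<omega> - Sr w (h * real k) \<omega>)^2) \<le> K * h" by auto
  obtain K1 where K1: "K1 \<ge> 0" "\<And>h k r. 0 < h \<Longrightarrow> h * real k \<le> T \<Longrightarrow> 0 < r \<Longrightarrow>
    expectation (\<lambda>\<omega>. ((\<Sum>j<k. Dsig (h / real r) w (j * r) \<omega> * Del h a j \<omega>)
       - Dsig (h / real r) (a # w) (k * r) \<omega>)^2) \<le> K1 * h"
    using Dsig_coarse_integrand_bound[OF w(1,2) assms(2)] by blast
  obtain K2 where K2: "K2 \<ge> 0" "\<And>h k r. 0 < h \<Longrightarrow> h * real k \<le> T \<Longrightarrow> 0 < r \<Longrightarrow>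
    expectation (\<lambda>\<omega>. (Dsig h (a # w) k \<omega> - Dsig (h / real r) (a # w) (k * r) \<omega>)^2) \<le> K2 * h"
    using Dsig_refine_bound[OF w(3) assms(2)] by blast
  show ?case
  \<comment> \<open>The constant of the refinement bound survives unchanged, since the limit is
    taken over refinements of the grid of mesh \<open>h\<close>.\<close>
  proof (intro exI[of _ K2] allI impI conjI)
    fix h k assume h: "0 < h" "h * real k \<le> T"
    define s where "s = h * real k"
    have s: "0 \<le> s" "s \<le> T" using h by (auto simp: s_def)
    have Sm: "Sr (a # w) s \<in> borel_measurable M" by (rule Sr_measurable) (use w s in auto)
    have Dm: "Dsig h (a # w) k \<in> borel_measurable M" by (rule fin_mom_measurable[OF fin_mom_Dsig[OF h(1) w(3)]])
    have *: "\<exists>Z. (\<forall>n. fin_mom (Z n)) \<and> (AE \<omega> in M. (\<lambda>n. Z n \<omega>) \<longlonglongrightarrow> Sr (a # w) s \<omega>) \<and>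
         (\<forall>n. expectation (\<lambda>\<omega>. (Dsig h (a # w) k \<omega> - Z n \<omega>)^2) \<le> K2 * h)"
    proof (cases "k = 0")
      \<comment> \<open>At time 0 the dyadic meshes would vanish; all increments are 0 there, and so
        is the limit.\<close>
      case True
      have "AE \<omega> in M. (\<lambda>n. 0) \<longlonglongrightarrow> Sr (a # w) s \<omega>"
        using conv_in_prob_imp_AE_subseq[of "\<lambda>n \<omega>. 0" "Sr (a # w) s"] Sr_Cons_conv[OF w(1,2) s(1)] Sm True
        by (simp add: s_def Del_def)
      then show ?thesis using True K2 h fin_mom_const
        by (intro exI[of _ "\<lambda>n \<omega>. 0"]) auto
    next
      case False
      then have s0: "0 < s" using h by (simp add: s_def)
      define hn where "hn n = s / 2^n" for n :: nat
      \<comment> \<open>Since \<open>s = h * real k\<close>, the factor \<open>k\<close> makes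
        \<open>g n\<close> equal to \<open>h / 16^n\<close>, so the fine grid refines both the
        dyadic grid and the grid of mesh \<open>h\<close>. The power \<open>8^n\<close> beats the
        \<open>4^n\<close> lost in the sum of errors below.\<close>
      define rn where "rn n = k * 8^n" for n :: nat
      define g where "g n = hn n / real (rn n)" for n
      define X where "X n \<omega> = (\<Sum>j<2^n. Sr w (hn n * real j) \<omega> * Del (hn n) a j \<omega>)" for n \<omega>
      define X' where "X' n \<omega> = (\<Sum>j<2^n. Dsig (g n) w (j * rn n) \<omega> * Del (hn n) a j \<omega>)" for n \<omega>
      define Z where "Z n = Dsig (g n) (a # w) (2^n * rn n)" for n
      have hn0: "0 < hn n" for n using s0 by (simp add: hn_def)
      have rn0: "0 < rn n" for n using False by (simp add: rn_def)
      have g0: "0 < g n" for n using hn0 rn0 by (simp add: g_def)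
      have hnT: "hn n * real (2^n) \<le> T" for n using s by (simp add: hn_def)
      have hn_le: "hn n \<le> T * (1/2)^n" for n using s by (simp add: hn_def power_divide divide_right_mono)
      have gh: "g n * real (j * rn n) = hn n * real j" for n j using rn0[of n] by (simp add: g_def)
      have hnj: "0 \<le> hn n * real j" for n j using hn0[of n] by simp
      have fDel: "fin_mom (Del (hn n) a j)" for n j using adapted_fin_mom[OF adapted_Del[OF hn0 w(2)]] .
      have Xm: "X n \<in> borel_measurable M" for n
        unfolding X_def[abs_def]
        by (intro borel_measurable_sum borel_measurable_times Sr_measurable w hnj fin_mom_measurable[OF fDel])
      have fX': "fin_mom (X' n)" for n
        unfolding X'_def[abs_def] by (intro fin_mom_sum fin_mom_mult fin_mom_Dsig g0 w fDel)
      have fZ: "fin_mom (Z n)" for n unfolding Z_def by (intro fin_mom_Dsig g0 w)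

      have XX': "AE \<omega> in M. (\<lambda>n. X n \<omega> - X' n \<omega>) \<longlonglongrightarrow> 0"
      proof (rule geometric_L1_imp_AE_tendsto[where q="1/2" and K="K * T + (1 + T) * T"])
        fix n
        define A where "A j \<omega> = Dsig (g n) w (j * rn n) \<omega> - Sr w (g n * real (j * rn n)) \<omega>" for j \<omega>
        have gT: "g n * real (j * rn n) \<le> T" if "j < 2^n" for j
        proof -
          have "hn n * real j \<le> hn n * real (2^n)"
            using that hn0[of n] by (intro mult_left_mono of_nat_mono) auto
          then show ?thesis using hnT[of n] unfolding gh by linarith
        qed
        have Am: "A j \<in> borel_measurable M" for j unfolding A_def[abs_def]
          by (intro borel_measurable_diff fin_mom_measurable[OF fin_mom_Dsig] Sr_measurable w g0) (simp only: gh hnj)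
        have Ai: "integrable M (\<lambda>\<omega>. (A j \<omega>)^2)" "nsq (A j) \<le> K * g n" if "j < 2^n" for j
          unfolding A_def using Kint[OF g0 gT[OF that]] Kle[OF g0 gT[OF that]] by auto
        have Di: "integrable M (\<lambda>\<omega>. (Del (hn n) a j \<omega>)^2)" for j
          by (intro fin_mom_integrable fin_mom_power fDel)
        have pi: "integrable M (\<lambda>\<omega>. A j \<omega> * Del (hn n) a j \<omega>)" if "j < 2^n" for j
          by (rule integral_abs_mult_le(1)[where c=1]) (use Am Ai that Di fin_mom_measurable[OF fDel] in auto)
        have eq: "X n \<omega> - X' n \<omega> = - (\<Sum>j<2^n. A j \<omega> * Del (hn n) a j \<omega>)" for \<omega>
          unfolding X_def X'_def A_def gh by (simp add: sum_subtractf left_diff_distrib)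
        show "integrable M (\<lambda>\<omega>. X n \<omega> - X' n \<omega>)"
          unfolding eq using pi by (intro integrable_minus Bochner_Integration.integrable_sum) auto
        have "expectation (\<lambda>\<omega>. \<bar>X n \<omega> - X' n \<omega>\<bar>) \<le> expectation (\<lambda>\<omega>. \<Sum>j<2^n. \<bar>A j \<omega> * Del (hn n) a j \<omega>\<bar>)"
          unfolding eq abs_minus_cancel using pi
          by (intro integral_mono integrable_abs Bochner_Integration.integrable_sum sum_abs) auto
        also have "\<dots> = (\<Sum>j<2^n. expectation (\<lambda>\<omega>. \<bar>A j \<omega> * Del (hn n) a j \<omega>\<bar>))"
          using pi by (intro Bochner_Integration.integral_sum integrable_abs) auto
        \<comment> \<open>Each of the \<open>2^n\<close> terms is charged with weight
          \<open>2^n\<close>, which costs \<open>4^n * g n\<close> up to the factor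
          \<open>K\<close>; the refinement makes this at most \<open>hn n\<close>, a geometric
          sequence.\<close>
        also have "\<dots> \<le> (\<Sum>j<(2::nat)^n. 2^n * (K * g n) + (1 + T) * hn n / 2^n)"
        proof (rule sum_mono)
          fix j :: nat assume "j \<in> {..<2^n}"
          then have j: "j < 2^n" by simp
          have "hn n \<le> s / 1" unfolding hn_def using s0 by (intro divide_left_mono) auto
          then have "hn n \<le> T" using s by simp
          have "expectation (\<lambda>\<omega>. \<bar>A j \<omega> * Del (hn n) a j \<omega>\<bar>) \<le>
             2^n * nsq (A j) + nsq (Del (hn n) a j) / 2^n"
            by (rule integral_abs_mult_le(2)) (use Am Ai j Di fin_mom_measurable[OF fDel] in auto)
          also have "\<dots> \<le> 2^n * (K * g n) + (1 + T) * hn n / 2^n"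
          proof (intro add_mono mult_left_mono divide_right_mono Ai j)
            have "nsq (Del (hn n) a j) \<le> (1 + hn n) * hn n"
              by (rule Del_L2_bound[OF hn0 w(2)])
            also have "\<dots> \<le> (1 + T) * hn n" using \<open>hn n \<le> T\<close> hn0[of n] by (intro mult_right_mono) auto
            finally show "nsq (Del (hn n) a j) \<le> (1 + T) * hn n" .
          qed auto
          finally show "expectation (\<lambda>\<omega>. \<bar>A j \<omega> * Del (hn n) a j \<omega>\<bar>) \<le> 2^n * (K * g n) + (1 + T) * hn n / 2^n" .
        qed
        also have "\<dots> = K * (2^n * 2^n * g n) + (1 + T) * hn n" by (simp add: field_simps)
        also have "\<dots> \<le> K * hn n + (1 + T) * hn n"
        proof (intro add_right_mono mult_left_mono K)
          have "(2::real)^n * 2^n = 4^n" by (simp add: power_mult_distrib[symmetric])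
          also have "\<dots> \<le> real (rn n)"
          proof -
            have "(4::nat)^n \<le> 8^n" by (rule power_mono) auto
            also have "\<dots> \<le> k * 8^n" using False by simp
            finally have "real (4^n) \<le> real (rn n)" unfolding rn_def by (rule of_nat_mono)
            then show ?thesis by simp
          qed
          finally have "2^n * 2^n * g n \<le> real (rn n) * g n" using g0[of n] by (intro mult_right_mono) auto
          also have "\<dots> = hn n" using rn0[of n] by (simp add: g_def)
          finally show "2^n * 2^n * g n \<le> hn n" .
        qed
        also have "K * hn n + (1 + T) * hn n \<le> (K + (1 + T)) * (T * (1/2)^n)"
          unfolding distrib_right[symmetric] using hn_le K assms(2) by (intro mult_left_mono) auto
        finally show "expectation (\<lambda>\<omega>. \<bar>X n \<omega> - X' n \<omega>\<bar>) \<le> (K * T + (1 + T) * T) * (1/2)^n"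
          by (simp add: algebra_simps)
      qed auto

      have X'Z: "AE \<omega> in M. (\<lambda>n. X' n \<omega> - Z n \<omega>) \<longlonglongrightarrow> 0"
      proof (rule geometric_L2_imp_AE_tendsto[where q="1/2" and K="K1 * T"])
        fix n
        have f: "fin_mom (\<lambda>\<omega>. X' n \<omega> - Z n \<omega>)" by (intro fin_mom_diff fX' fZ)
        show "(\<lambda>\<omega>. X' n \<omega> - Z n \<omega>) \<in> borel_measurable M" by (rule fin_mom_measurable[OF f])
        show "integrable M (\<lambda>\<omega>. (X' n \<omega> - Z n \<omega>)^2)" by (intro fin_mom_integrable fin_mom_power f)
        have "expectation (\<lambda>\<omega>. (X' n \<omega> - Z n \<omega>)^2) \<le> K1 * hn n"
          using K1(2)[OF hn0 hnT rn0, of n n] unfolding X'_def Z_def g_def .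
        also have "\<dots> \<le> K1 * (T * (1/2)^n)" using hn_le K1 by (intro mult_left_mono) auto
        finally show "expectation (\<lambda>\<omega>. (X' n \<omega> - Z n \<omega>)^2) \<le> K1 * T * (1/2)^n" by simp
      qed auto

      have "conv_in_prob M X (Sr (a # w) s)"
        using Sr_Cons_conv[OF w(1,2) s(1)] unfolding X_def[abs_def] hn_def[abs_def] .
      then obtain \<rho> where \<rho>: "strict_mono \<rho>" "AE \<omega> in M. (\<lambda>n. X (\<rho> n) \<omega>) \<longlonglongrightarrow> Sr (a # w) s \<omega>"
        using conv_in_prob_imp_AE_subseq[of X "Sr (a # w) s", OF Xm Sm] by blast
      \<comment> \<open>Convergence in probability provides only a subsequence, while the two
        corrections vanish along the whole sequence.\<close>
      have "AE \<omega> in M. (\<lambda>n. Z (\<rho> n) \<omega>) \<longlonglongrightarrow> Sr (a # w) s \<omega>"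
        using \<rho>(2) XX' X'Z
      proof eventually_elim
        case (elim \<omega>)
        have "(\<lambda>n. X (\<rho> n) \<omega> - (X (\<rho> n) \<omega> - X' (\<rho> n) \<omega>) - (X' (\<rho> n) \<omega> - Z (\<rho> n) \<omega>)) \<longlonglongrightarrow> Sr (a # w) s \<omega> - 0 - 0"
          using elim(1) LIMSEQ_subseq_LIMSEQ[OF elim(2) \<rho>(1)] LIMSEQ_subseq_LIMSEQ[OF elim(3) \<rho>(1)]
          unfolding comp_def by (intro tendsto_diff)
        then show ?case by simp
      qed
      moreover have "expectation (\<lambda>\<omega>. (Dsig h (a # w) k \<omega> - Z n \<omega>)^2) \<le> K2 * h" for n
      proof -
        have eqs: "g n = h / real (2^n * 8^n)" "2^n * rn n = k * (2^n * 8^n)"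
          using False by (auto simp: g_def hn_def rn_def s_def)
        show ?thesis unfolding Z_def eqs by (rule K2(2)[OF h]) simp
      qed
      ultimately show ?thesis using fZ by (intro exI[of _ "\<lambda>n. Z (\<rho> n)"]) auto
    qed
    then obtain Z where Z: "\<And>n. fin_mom (Z n)" "AE \<omega> in M. (\<lambda>n. Z n \<omega>) \<longlonglongrightarrow> Sr (a # w) s \<omega>"
       "\<And>n. expectation (\<lambda>\<omega>. (Dsig h (a # w) k \<omega> - Z n \<omega>)^2) \<le> K2 * h" by blast
    have int: "integrable M (\<lambda>\<omega>. (Dsig h (a # w) k \<omega> - Z n \<omega>)^2)" for n
      by (intro fin_mom_integrable fin_mom_power fin_mom_diff fin_mom_Dsig h w Z)
    have K0: "0 \<le> K2 * h" using K2 h by simp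
    show "integrable M (\<lambda>\<omega>. (Dsig h (a # w) k \<omega> - Sr (a # w) (h * real k) \<omega>)^2)"
      using L2_bound_limit(1)[where Z=Z, OF fin_mom_measurable[OF Z(1)] Sm Dm Z(2) int Z(3) K0] unfolding s_def .
    show "expectation (\<lambda>\<omega>. (Dsig h (a # w) k \<omega> - Sr (a # w) (h * real k) \<omega>)^2) \<le> K2 * h"
      using L2_bound_limit(2)[where Z=Z, OF fin_mom_measurable[OF Z(1)] Sm Dm Z(2) int Z(3) K0] unfolding s_def .
  qed (use K2 in auto)
qed

text \<open>The factor 4 makes mean-square errors of order \<open>4^-n\<close> and mean errors of
  order \<open>2^-n\<close>, both summable. The grids are nested, which the increasing
  sigma-algebras \<open>Hn\<close> rely on.\<close>

definition Dn :: "real \<Rightarrow> nat \<Rightarrow> nat list \<Rightarrow> 'a \<Rightarrow> real" where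
  "Dn t n w = Dsig (t / 4^n) w (4^n)"

lemma fin_mom_Dn: "0 < t \<Longrightarrow> set w \<subseteq> {0..d} \<Longrightarrow> fin_mom (Dn t n w)"
  unfolding Dn_def by (rule fin_mom_Dsig) auto

lemma Dn_Sr_L2:
  assumes "set w \<subseteq> {0..d}" "0 < t"
  shows "\<exists>K\<ge>0. \<forall>n. integrable M (\<lambda>\<omega>. (Dn t n w \<omega> - Sr w t \<omega>)^2) \<and>
    expectation (\<lambda>\<omega>. (Dn t n w \<omega> - Sr w t \<omega>)^2) \<le> K * (1/4)^n"
proof -
  obtain K where K: "K \<ge> 0" "\<And>h k. 0 < h \<Longrightarrow> h * real k \<le> t \<Longrightarrow>
    integrable M (\<lambda>\<omega>. (Dsig h w k \<omega> - Sr w (h * real k) \<omega>)^2) \<and>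
    expectation (\<lambda>\<omega>. (Dsig h w k \<omega> - Sr w (h * real k) \<omega>)^2) \<le> K * h"
    using Dsig_Sr_L2[of w t] assms by force
  show ?thesis
  proof (intro exI[of _ "K * t"] conjI allI)
    fix n :: nat
    show "integrable M (\<lambda>\<omega>. (Dn t n w \<omega> - Sr w t \<omega>)^2)"
      "expectation (\<lambda>\<omega>. (Dn t n w \<omega> - Sr w t \<omega>)^2) \<le> K * t * (1/4)^n"
      using K(2)[of "t / 4^n" "4^n"] assms by (auto simp: Dn_def power_divide)
  qed (use K assms in auto)
qed

text \<open>Summable mean-square errors give almost sure convergence for each word; there are
  countably many words, so one null set serves all.\<close>

lemma Dn_tendsto_Sr:
  assumes "0 < t"
  shows "AE \<omega> in M. \<forall>w. set w \<subseteq> {0..d} \<longrightarrow> (\<lambda>n. Dn t n w \<omega>) \<longlonglongrightarrow> Sr w t \<omega>"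
proof (subst AE_all_countable, intro allI)
  fix w :: "nat list"
  show "AE \<omega> in M. set w \<subseteq> {0..d} \<longrightarrow> (\<lambda>n. Dn t n w \<omega>) \<longlonglongrightarrow> Sr w t \<omega>"
  proof (cases "set w \<subseteq> {0..d}")
    case True
    obtain K where "\<And>n. integrable M (\<lambda>\<omega>. (Dn t n w \<omega> - Sr w t \<omega>)^2)"
      "\<And>n. expectation (\<lambda>\<omega>. (Dn t n w \<omega> - Sr w t \<omega>)^2) \<le> K * (1/4)^n"
      using Dn_Sr_L2[OF True assms] by blast
    then have "AE \<omega> in M. (\<lambda>n. Dn t n w \<omega> - Sr w t \<omega>) \<longlonglongrightarrow> 0"
      by (intro geometric_L2_imp_AE_tendsto[where q="1/4" and K=K] borel_measurable_diff
            fin_mom_measurable[OF fin_mom_Dn] Sr_measurable) (use assms True in auto)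
    then show ?thesis by eventually_elim (auto intro: LIM_zero_cancel)
  qed simp
qed

lemma Sr_sq_integrable:
  assumes "set w \<subseteq> {0..d}" "0 < t"
  shows "integrable M (\<lambda>\<omega>. (Sr w t \<omega>)^2)"
proof -
  have int: "integrable M (\<lambda>\<omega>. (Dn t 0 w \<omega> - Sr w t \<omega>)^2)" using Dn_Sr_L2[OF assms] by blast
  have [measurable]: "Sr w t \<in> borel_measurable M" using assms by (intro Sr_measurable) auto
  show ?thesis
  proof (rule Bochner_Integration.integrable_bound)
    show "integrable M (\<lambda>\<omega>. 2 * (Dn t 0 w \<omega>)^2 + 2 * (Dn t 0 w \<omega> - Sr w t \<omega>)^2)"
      using int fin_mom_integrable[OF fin_mom_power[OF fin_mom_Dn[OF assms(2,1)]]] by auto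
    have "y^2 \<le> 2 * x^2 + 2 * (x - y)^2" for x y :: real
      using zero_le_power2[of "2 * x - y"] unfolding power2_diff by (simp add: power_mult_distrib)
    then show "AE \<omega> in M. norm ((Sr w t \<omega>)^2) \<le> norm (2 * (Dn t 0 w \<omega>)^2 + 2 * (Dn t 0 w \<omega> - Sr w t \<omega>)^2)"
      by auto
  qed measurable
qed

end

subsection \<open>The product formula\<close>

text \<open>The pairing of a functional on words with a formal sum. It does not see the order or the
  splitting of entries, so lists are compared through it.\<close>

definition evl :: "(nat list \<Rightarrow> real) \<Rightarrow> lc \<Rightarrow> real" where
  "evl s x = (\<Sum>(r,w)\<leftarrow>x. r * s w)"

lemma evl_Nil [simp]: "evl s [] = 0"
  by (simp add: evl_def)

lemma evl_Cons [simp]: "evl s ((r, w) # x) = r * s w + evl s x"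
  by (simp add: evl_def)

lemma evl_append [simp]: "evl s (x @ y) = evl s x + evl s y"
  by (simp add: evl_def)

lemma evl_lprep: "evl s (lprep a x) = evl (\<lambda>w. s (a # w)) x"
  by (induction x) (auto simp: lprep_def)

lemma evl_lscale: "evl s (lscale c x) = c * evl s x"
  by (induction x) (auto simp: lscale_def algebra_simps)

lemma evl_cong: "(\<And>r w. (r, w) \<in> set x \<Longrightarrow> s w = s' w) \<Longrightarrow> evl s x = evl s' x"
  unfolding evl_def by (intro arg_cong[where f=sum_list] map_cong) auto

definition lc_over :: "nat set \<Rightarrow> lc \<Rightarrow> bool" where
  "lc_over A x \<longleftrightarrow> (\<forall>(r,w)\<in>set x. set w \<subseteq> A)"

lemma lc_over_Nil [simp]: "lc_over A []"
  by (simp add: lc_over_def)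

lemma lc_over_Cons [simp]: "lc_over A ((r, w) # x) \<longleftrightarrow> set w \<subseteq> A \<and> lc_over A x"
  by (simp add: lc_over_def)

lemma lc_over_append [simp]: "lc_over A (x @ y) \<longleftrightarrow> lc_over A x \<and> lc_over A y"
  by (auto simp: lc_over_def)

lemma lc_over_lprep: "a \<in> A \<Longrightarrow> lc_over A x \<Longrightarrow> lc_over A (lprep a x)"
  by (induction x) (auto simp: lprep_def)

lemma lc_over_lscale: "lc_over A x \<Longrightarrow> lc_over A (lscale c x)"
  by (auto simp: lc_over_def lscale_def)

lemma lc_over_rstar: "0 \<in> A \<Longrightarrow> set u \<subseteq> A \<Longrightarrow> set v \<subseteq> A \<Longrightarrow> lc_over A (rstar u v)"
  by (induction u v rule: rstar.induct) (auto intro!: lc_over_lprep)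

lemma tendsto_evl:
  assumes "\<And>w. set w \<subseteq> A \<Longrightarrow> (\<lambda>n. s n w) \<longlonglongrightarrow> s' w" "lc_over A x"
  shows "(\<lambda>n. evl (s n) x) \<longlonglongrightarrow> evl s' x"
  using assms(2) by (induction x) (auto intro!: tendsto_intros assms(1))

context brownian_motion begin

lemma fin_mom_evl:
  assumes "\<And>w. set w \<subseteq> {0..d} \<Longrightarrow> fin_mom (X w)" "lc_over {0..d} x"
  shows "fin_mom (\<lambda>\<omega>. evl (\<lambda>w. X w \<omega>) x)"
  using assms(2)
proof (induction x)
  case (Cons p x)
  obtain r w where p: "p = (r, w)" by (cases p)
  have "fin_mom (\<lambda>\<omega>. r * X w \<omega> + evl (\<lambda>w. X w \<omega>) x)"
    using Cons p by (intro fin_mom_intros assms(1)) auto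
  then show ?case by (simp add: p)
qed (simp add: fin_mom_const)

lemma adapted_evl_Dsig:
  assumes "0 < h" "lc_over {0..d} x"
  shows "adapted (h * real k) (\<lambda>\<omega>. evl (\<lambda>w. Dsig h w k \<omega>) x)"
  using assms(2)
proof (induction x)
  case (Cons p x)
  obtain r w where p: "p = (r, w)" by (cases p)
  have "adapted (h * real k) (\<lambda>\<omega>. r * Dsig h w k \<omega> + evl (\<lambda>w. Dsig h w k \<omega>) x)"
    using Cons p assms(1) by (intro adapted_add adapted_mult adapted_const adapted_Dsig) auto
  then show ?case by (simp add: p)
qed (simp add: adapted_const)

lemma evl_Dsig_L2_bound:
  assumes "lc_over {0..d} x" "0 \<le> T"
  shows "\<exists>K\<ge>0. \<forall>h k. 0 < h \<longrightarrow> h * real k \<le> T \<longrightarrow> expectation (\<lambda>\<omega>. (evl (\<lambda>w. Dsig h w k \<omega>) x)^2) \<le> K"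
  using assms(1)
proof (induction x)
  case (Cons p x)
  obtain r w where p: "p = (r, w)" by (cases p)
  from Cons p have v: "set w \<subseteq> {0..d}" "lc_over {0..d} x" by auto
  obtain K where K: "K \<ge> 0" "\<And>h k. 0 < h \<Longrightarrow> h * real k \<le> T \<Longrightarrow> expectation (\<lambda>\<omega>. (evl (\<lambda>w. Dsig h w k \<omega>) x)^2) \<le> K"
    using Cons.IH v by blast
  obtain K' where K': "K' \<ge> 0" "\<And>h k. 0 < h \<Longrightarrow> h * real k \<le> T \<Longrightarrow> nsq (Dsig h w k) \<le> K'"
    using Dsig_L2_bound[OF v(1) assms(2)] by blast
  show ?case
  proof (intro exI[of _ "2 * (r^2 * K') + 2 * K"] conjI allI impI)
    fix h k assume h: "0 < h" "h * real k \<le> T"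
    have "expectation (\<lambda>\<omega>. (evl (\<lambda>w. Dsig h w k \<omega>) (p # x))^2) =
      expectation (\<lambda>\<omega>. (r * Dsig h w k \<omega> + evl (\<lambda>w. Dsig h w k \<omega>) x)^2)" by (simp add: p)
    also have "\<dots> \<le> 2 * expectation (\<lambda>\<omega>. (r * Dsig h w k \<omega>)^2) + 2 * expectation (\<lambda>\<omega>. (evl (\<lambda>w. Dsig h w k \<omega>) x)^2)"
      by (intro expectation_sq_add fin_mom_intros fin_mom_Dsig h v fin_mom_evl)
    also have "expectation (\<lambda>\<omega>. (r * Dsig h w k \<omega>)^2) = r^2 * nsq (Dsig h w k)"
      by (simp add: power_mult_distrib)
    also have "2 * (r^2 * nsq (Dsig h w k)) + 2 * expectation (\<lambda>\<omega>. (evl (\<lambda>w. Dsig h w k \<omega>) x)^2)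
      \<le> 2 * (r^2 * K') + 2 * K"
      using K(2)[OF h] K'(2)[OF h] by (intro add_mono mult_left_mono) auto
    finally show "expectation (\<lambda>\<omega>. (evl (\<lambda>w. Dsig h w k \<omega>) (p # x))^2) \<le> 2 * (r^2 * K') + 2 * K" .
  qed (use K K' in auto)
qed auto

lemma evl_Dsig_lprep:
  "evl (\<lambda>w. Dsig h w k \<omega>) (lprep a x) = (\<Sum>j<k. evl (\<lambda>w. Dsig h w j \<omega>) x * Del h a j \<omega>)"
  unfolding evl_lprep by (induction x) (auto simp: sum.distrib algebra_simps sum_distrib_left)

section \<open>The defect of the product formula on a grid\<close>

definition Qsig :: "real \<Rightarrow> nat list \<Rightarrow> nat list \<Rightarrow> nat \<Rightarrow> 'a \<Rightarrow> real" where
  "Qsig h u v k \<omega> = Dsig h u k \<omega> * Dsig h v k \<omega> - evl (\<lambda>w. Dsig h w k \<omega>) (rstar u v)"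

lemma adapted_Qsig:
  assumes "0 < h" "set u \<subseteq> {0..d}" "set v \<subseteq> {0..d}"
  shows "adapted (h * real k) (Qsig h u v k)"
  unfolding Qsig_def[abs_def]
  by (intro adapted_diff adapted_mult adapted_Dsig adapted_evl_Dsig lc_over_rstar assms) auto

text \<open>Pairs of indices are split into those below, above and on the diagonal; the diagonal is
  what becomes the quadratic covariation.\<close>

lemma summation_product:
  fixes x y :: "nat \<Rightarrow> real"
  shows "(\<Sum>l<k. x l) * (\<Sum>l<k. y l) =
    (\<Sum>l<k. x l * (\<Sum>m<l. y m)) + (\<Sum>l<k. (\<Sum>m<l. x m) * y l) + (\<Sum>l<k. x l * y l)"
  by (induction k) (auto simp: algebra_simps)

text \<open>The defect satisfies the star recursion with one source term, the product of increments
  minus its compensator. The letter 0 appended by the star product accounts for the compensator,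
  because \<open>Del h 0\<close> is \<open>h\<close>.\<close>

lemma Qsig_Cons_Cons:
  "Qsig h (i # I) (j # J) k \<omega> =
     (\<Sum>l<k. Qsig h I (j # J) l \<omega> * Del h i l \<omega>) + (\<Sum>l<k. Qsig h (i # I) J l \<omega> * Del h j l \<omega>)
     + (if rho i j then \<Sum>l<k. Qsig h I J l \<omega> * Del h 0 l \<omega> else 0)
     + (\<Sum>l<k. (Dsig h I l \<omega> * Dsig h J l \<omega>) * (Del h i l \<omega> * Del h j l \<omega> - (if rho i j then h else 0)))"
proof -
  have "Dsig h (i # I) k \<omega> * Dsig h (j # J) k \<omega> =
    (\<Sum>l<k. Dsig h I l \<omega> * Del h i l \<omega> * Dsig h (j # J) l \<omega>) +
    (\<Sum>l<k. Dsig h (i # I) l \<omega> * (Dsig h J l \<omega> * Del h j l \<omega>)) +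
    (\<Sum>l<k. Dsig h I l \<omega> * Del h i l \<omega> * (Dsig h J l \<omega> * Del h j l \<omega>))"
    using summation_product[of "\<lambda>l. Dsig h I l \<omega> * Del h i l \<omega>" k "\<lambda>l. Dsig h J l \<omega> * Del h j l \<omega>"] by simp
  moreover have "evl (\<lambda>w. Dsig h w k \<omega>) (rstar (i # I) (j # J)) =
    (\<Sum>l<k. evl (\<lambda>w. Dsig h w l \<omega>) (rstar I (j # J)) * Del h i l \<omega>) +
    (\<Sum>l<k. evl (\<lambda>w. Dsig h w l \<omega>) (rstar (i # I) J) * Del h j l \<omega>) +
    (if rho i j then \<Sum>l<k. evl (\<lambda>w. Dsig h w l \<omega>) (rstar I J) * Del h 0 l \<omega> else 0)"
    by (simp add: evl_Dsig_lprep)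
  ultimately show ?thesis
    unfolding Qsig_def by (simp add: sum_subtractf sum.distrib algebra_simps Del_0 del: rstar.simps Dsig.simps)
qed

text \<open>With a time letter the product of increments is \<open>h\<close> times an increment, and
  \<open>h \<le> T\<close> trades one of the resulting two powers of \<open>h\<close> for
  \<open>T\<close>. With two Brownian letters the martingale bound \<open>2 * h^2\<close> is summed
  over at most \<open>T / h\<close> steps.\<close>

lemma quadratic_covariation_bound:
  assumes "0 < h" "i \<le> d" "j \<le> d" "\<And>l. adapted (h * real l) (Z l)"
    "\<And>l. l < k \<Longrightarrow> nsq (Z l) \<le> B" "h * real k \<le> T" "0 \<le> B" "h \<le> T"
  shows "expectation (\<lambda>\<omega>. (\<Sum>l<k. Z l \<omega> * (Del h i l \<omega> * Del h j l \<omega> - (if rho i j then h else 0)))^2)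
     \<le> (2 * T + T * ((1 + T) * T)) * B * h"
proof -
  have T: "0 \<le> T" using assms by linarith
  have zero: "expectation (\<lambda>\<omega>. (\<Sum>l<k. Z l \<omega> * (Del h 0 l \<omega> * Del h b l \<omega>))^2) \<le> (2 * T + T * ((1 + T) * T)) * B * h"
    if "b \<le> d" for b
  proof -
    have "expectation (\<lambda>\<omega>. (\<Sum>l<k. Z l \<omega> * (Del h 0 l \<omega> * Del h b l \<omega>))^2) =
      expectation (\<lambda>\<omega>. h^2 * (\<Sum>l<k. Z l \<omega> * Del h b l \<omega>)^2)"
      unfolding power_mult_distrib[symmetric] by (simp add: Del_0 sum_distrib_left mult_ac)
    also have "\<dots> = h^2 * expectation (\<lambda>\<omega>. (\<Sum>l<k. Z l \<omega> * Del h b l \<omega>)^2)" by simp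
    also have "\<dots> \<le> h^2 * ((1 + T) * T * B)"
      by (intro mult_left_mono discrete_integral_uniform_bound) (use assms that in auto)
    also have "\<dots> \<le> (T * h) * ((1 + T) * T * B)"
      using assms T by (intro mult_right_mono) (auto simp: power2_eq_square)
    also have "\<dots> \<le> (2 * T + T * ((1 + T) * T)) * B * h"
      using T assms by (simp add: algebra_simps)
    finally show ?thesis .
  qed
  consider "i = 0" | "j = 0" | "i \<in> {1..d}" "j \<in> {1..d}" using assms by fastforce
  then show ?thesis
  proof cases
    case 1
    then show ?thesis using zero[of j] assms by (simp add: rho_def)
  next
    case 2
    then show ?thesis using zero[of i] assms by (simp add: rho_def mult.commute[of "Del h i _ _"])
  next
    case 3
    then have "(if rho i j then h else 0) = (if i = j then h else 0)" by (auto simp: rho_def)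
    then have "expectation (\<lambda>\<omega>. (\<Sum>l<k. Z l \<omega> * (Del h i l \<omega> * Del h j l \<omega> - (if rho i j then h else 0)))^2)
      \<le> 2 * h^2 * (\<Sum>l<k. nsq (Z l))"
      using quadratic_variation_bound[of h i j Z k] 3 assms(1,4) by simp
    also have "\<dots> \<le> 2 * h^2 * (\<Sum>l<k. B)" using assms by (intro mult_left_mono sum_mono) auto
    also have "\<dots> = 2 * (h * real k) * B * h" by (simp add: power2_eq_square)
    also have "\<dots> \<le> (2 * T) * B * h"
      using assms by (intro mult_right_mono) auto
    also have "\<dots> \<le> (2 * T + T * ((1 + T) * T)) * B * h"
      using T assms by (intro mult_right_mono) auto
    finally show ?thesis .
  qed
qed

text \<open>Induction on the total length: the integrals of defects inherit the order
  \<open>h\<close> from shorter pairs, and the source term has order \<open>h\<close> by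
  \<open>quadratic_covariation_bound\<close>.\<close>

lemma Qsig_L2_bound:
  assumes "set u \<subseteq> {0..d}" "set v \<subseteq> {0..d}" "0 \<le> T"
  shows "\<exists>K\<ge>0. \<forall>h k. 0 < h \<longrightarrow> h * real k \<le> T \<longrightarrow> nsq (Qsig h u v k) \<le> K * h"
  using assms(1,2)
proof (induction "length u + length v" arbitrary: u v rule: less_induct)
  case less
  show ?case
  proof (cases "u = [] \<or> v = []")
    case True
    then show ?thesis by (cases u) (auto simp: Qsig_def intro!: exI[of _ 0])
  next
    case False
    then obtain i I j J where uv: "u = i # I" "v = j # J" by (meson list.exhaust)
    show ?thesis unfolding uv
  proof -
  have v: "i \<le> d" "j \<le> d" "set I \<subseteq> {0..d}" "set J \<subseteq> {0..d}" "set (i # I) \<subseteq> {0..d}" "set (j # J) \<subseteq> {0..d}"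
    using less.prems uv by auto
  obtain K1 where K1: "K1 \<ge> 0" "\<And>h k. 0 < h \<Longrightarrow> h * real k \<le> T \<Longrightarrow> nsq (Qsig h I (j # J) k) \<le> K1 * h"
    using less.hyps[of I "j # J"] v uv by auto
  obtain K2 where K2: "K2 \<ge> 0" "\<And>h k. 0 < h \<Longrightarrow> h * real k \<le> T \<Longrightarrow> nsq (Qsig h (i # I) J k) \<le> K2 * h"
    using less.hyps[of "i # I" J] v uv by auto
  obtain K3 where K3: "K3 \<ge> 0" "\<And>h k. 0 < h \<Longrightarrow> h * real k \<le> T \<Longrightarrow> nsq (Qsig h I J k) \<le> K3 * h"
    using less.hyps[of I J] v uv by auto
  have ov: "lc_over {0..d} (rstar I J)" by (intro lc_over_rstar v) auto
  obtain K4 where K4: "K4 \<ge> 0"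
    "\<And>h k. 0 < h \<Longrightarrow> h * real k \<le> T \<Longrightarrow> expectation (\<lambda>\<omega>. (evl (\<lambda>w. Dsig h w k \<omega>) (rstar I J))^2) \<le> K4"
    using evl_Dsig_L2_bound[OF ov assms(3)] by blast
  \<comment> \<open>Bounds the second moment of \<open>Dsig h I l * Dsig h J l\<close>. This product
    is its own defect plus a linear combination, so second moments suffice and no fourth moment of
    iterated sums has to be estimated.\<close>
  define B where "B = 2 * (K3 * T) + 2 * K4"
  have B0: "0 \<le> B" using K3 K4 assms by (simp add: B_def)
  define C where "C = (1 + T) * T"
  have C0: "0 \<le> C" using assms by (simp add: C_def)
  \<comment> \<open>The 4 comes from splitting the square of four summands twice in two.\<close>
  define K where "K = 4 * (C * K1 + C * K2 + C * K3 + (2 * T + T * ((1 + T) * T)) * B)"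
  show "\<exists>K\<ge>0. \<forall>h k. 0 < h \<longrightarrow> h * real k \<le> T \<longrightarrow> expectation (\<lambda>\<omega>. (Qsig h (i # I) (j # J) k \<omega>)^2) \<le> K * h"
  proof (intro exI[of _ K] conjI allI impI)
    show "0 \<le> K" using K1 K2 K3 C0 B0 assms by (simp add: K_def)
    fix h k assume h: "0 < h" "h * real k \<le> T"
    show "expectation (\<lambda>\<omega>. (Qsig h (i # I) (j # J) k \<omega>)^2) \<le> K * h"
    proof (cases "k = 0")
      \<comment> \<open>The comparison \<open>h \<le> T\<close> used in the other case needs at
        least one step.\<close>
      case True
      then show ?thesis using h \<open>0 \<le> K\<close> unfolding Qsig_Cons_Cons by (cases "rho i j") simp_all
    next
      case False
      then have "h * 1 \<le> h * real k" using h by (intro mult_left_mono) auto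
      then have hT: "h \<le> T" using h(2) by linarith
      have lT: "h * real l \<le> T" if "l < k" for l
      proof -
        have "h * real l \<le> h * real k" using that h by (intro mult_left_mono) auto
        then show ?thesis using h by linarith
      qed
      define A1 where "A1 \<omega> = (\<Sum>l<k. Qsig h I (j # J) l \<omega> * Del h i l \<omega>)" for \<omega>
      define A2 where "A2 \<omega> = (\<Sum>l<k. Qsig h (i # I) J l \<omega> * Del h j l \<omega>)" for \<omega>
      define A3 where "A3 \<omega> = (if rho i j then \<Sum>l<k. Qsig h I J l \<omega> * Del h 0 l \<omega> else 0)" for \<omega>
      define A4 where "A4 \<omega> = (\<Sum>l<k. (Dsig h I l \<omega> * Dsig h J l \<omega>) * (Del h i l \<omega> * Del h j l \<omega> - (if rho i j then h else 0)))" for \<omega>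
      have fDel: "fin_mom (Del h a l)" if "a \<le> d" for a l using adapted_fin_mom[OF adapted_Del[OF h(1) that]] .
      have fQ: "fin_mom (Qsig h u v l)" if "set u \<subseteq> {0..d}" "set v \<subseteq> {0..d}" for u v l
        using adapted_fin_mom[OF adapted_Qsig[OF h(1) that]] .
      have fmA: "fin_mom A1" "fin_mom A2" "fin_mom A4"
        unfolding A1_def[abs_def] A2_def[abs_def] A4_def[abs_def]
        by (intro fin_mom_intros fQ fDel fin_mom_Dsig h v)+
      have fm3: "fin_mom A3"
        unfolding A3_def[abs_def] by (cases "rho i j") (simp_all add: fin_mom_const, intro fin_mom_intros fQ fDel v, simp)
      have E1: "nsq A1 \<le> C * (K1 * h)"
        unfolding A1_def C_def
        by (rule discrete_integral_uniform_bound) (use h v K1 lT adapted_Qsig in auto)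
      have E2: "nsq A2 \<le> C * (K2 * h)"
        unfolding A2_def C_def
        by (rule discrete_integral_uniform_bound) (use h v K2 lT adapted_Qsig in auto)
      have E3: "nsq A3 \<le> C * (K3 * h)"
      proof (cases "rho i j")
        case True
        have "expectation (\<lambda>\<omega>. (\<Sum>l<k. Qsig h I J l \<omega> * Del h 0 l \<omega>)^2) \<le> C * (K3 * h)"
          unfolding C_def
          by (rule discrete_integral_uniform_bound) (use h v K3 lT adapted_Qsig in auto)
        then show ?thesis using True by (simp add: A3_def)
      next
        case False
        then show ?thesis using C0 K3 h by (simp add: A3_def)
      qed
      have E4: "nsq A4 \<le> (2 * T + T * ((1 + T) * T)) * B * h"
        unfolding A4_def
      proof (rule quadratic_covariation_bound)
        show "adapted (h * real l) (\<lambda>\<omega>. Dsig h I l \<omega> * Dsig h J l \<omega>)" for l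
          by (intro adapted_mult adapted_Dsig h v)
        fix l assume "l < k"
        have "expectation (\<lambda>\<omega>. (Dsig h I l \<omega> * Dsig h J l \<omega>)^2) =
          expectation (\<lambda>\<omega>. (Qsig h I J l \<omega> + evl (\<lambda>w. Dsig h w l \<omega>) (rstar I J))^2)"
          by (simp add: Qsig_def)
        also have "\<dots> \<le> 2 * nsq (Qsig h I J l) +
          2 * expectation (\<lambda>\<omega>. (evl (\<lambda>w. Dsig h w l \<omega>) (rstar I J))^2)"
          by (intro expectation_sq_add fQ v fin_mom_evl fin_mom_Dsig h ov)
        also have "\<dots> \<le> 2 * (K3 * h) + 2 * K4"
          using K3(2)[OF h(1) lT] K4(2)[OF h(1) lT] \<open>l < k\<close> by (intro add_mono mult_left_mono) auto
        also have "\<dots> \<le> B" unfolding B_def using hT K3 by (intro add_mono mult_left_mono) auto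
        finally show "expectation (\<lambda>\<omega>. (Dsig h I l \<omega> * Dsig h J l \<omega>)^2) \<le> B" .
      qed (use h v B0 hT in auto)
      have "expectation (\<lambda>\<omega>. (Qsig h (i # I) (j # J) k \<omega>)^2) =
        expectation (\<lambda>\<omega>. ((A1 \<omega> + A2 \<omega>) + (A3 \<omega> + A4 \<omega>))^2)"
        unfolding Qsig_Cons_Cons A1_def A2_def A3_def A4_def by (simp add: add.assoc)
      also have "\<dots> \<le> 2 * expectation (\<lambda>\<omega>. (A1 \<omega> + A2 \<omega>)^2) + 2 * expectation (\<lambda>\<omega>. (A3 \<omega> + A4 \<omega>)^2)"
        by (intro expectation_sq_add fin_mom_add fmA fm3)
      also have "\<dots> \<le> 2 * (2 * nsq A1 + 2 * nsq A2) +
         2 * (2 * nsq A3 + 2 * nsq A4)"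
        using expectation_sq_add[OF fmA(1,2)] expectation_sq_add[OF fm3 fmA(3)] by simp
      also have "\<dots> \<le> 4 * (C * (K1 * h) + C * (K2 * h) + C * (K3 * h) + (2 * T + T * ((1 + T) * T)) * B * h)"
        using E1 E2 E3 E4 by simp
      also have "\<dots> = K * h" by (simp add: K_def algebra_simps)
      finally show ?thesis .
    qed
  qed
  qed
  qed
qed

text \<open>One Brownian letter anywhere annihilates the expectation. For time words the sum counts
  strictly increasing index tuples, by the hockey-stick identity.\<close>

lemma expectation_Dsig:
  assumes "0 < h" "set w \<subseteq> {0..d}"
  shows "expectation (Dsig h w k) =
    (if set w \<subseteq> {0} then h ^ length w * real (k choose length w) else 0)"
  using assms(2)
proof (induction w arbitrary: k)
  case Nil
  have "Dsig h [] k = (\<lambda>\<omega>. 1)" by (simp add: fun_eq_iff)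
  then show ?case by (simp add: prob_space)
next
  case (Cons a w)
  then have v: "set w \<subseteq> {0..d}" "a \<le> d" by auto
  have eq: "Dsig h (a # w) k = (\<lambda>\<omega>. \<Sum>j<k. Dsig h w j \<omega> * Del h a j \<omega>)" by (simp add: fun_eq_iff)
  have "expectation (Dsig h (a # w) k) = (\<Sum>j<k. expectation (\<lambda>\<omega>. Dsig h w j \<omega> * Del h a j \<omega>))"
    unfolding eq
    by (intro Bochner_Integration.integral_sum fin_mom_integrable fin_mom_mult fin_mom_Dsig assms v adapted_fin_mom[OF adapted_Del[OF assms(1) v(2)]])
  also have "\<dots> = (\<Sum>j<k. if a = 0 then h * expectation (Dsig h w j) else 0)"
    by (intro sum.cong refl expectation_Del assms v adapted_Dsig)
  also have "\<dots> = (if set (a # w) \<subseteq> {0} then h ^ Suc (length w) * (\<Sum>j<k. real (j choose length w)) else 0)"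
    unfolding Cons.IH[OF v(1)] by (cases "set w \<subseteq> {0}"; cases "a = 0") (auto simp: sum_distrib_left mult.assoc)
  also have "(\<Sum>j<k. real (j choose n)) = real (k choose Suc n)" for n
    by (induction k) auto
  finally show ?case by simp
qed

end

text \<open>In the limit the strictly increasing tuples fill the fraction \<open>1 / fact n\<close>
  of the cube, the volume of the simplex.\<close>

lemma binomial_div_power_tendsto:
  "(\<lambda>k. real (k choose n) / real k ^ n) \<longlonglongrightarrow> 1 / fact n"
proof (induction n)
  case 0 show ?case by simp
next
  case (Suc n)
  have "(\<lambda>k. (real (k choose n) / real k ^ n) * ((1 - real n / real k) / real (Suc n))) \<longlonglongrightarrow> 1 / fact n * ((1 - 0) / real (Suc n))"
    by (intro tendsto_intros Suc lim_const_over_n) auto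
  moreover have "eventually (\<lambda>k. (real (k choose n) / real k ^ n) * ((1 - real n / real k) / real (Suc n)) =
     real (k choose Suc n) / real k ^ Suc n) sequentially"
    using eventually_ge_at_top[of "Suc n"]
  proof eventually_elim
    case (elim k)
    have "real (Suc n) * real (k choose Suc n) = real (k choose n) * (real k - real n)"
    proof -
      have "real k * real (k choose n) = real n * real (k choose n) + real (Suc n) * real (k choose Suc n)"
        using gbinomial_mult_1[of "real k" n] by (simp only: binomial_gbinomial)
      then show ?thesis by (simp add: algebra_simps)
    qed
    then have eq: "real (k choose Suc n) = real (k choose n) * (real k - real n) / real (Suc n)"
      by (simp add: field_simps)
    have "real k > 0" using elim by simp
    then show ?case unfolding eq by (simp add: field_simps)
  qed
  ultimately show ?case by (simp add: tendsto_cong mult.commute)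
qed

lemma evl_map_rev: "evl s (map (\<lambda>(r,w). (r, rev w)) x) = evl (\<lambda>w. s (rev w)) x"
  by (induction x) auto

lemma lc_over_map_rev: "lc_over A (map (\<lambda>(r,w). (r, rev w)) x) = lc_over A x"
  by (induction x) auto

lemma lc_over_wstar: "0 \<in> A \<Longrightarrow> set u \<subseteq> A \<Longrightarrow> set v \<subseteq> A \<Longrightarrow> lc_over A (wstar u v)"
  using lc_over_rstar[of A "rev u" "rev v"] by (simp add: lc_over_map_rev wstar_def)

section \<open>Product formula and moments of the signature\<close>

context ito_signature begin

text \<open>Along the meshes \<open>t / 4^n\<close> the defect tends to 0 and every discrete
  integral tends to its Ito integral, so uniqueness of limits gives the identity.\<close>

lemma Sr_product:
  assumes "0 < t" "set u \<subseteq> {0..d}" "set v \<subseteq> {0..d}"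
  shows "AE \<omega> in M. Sr u t \<omega> * Sr v t \<omega> = evl (\<lambda>w. Sr w t \<omega>) (rstar u v)"
proof -
  have ov: "lc_over {0..d} (rstar u v)" by (intro lc_over_rstar assms) auto
  define Q where "Q n = Qsig (t / 4^n) u v (4^n)" for n
  obtain K where K: "K \<ge> 0" "\<And>h k. 0 < h \<Longrightarrow> h * real k \<le> t \<Longrightarrow> nsq (Qsig h u v k) \<le> K * h"
    using Qsig_L2_bound[OF assms(2,3), of t] assms(1) by force
  have fQ: "fin_mom (Q n)" for n
    unfolding Q_def using adapted_fin_mom[OF adapted_Qsig[OF _ assms(2,3)]] assms(1) by simp
  have "AE \<omega> in M. (\<lambda>n. Q n \<omega>) \<longlonglongrightarrow> 0"
  proof (rule geometric_L2_imp_AE_tendsto[where K="K * t" and q="1/4"])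
    show "nsq (Q n) \<le> K * t * (1/4)^n" for n
      using K(2)[of "t / 4^n" "4^n"] assms(1) by (simp add: Q_def power_divide)
  qed (auto intro!: fin_mom_measurable fin_mom_integrable fin_mom_power fQ)
  with Dn_tendsto_Sr[OF assms(1)] show ?thesis
  proof eventually_elim
    case (elim \<omega>)
    have "(\<lambda>n. Dn t n u \<omega> * Dn t n v \<omega> - evl (\<lambda>w. Dn t n w \<omega>) (rstar u v)) \<longlonglongrightarrow>
       Sr u t \<omega> * Sr v t \<omega> - evl (\<lambda>w. Sr w t \<omega>) (rstar u v)"
      using elim(1) assms(2,3) ov
      by (intro tendsto_diff tendsto_mult tendsto_evl[where A="{0..d}"]) auto
    moreover have "(\<lambda>n. Dn t n u \<omega> * Dn t n v \<omega> - evl (\<lambda>w. Dn t n w \<omega>) (rstar u v)) = (\<lambda>n. Q n \<omega>)"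
      by (simp add: fun_eq_iff Q_def Qsig_def Dn_def)
    ultimately have "Sr u t \<omega> * Sr v t \<omega> - evl (\<lambda>w. Sr w t \<omega>) (rstar u v) = 0"
      using elim(2) LIMSEQ_unique by metis
    then show ?case by simp
  qed
qed

lemma S_product:
  assumes "0 < t"
  shows "AE \<omega> in M. \<forall>u v. set u \<subseteq> {0..d} \<longrightarrow> set v \<subseteq> {0..d} \<longrightarrow>
    S u t \<omega> * S v t \<omega> = evl (\<lambda>w. S w t \<omega>) (wstar u v)"
proof -
  have "AE \<omega> in M. set u \<subseteq> {0..d} \<longrightarrow> set v \<subseteq> {0..d} \<longrightarrow> S u t \<omega> * S v t \<omega> = evl (\<lambda>w. S w t \<omega>) (wstar u v)" for u v
  proof (cases "set u \<subseteq> {0..d} \<and> set v \<subseteq> {0..d}")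
    case True
    then have "AE \<omega> in M. Sr (rev u) t \<omega> * Sr (rev v) t \<omega> = evl (\<lambda>w. Sr w t \<omega>) (rstar (rev u) (rev v))"
      using assms by (intro Sr_product) auto
    then show ?thesis by eventually_elim (simp add: Sr_def wstar_def evl_map_rev)
  qed auto
  then show ?thesis by (simp add: AE_all_countable)
qed

lemma S_measurable:
  assumes "set w \<subseteq> {0..d}" "0 \<le> t" shows "S w t \<in> borel_measurable M"
  using Sr_measurable[of "rev w" t] assms by (simp add: Sr_def)

lemma evl_S_sq_integrable:
  assumes "0 < t" "lc_over {0..d} x"
  shows "(\<lambda>\<omega>. evl (\<lambda>w. S w t \<omega>) x) \<in> borel_measurable M"
    "integrable M (\<lambda>\<omega>. (evl (\<lambda>w. S w t \<omega>) x)^2)"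
proof -
  have "(\<lambda>\<omega>. evl (\<lambda>w. S w t \<omega>) x) \<in> borel_measurable M \<and> integrable M (\<lambda>\<omega>. (evl (\<lambda>w. S w t \<omega>) x)^2)"
    using assms(2)
  proof (induction x)
    case (Cons p x)
    obtain r w where p: "p = (r, w)" by (cases p)
    have w: "set w \<subseteq> {0..d}" "lc_over {0..d} x" using Cons.prems p by auto
    have [measurable]: "S w t \<in> borel_measurable M" using w assms by (intro S_measurable) auto
    have IH [measurable]: "(\<lambda>\<omega>. evl (\<lambda>w. S w t \<omega>) x) \<in> borel_measurable M" using Cons.IH w by blast
    have "integrable M (\<lambda>\<omega>. (r * S w t \<omega> + evl (\<lambda>w. S w t \<omega>) x)^2)"
    proof (rule Bochner_Integration.integrable_bound)
      show "integrable M (\<lambda>\<omega>. 2 * (r^2 * (S w t \<omega>)^2) + 2 * (evl (\<lambda>w. S w t \<omega>) x)^2)"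
        using Cons.IH w Sr_sq_integrable[of "rev w" t] assms by (auto simp: Sr_def)
      have "(r * a + b)^2 \<le> 2 * (r^2 * a^2) + 2 * b^2" for a b
        using zero_le_power2[of "r * a - b"] unfolding power2_diff power2_sum power_mult_distrib by linarith
      then show "AE \<omega> in M. norm ((r * S w t \<omega> + evl (\<lambda>w. S w t \<omega>) x)^2) \<le>
          norm (2 * (r^2 * (S w t \<omega>)^2) + 2 * (evl (\<lambda>w. S w t \<omega>) x)^2)"
        by simp
    qed measurable
    then show ?case by (simp add: p)
  qed simp
  then show "(\<lambda>\<omega>. evl (\<lambda>w. S w t \<omega>) x) \<in> borel_measurable M"
    "integrable M (\<lambda>\<omega>. (evl (\<lambda>w. S w t \<omega>) x)^2)" by auto
qed

text \<open>By the product formula, multiplying a linear combination by one more iterated integral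
  gives a linear combination again.\<close>

lemma S_power_AE_evl:
  assumes "0 < t" "set u \<subseteq> {0..d}"
  shows "\<exists>x. lc_over {0..d} x \<and> (AE \<omega> in M. S u t \<omega> ^ n = evl (\<lambda>w. S w t \<omega>) x)"
proof (induction n)
  case 0
  have "S [] t \<omega> = 1" for \<omega> using Sr_Nil by (simp add: Sr_def)
  then show ?case by (intro exI[of _ "[(1, [])]"]) auto
next
  case (Suc n)
  then obtain x where x: "lc_over {0..d} x" "AE \<omega> in M. S u t \<omega> ^ n = evl (\<lambda>w. S w t \<omega>) x" by blast
  define y where "y = concat (map (\<lambda>(r,v). lscale r (wstar u v)) x)"
  have "lc_over {0..d} y"
    using x(1) unfolding y_def
  proof (induction x)
    case (Cons p x)
    then show ?case using lc_over_lscale[OF lc_over_wstar[OF _ assms(2)]] by (cases p) simp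
  qed simp
  moreover have "AE \<omega> in M. S u t \<omega> ^ Suc n = evl (\<lambda>w. S w t \<omega>) y"
    using x(2) S_product[OF assms(1)]
  proof eventually_elim
    case (elim \<omega>)
    have "S u t \<omega> * evl (\<lambda>w. S w t \<omega>) x = evl (\<lambda>w. S w t \<omega>) y"
      using x(1) unfolding y_def
    proof (induction x)
      case (Cons p x)
      obtain r v where p: "p = (r, v)" by (cases p)
      have "S u t \<omega> * S v t \<omega> = evl (\<lambda>w. S w t \<omega>) (wstar u v)"
        using elim(2) assms(2) Cons.prems p by simp
      then show ?case using Cons by (simp add: p evl_lscale distrib_left mult.left_commute)
    qed simp
    then show ?case using elim(1) by simp
  qed
  ultimately show ?case by blast
qed

text \<open>The square of \<open>S u t ^ n\<close> is almost surely the square of a linear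
  combination, integrable by the mean-square theory. All moments follow without estimates for higher
  powers.\<close>

lemma fin_mom_S:
  assumes "0 < t" "set u \<subseteq> {0..d}" shows "fin_mom (S u t)"
proof (rule fin_mom_of_even_powers)
  show [measurable]: "S u t \<in> borel_measurable M" by (rule S_measurable) (use assms in auto)
  fix n
  obtain x where x: "lc_over {0..d} x" "AE \<omega> in M. S u t \<omega> ^ n = evl (\<lambda>w. S w t \<omega>) x"
    using S_power_AE_evl[OF assms] by blast
  note [measurable] = evl_S_sq_integrable(1)[OF assms(1) x(1)]
  show "integrable M (\<lambda>\<omega>. S u t \<omega> ^ (2 * n))"
  proof (rule integrable_cong_AE_imp[OF evl_S_sq_integrable(2)[OF assms(1) x(1)]])
    show "AE \<omega> in M. (evl (\<lambda>w. S w t \<omega>) x)^2 = S u t \<omega> ^ (2 * n)"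
      using x(2) by eventually_elim (simp only: power_mult[of _ n 2] mult.commute[of 2 n])
  qed measurable
qed

lemma expectation_Sr:
  assumes "0 < t" "set w \<subseteq> {0..d}"
  shows "expectation (Sr w t) = (if set w \<subseteq> {0} then t ^ length w / fact (length w) else 0)"
proof -
  let ?n = "length w"
  obtain K where K: "K \<ge> 0" "\<And>n. integrable M (\<lambda>\<omega>. (Dn t n w \<omega> - Sr w t \<omega>)^2)"
    "\<And>n. expectation (\<lambda>\<omega>. (Dn t n w \<omega> - Sr w t \<omega>)^2) \<le> K * (1/4)^n"
    using Dn_Sr_L2[OF assms(2,1)] by blast
  have fSr: "fin_mom (Sr w t)" using fin_mom_S[of t "rev w"] assms by (simp add: Sr_def)
  have fD: "fin_mom (Dn t n w)" for n by (rule fin_mom_Dn[OF assms])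
  have "(\<lambda>n. expectation (Dn t n w)) \<longlonglongrightarrow> expectation (Sr w t)"
  proof (rule LIM_zero_cancel, rule Lim_null_comparison)
    \<comment> \<open>The rate is \<open>K * 2^n * 4^-n + 2^-n\<close>, from Young's inequality
      against the constant 1 with weight \<open>2^n\<close>.\<close>
    show "(\<lambda>n. (K + 1) * (1/2)^n) \<longlonglongrightarrow> 0"
      by (intro tendsto_mult_right_zero LIMSEQ_realpow_zero) auto
    have "norm (expectation (Dn t n w) - expectation (Sr w t)) \<le> (K + 1) * (1/2)^n" for n
    proof -
      have "norm (expectation (Dn t n w) - expectation (Sr w t)) = \<bar>expectation (\<lambda>\<omega>. Dn t n w \<omega> - Sr w t \<omega>)\<bar>"
        using fin_mom_integrable[OF fD] fin_mom_integrable[OF fSr] by simp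
      also have "\<dots> \<le> expectation (\<lambda>\<omega>. \<bar>(Dn t n w \<omega> - Sr w t \<omega>) * 1\<bar>)"
        using integral_abs_bound[of M "\<lambda>\<omega>. Dn t n w \<omega> - Sr w t \<omega>"] by simp
      also have "\<dots> \<le> 2^n * expectation (\<lambda>\<omega>. (Dn t n w \<omega> - Sr w t \<omega>)^2) + expectation (\<lambda>\<omega>. 1^2) / 2^n"
        by (rule integral_abs_mult_le(2)) (use K fin_mom_measurable[OF fin_mom_diff[OF fD fSr]] in auto)
      also have "\<dots> \<le> 2^n * (K * (1/4)^n) + 1 / 2^n"
        using K by (intro add_mono mult_left_mono) (auto simp: prob_space)
      also have "(2::real)^n * (1/4)^n = (1/2)^n" by (simp add: power_mult_distrib[symmetric])
      then have "2^n * (K * (1/4)^n) + 1 / 2^n = (K + 1) * (1/2)^n"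
        unfolding mult.left_commute[of "2^n"] by (simp add: distrib_right power_divide add_divide_distrib)
      finally show ?thesis .
    qed
    then show "\<forall>\<^sub>F n in sequentially. norm (expectation (Dn t n w) - expectation (Sr w t)) \<le> (K + 1) * (1/2)^n"
      by simp
  qed
  moreover have "(\<lambda>n. expectation (Dn t n w)) \<longlonglongrightarrow> (if set w \<subseteq> {0} then t ^ ?n / fact ?n else 0)"
  proof (cases "set w \<subseteq> {0}")
    case True
    have "(\<lambda>n. t ^ ?n * (real (4^n choose ?n) / real (4^n) ^ ?n)) \<longlonglongrightarrow> t ^ ?n * (1 / fact ?n)"
      by (intro tendsto_mult tendsto_const filterlim_compose[OF binomial_div_power_tendsto]
          filterlim_subseq strict_monoI_Suc) auto
    moreover have "expectation (Dn t n w) = t ^ ?n * (real (4^n choose ?n) / real (4^n) ^ ?n)" for n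
      using expectation_Dsig[OF _ assms(2), of "t / 4^n" "4^n"] assms(1) True
      by (simp add: Dn_def power_divide)
    ultimately show ?thesis using True by simp
  next
    case False
    then have "expectation (Dn t n w) = 0" for n
      using expectation_Dsig[OF _ assms(2), of "t / 4^n" "4^n"] assms(1) by (simp add: Dn_def)
    then show ?thesis using False by simp
  qed
  ultimately show ?thesis by (rule LIMSEQ_unique)
qed

lemma expectation_S:
  assumes "0 < t" "set w \<subseteq> {0..d}"
  shows "expectation (S w t) = (if set w \<subseteq> {0} then t ^ length w / fact (length w) else 0)"
  using expectation_Sr[of t "rev w"] assms by (simp add: Sr_def)

lemma expectation_evl:
  assumes "0 < t" "lc_over {0..d} x"
  shows "expectation (\<lambda>\<omega>. evl (\<lambda>w. S w t \<omega>) x) =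
    evl (\<lambda>w. if set w \<subseteq> {0} then t ^ length w / fact (length w) else 0) x"
  using assms(2)
proof (induction x)
  case (Cons p x)
  obtain r w where p: "p = (r, w)" by (cases p)
  have w: "set w \<subseteq> {0..d}" "lc_over {0..d} x" using Cons.prems p by auto
  have "expectation (\<lambda>\<omega>. r * S w t \<omega> + evl (\<lambda>w. S w t \<omega>) x) =
    r * expectation (S w t) + expectation (\<lambda>\<omega>. evl (\<lambda>w. S w t \<omega>) x)"
    using fin_mom_integrable[OF fin_mom_S[OF assms(1) w(1)]] fin_mom_integrable[OF fin_mom_evl[OF fin_mom_S[OF assms(1)] w(2)]] by simp
  then show ?case using Cons.IH w expectation_S[OF assms(1) w(1)] by (simp add: p)
qed simp

end

subsection \<open>Characters of the star algebra\<close>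

lemma evl_concat_map: "evl s (concat (map f x)) = (\<Sum>p\<leftarrow>x. evl s (f p))"
  by (induction x) auto

lemma lc_over_concat_map: "(\<And>p. p \<in> set x \<Longrightarrow> lc_over A (f p)) \<Longrightarrow> lc_over A (concat (map f x))"
  by (induction x) auto

text \<open>\<open>G0\<close> is the case \<open>a = 0\<close>. Brownian letters are treated
  alongside because the Ito correction of \<open>G0\<close> on a star product is a sum over
  them.\<close>

definition Dl :: "nat \<Rightarrow> lc \<Rightarrow> lc" where
  "Dl a x = concat (map (\<lambda>(r,h). if h \<noteq> [] \<and> last h = a then [(r, butlast h)] else []) x)"

lemma G0_Dl: "G0 = Dl 0"
  by (simp add: fun_eq_iff G0_def Dl_def)

lemma Dl_Nil [simp]: "Dl a [] = []"
  by (simp add: Dl_def)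

lemma Dl_append [simp]: "Dl a (x @ y) = Dl a x @ Dl a y"
  by (simp add: Dl_def)



lemma evl_Dl: "evl s (Dl a x) = evl (\<lambda>h. if h \<noteq> [] \<and> last h = a then s (butlast h) else 0) x"
proof (induction x)
  case (Cons p x)
  then show ?case by (cases p) (simp add: Dl_def)
qed simp

lemma lc_over_Dl: "lc_over A x \<Longrightarrow> lc_over A (Dl a x)"
proof (induction x)
  case (Cons p x)
  then show ?case by (cases p) (auto simp: Dl_def dest: in_set_butlastD)
qed simp

lemma wstar_Nil: "wstar [] v = [(1, v)]" "wstar u [] = [(1, u)]"
proof -
  have "rstar x [] = [(1, x)]" for x by (cases x) auto
  then show "wstar [] v = [(1, v)]" "wstar u [] = [(1, u)]" by (simp_all add: wstar_def)
qed

text \<open>The star recursion lists its summands by last letter: \<open>i\<close>,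
  \<open>j\<close>, or the 0 of the Ito correction. Deleting that letter undoes one step of the
  recursion, for any functional \<open>s\<close>.\<close>

lemma evl_Dl_wstar_snoc:
  "evl s (Dl a (wstar (u @ [i]) (v @ [j]))) =
    (if i = a then evl s (wstar u (v @ [j])) else 0) + (if j = a then evl s (wstar (u @ [i]) v) else 0)
    + (if rho i j \<and> a = 0 then evl s (wstar u v) else 0)"
proof -
  have 1: "evl s (Dl a (wstar x y)) = evl (\<lambda>h. if h \<noteq> [] \<and> hd h = a then s (rev (tl h)) else 0) (rstar (rev x) (rev y))" for x y
    unfolding evl_Dl wstar_def evl_map_rev
    by (intro evl_cong) (auto simp: last_rev butlast_rev)
  have 2: "evl (\<lambda>h. if h \<noteq> [] \<and> hd h = a then s (rev (tl h)) else 0) (lprep b z) =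
     (if b = a then evl (\<lambda>h. s (rev h)) z else 0)" for b z
    by (induction z) (auto simp: lprep_def)
  have 3: "evl s (wstar x y) = evl (\<lambda>h. s (rev h)) (rstar (rev x) (rev y))" for x y
    by (simp add: wstar_def evl_map_rev)
  show ?thesis unfolding 1 3
    by (simp only: rev_append rev.simps append.simps rstar.simps evl_append 2 if_distrib[of "evl _"] evl_Nil)
      auto
qed

text \<open>A linear functional on words is a real-valued function on words; it is a character when it
  is multiplicative for the star product.  The iterated integrals at a fixed time form one almost
  surely, and so does the coefficient of the empty word.\<close>
definition char_on :: "nat \<Rightarrow> (nat list \<Rightarrow> real) \<Rightarrow> bool" where
  "char_on d s \<longleftrightarrow> s [] = 1 \<and>
     (\<forall>u v. set u \<subseteq> {0..d} \<longrightarrow> set v \<subseteq> {0..d} \<longrightarrow> s u * s v = evl s (wstar u v))"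

lemma char_on_Nil: "char_on d s \<Longrightarrow> s [] = 1"
  by (simp add: char_on_def)

lemma char_on_wstar:
  "char_on d s \<Longrightarrow> set u \<subseteq> {0..d} \<Longrightarrow> set v \<subseteq> {0..d} \<Longrightarrow> evl s (wstar u v) = s u * s v"
  by (simp add: char_on_def)

lemma lstar_Nil [simp]: "lstar [] y = []"
  by (simp add: lstar_def)

lemma lstar_Cons: "lstar (p # x) y = lstar [p] y @ lstar x y"
  by (simp add: lstar_def)

lemma lstar_Nil2: "lstar x [] = []"
  by (induction x) (auto simp: lstar_def)

lemma lstar_Cons_single: "lstar [(a, u)] ((b, v) # y) = lscale (a * b) (wstar u v) @ lstar [(a, u)] y"
  by (simp add: lstar_def)

lemma lc_over_lstar:
  assumes "0 \<in> A" "lc_over A x" "lc_over A y" shows "lc_over A (lstar x y)"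
  using assms(2)
proof (induction x)
  case (Cons p x)
  obtain a u where p: "p = (a, u)" by (cases p)
  have "lc_over A (lstar [(a, u)] y)"
    using assms(3)
  proof (induction y)
    case (Cons q y)
    then show ?case using \<open>lc_over A (p # x)\<close> assms(1) p
      by (cases q) (simp add: lstar_Cons_single lc_over_lscale lc_over_wstar)
  qed (simp add: lstar_Nil2)
  then show ?case using Cons by (subst lstar_Cons) (simp add: p)
qed simp

lemma evl_lstar:
  assumes "char_on d s" "lc_over {0..d} x" "lc_over {0..d} y"
  shows "evl s (lstar x y) = evl s x * evl s y"
  using assms(2)
proof (induction x)
  case (Cons p x)
  obtain a u where p: "p = (a, u)" by (cases p)
  have "evl s (lstar [(a, u)] y) = a * s u * evl s y"
    using assms(3)
  proof (induction y)
    case (Cons q y)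
    then show ?case using \<open>lc_over {0..d} (p # x)\<close> p assms(1)
      by (cases q) (simp add: lstar_Cons_single evl_lscale char_on_wstar algebra_simps)
  qed (simp add: lstar_Nil2)
  then show ?case using Cons by (subst lstar_Cons) (simp add: p algebra_simps)
qed simp

text \<open>The transpose of \<open>Dl a\<close>, acting on functionals in place of formal
  sums.\<close>

definition sD :: "(nat list \<Rightarrow> real) \<Rightarrow> nat \<Rightarrow> nat list \<Rightarrow> real" where
  "sD s a h = (if h \<noteq> [] \<and> last h = a then s (butlast h) else 0)"

lemma evl_Dl_sD: "evl s (Dl a x) = evl (sD s a) x"
  by (simp add: evl_Dl sD_def[abs_def])

text \<open>Only \<open>b = last h\<close> contributes. Read backwards, this replaces the condition
  \<open>rho\<close> on two last letters by a sum over Brownian letters, which separates the two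
  words.\<close>

lemma sum_sD:
  assumes "set h \<subseteq> {0..d}"
  shows "(\<Sum>b\<in>{1..d}. E b * sD s b h) = (if h \<noteq> [] \<and> last h > 0 then E (last h) * s (butlast h) else 0)"
proof (cases "h \<noteq> [] \<and> last h > 0")
  case True
  then have "last h \<in> {1..d}" using assms last_in_set[of h] by fastforce
  moreover have "(\<Sum>b\<in>{1..d}. E b * sD s b h) = (\<Sum>b\<in>{1..d}. if b = last h then E (last h) * s (butlast h) else 0)"
    using True by (intro sum.cong) (auto simp: sD_def)
  ultimately show ?thesis using True by simp
next
  case False
  then show ?thesis by (auto simp: sD_def intro!: sum.neutral)
qed

text \<open>A derivation rule over the character \<open>s\<close>, corrected for the time letter as
  in the Ito product rule. Empty words fit in because \<open>sD\<close> is 0 there.\<close>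

lemma evl_Dl_wstar:
  assumes s: "char_on d s" and u: "set u \<subseteq> {0..d}" and v: "set v \<subseteq> {0..d}"
  shows "evl s (Dl a (wstar u v)) = sD s a u * s v + s u * sD s a v +
     (if a = 0 then (\<Sum>b\<in>{1..d}. sD s b u * sD s b v) else 0)"
proof (cases u rule: rev_exhaust)
  case Nil
  then show ?thesis using char_on_Nil[OF s] by (simp add: wstar_Nil evl_Dl_sD sD_def)
next
  case (snoc u' i)
  show ?thesis
  proof (cases v rule: rev_exhaust)
    case Nil
    then show ?thesis using char_on_Nil[OF s] by (simp add: wstar_Nil evl_Dl_sD sD_def)
  next
    case (snoc v' j)
    have ov: "set u' \<subseteq> {0..d}" "set v' \<subseteq> {0..d}" "set (u' @ [i]) \<subseteq> {0..d}" "set (v' @ [j]) \<subseteq> {0..d}"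
      using u v \<open>u = u' @ [i]\<close> snoc by auto
    have "(\<Sum>b\<in>{1..d}. sD s b (u' @ [i]) * sD s b (v' @ [j])) = (if rho i j then s u' * s v' else 0)"
      using sum_sD[OF ov(4), of "\<lambda>b. sD s b (u' @ [i])" s] by (auto simp: sD_def rho_def)
    then show ?thesis
      unfolding \<open>u = u' @ [i]\<close> snoc evl_Dl_wstar_snoc using ov
      by (auto simp: char_on_wstar[OF s] sD_def)
  qed
qed

lemma evl_Dl_lstar:
  assumes s: "char_on d s" and x: "lc_over {0..d} x" and y: "lc_over {0..d} y"
  shows "evl s (Dl a (lstar x y)) = evl s (Dl a x) * evl s y + evl s x * evl s (Dl a y) +
     (if a = 0 then (\<Sum>b\<in>{1..d}. evl s (Dl b x) * evl s (Dl b y)) else 0)"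
  using x
proof (induction x)
  case (Cons p x)
  obtain r u where p: "p = (r, u)" by (cases p)
  have u: "set u \<subseteq> {0..d}" using Cons.prems p by simp
  have 1: "evl s (Dl a (lstar [(r, u)] y)) = r * sD s a u * evl s y + r * s u * evl s (Dl a y) +
     (if a = 0 then (\<Sum>b\<in>{1..d}. r * sD s b u * evl s (Dl b y)) else 0)"
    using y
  proof (induction y)
    case (Cons q y)
    obtain r' v where q: "q = (r', v)" by (cases q)
    have v: "set v \<subseteq> {0..d}" using Cons.prems q by simp
    have w: "evl s (Dl a (lscale (r * r') (wstar u v))) = r * r' * (sD s a u * s v + s u * sD s a v +
     (if a = 0 then (\<Sum>b\<in>{1..d}. sD s b u * sD s b v) else 0))"
      unfolding evl_Dl_wstar[OF s u v, symmetric] by (simp add: evl_Dl evl_lscale)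
    have c: "evl s (Dl b ((r', v) # y)) = r' * sD s b v + evl s (Dl b y)" for b
      by (simp add: evl_Dl_sD)
    show ?case using Cons unfolding q lstar_Cons_single Dl_append evl_append w c
      by (simp add: sum.distrib sum_distrib_left algebra_simps)
  qed (simp add: lstar_Nil2)
  have 2: "evl s (Dl b (p # x)) = r * sD s b u + evl s (Dl b x)" for b
    by (simp add: evl_Dl_sD p)
  have 3: "evl s (Dl a (lstar (p # x) y)) = evl s (Dl a (lstar [p] y)) + evl s (Dl a (lstar x y))"
    by (subst lstar_Cons) simp
  have 4: "evl s (p # x) = r * s u + evl s x" by (simp add: p)
  have "lc_over {0..d} x" using Cons.prems p by simp
  then show ?case using Cons.IH unfolding 3 2 4 1[folded p]
    by (simp add: sum.distrib algebra_simps)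
qed simp

section \<open>The operators as Ito calculus under a character\<close>

context
  fixes d L :: nat and cf :: "nat list \<Rightarrow> real"
begin

text \<open>The empty word is removed, so that evaluation gives the centred variable
  \<open>Y\<close> and \<open>cf []\<close> stays the centre of the Taylor expansion.\<close>

definition C0 :: lc where "C0 = map (\<lambda>I. (cf I, I)) (filter (\<lambda>I. I \<noteq> []) (words d L))"

lemma words_over: "I \<in> set (words d L) \<Longrightarrow> set I \<subseteq> {0..d}"
  by (auto simp: words_def set_n_lists)

lemma lc_over_C0: "lc_over {0..d} C0"
  using words_over by (auto simp: lc_over_def C0_def)

text \<open>Stands for \<open>Y^m\<close> times \<open>x\<close>. The iteration fixes the
  bracketing, so associativity of the star product never arises.\<close>

definition Pm :: "nat \<Rightarrow> lc \<Rightarrow> lc" where "Pm m x = (lstar C0 ^^ m) x"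

lemma Pm_0 [simp]: "Pm 0 x = x"
  by (simp add: Pm_def)

lemma Pm_Suc: "Pm (Suc m) x = lstar C0 (Pm m x)"
  by (simp add: Pm_def)

lemma lc_over_Pm: "lc_over {0..d} x \<Longrightarrow> lc_over {0..d} (Pm m x)"
  by (induction m) (auto simp: Pm_Suc intro: lc_over_lstar lc_over_C0)

lemma evl_Pm:
  assumes "char_on d s" "lc_over {0..d} x"
  shows "evl s (Pm m x) = evl s C0 ^ m * evl s x"
  by (induction m) (simp_all add: Pm_Suc evl_lstar[OF assms(1) lc_over_C0 lc_over_Pm[OF assms(2)]])

text \<open>For a Brownian letter there is no correction term, so the ordinary power rule applies.
  At \<open>m = 0\<close> the truncated exponent is harmless because of the factor
  \<open>real m\<close>.\<close>

lemma evl_Dl_Pm: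
  assumes "char_on d s" "lc_over {0..d} x" "a \<noteq> 0"
  shows "evl s (Dl a (Pm m x)) = real m * evl s C0 ^ (m - 1) * evl s (Dl a C0) * evl s x + evl s C0 ^ m * evl s (Dl a x)"
proof (induction m)
  case (Suc m)
  have "evl s (Dl a (Pm (Suc m) x)) = evl s (Dl a C0) * (evl s C0 ^ m * evl s x) + evl s C0 * evl s (Dl a (Pm m x))"
    using assms(3) unfolding Pm_Suc evl_Dl_lstar[OF assms(1) lc_over_C0 lc_over_Pm[OF assms(2)]] evl_Pm[OF assms(1,2)] by simp
  then show ?case unfolding Suc.IH by (cases m) (simp_all add: algebra_simps)
qed simp

lemma sum_list_product:
  fixes f g :: "'b \<Rightarrow> real"
  shows "(\<Sum>I\<leftarrow>xs. \<Sum>J\<leftarrow>ys. c * (f I * g J)) = c * ((\<Sum>I\<leftarrow>xs. f I) * (\<Sum>J\<leftarrow>ys. g J))"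
  by (induction xs) (simp_all add: sum_list_const_mult algebra_simps)

text \<open>The empty word may be restored to the sum, since \<open>sD\<close> is 0 on it.\<close>

lemma sum_list_C0: "evl s (Dl b C0) = (\<Sum>I\<leftarrow>words d L. cf I * sD s b I)"
proof -
  have "evl g (map (\<lambda>I. (cf I, I)) (filter (\<lambda>I. I \<noteq> []) ws)) = (\<Sum>I\<leftarrow>ws. if I = [] then 0 else cf I * g I)" for g ws
    by (induction ws) auto
  then show ?thesis unfolding evl_Dl_sD C0_def
    by (simp add: sD_def if_distrib cong: if_cong) (auto intro!: arg_cong[where f=sum_list] map_cong)
qed

text \<open>The terms of Ito's formula that carry one derivative of \<open>f\<close>: the drift of
  \<open>Y\<close> times \<open>x\<close>, plus the covariation of \<open>Y\<close> with
  \<open>x\<close>.\<close>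

lemma evl_G1:
  assumes s: "char_on d s" and x: "lc_over {0..d} x"
  shows "evl s (G1 d L cf x) = evl s (Dl 0 C0) * evl s x + (\<Sum>b\<in>{1..d}. evl s (Dl b C0) * evl s (Dl b x))"
  using x
proof (induction x)
  case Nil show ?case by (simp add: G1_def)
next
  case (Cons p x)
  obtain r h where p: "p = (r, h)" by (cases p)
  have h: "set h \<subseteq> {0..d}" "lc_over {0..d} x" using Cons.prems p by auto
  have G: "evl s (G1 d L cf (p # x)) = evl s (G1 d L cf [p]) + evl s (G1 d L cf x)"
    by (simp add: G1_def)
  have "evl s (G1 d L cf [p]) = (\<Sum>I\<leftarrow>words d L. if I = [] then 0 else cf I * r * s (butlast I) *
     ((if last I = 0 then s h else 0) + (if h \<noteq> [] \<and> rho (last I) (last h) then s (butlast h) else 0)))"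
  proof -
    have "evl s (if I = [] then []
      else lstar [(cf I * r, butlast I)]
             ((if last I = 0 then [(1, h)] else []) @
              (if h \<noteq> [] \<and> rho (last I) (last h) then [(1, butlast h)] else []))) =
      (if I = [] then 0 else cf I * r * s (butlast I) *
     ((if last I = 0 then s h else 0) + (if h \<noteq> [] \<and> rho (last I) (last h) then s (butlast h) else 0)))"
      if "I \<in> set (words d L)" for I
    proof (cases "I = []")
      case False
      have "set (butlast I) \<subseteq> {0..d}" "set (butlast h) \<subseteq> {0..d}"
        using words_over[OF that] h(1) by (auto dest!: in_set_butlastD)
      then show ?thesis using False h(1)
        by (subst if_not_P[OF False], subst evl_lstar[OF s]) auto
    qed simp
    then show ?thesis unfolding G1_def p
      by (simp add: evl_concat_map cong: map_cong)
  qed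
  also have "\<dots> = (\<Sum>I\<leftarrow>words d L. r * s h * (cf I * sD s 0 I) +
      r * (if h \<noteq> [] \<and> last h > 0 then cf I * sD s (last h) I * s (butlast h) else 0))"
    by (intro arg_cong[where f=sum_list] map_cong) (auto simp: sD_def rho_def)
  also have "\<dots> = r * s h * evl s (Dl 0 C0) +
      r * (if h \<noteq> [] \<and> last h > 0 then evl s (Dl (last h) C0) * s (butlast h) else 0)"
    by (auto simp: sum_list_C0 sum_list_addf sum_list_const_mult sum_list_mult_const)
  also have "(if h \<noteq> [] \<and> last h > 0 then evl s (Dl (last h) C0) * s (butlast h) else 0) =
     (\<Sum>b\<in>{1..d}. evl s (Dl b C0) * sD s b h)"
    using sum_sD[OF h(1), of "\<lambda>b. evl s (Dl b C0)" s] by simp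
  finally show ?case unfolding G using Cons.IH h(2)
    by (simp add: p evl_Dl_sD sum.distrib sum_distrib_left algebra_simps)
qed

text \<open>Half the quadratic variation rate of \<open>Y\<close>, times \<open>x\<close>. Writing
  \<open>rho\<close> as a sum over letters lets the double sum over words factor into a square for
  each letter.\<close>

lemma evl_G2:
  assumes s: "char_on d s" and x: "lc_over {0..d} x"
  shows "evl s (G2 d L cf x) = (\<Sum>b\<in>{1..d}. (evl s (Dl b C0))^2) / 2 * evl s x"
  using x
proof (induction x)
  case Nil show ?case by (simp add: G2_def)
next
  case (Cons p x)
  obtain r h where p: "p = (r, h)" by (cases p)
  have h: "set h \<subseteq> {0..d}" "lc_over {0..d} x" using Cons.prems p by auto
  have G: "evl s (G2 d L cf (p # x)) = evl s (G2 d L cf [p]) + evl s (G2 d L cf x)"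
    by (simp add: G2_def)
  have "evl s (G2 d L cf [p]) = (\<Sum>I\<leftarrow>words d L. \<Sum>J\<leftarrow>words d L.
     \<Sum>b\<in>{1..d}. r / 2 * s h * ((cf I * sD s b I) * (cf J * sD s b J)))"
  proof -
    have "evl s (if I \<noteq> [] \<and> J \<noteq> [] \<and> rho (last I) (last J)
      then lstar (lstar [(cf I * cf J * r / 2, butlast I)] [(1, butlast J)]) [(1, h)] else []) =
     (\<Sum>b\<in>{1..d}. r / 2 * s h * ((cf I * sD s b I) * (cf J * sD s b J)))"
      if I: "I \<in> set (words d L)" and J: "J \<in> set (words d L)" for I J
    proof -
      have o: "set (butlast I) \<subseteq> {0..d}" "set (butlast J) \<subseteq> {0..d}"
        using words_over[OF I] words_over[OF J] by (auto dest!: in_set_butlastD)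
      have "(\<Sum>b\<in>{1..d}. r / 2 * s h * ((cf I * sD s b I) * (cf J * sD s b J))) =
        (\<Sum>b\<in>{1..d}. (r / 2 * s h * cf I * cf J * sD s b I) * sD s b J)"
        by (simp add: mult_ac)
      also have "\<dots> = (if J \<noteq> [] \<and> last J > 0 then (r / 2 * s h * cf I * cf J * sD s (last J) I) * s (butlast J) else 0)"
        by (rule sum_sD[OF words_over[OF J]])
      also have "\<dots> = evl s (if I \<noteq> [] \<and> J \<noteq> [] \<and> rho (last I) (last J)
      then lstar (lstar [(cf I * cf J * r / 2, butlast I)] [(1, butlast J)]) [(1, h)] else [])"
        using o h(1) by (auto simp: sD_def rho_def evl_lstar[OF s] lc_over_lstar)
      finally show ?thesis ..
    qed
    then show ?thesis unfolding G2_def p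
      by (simp add: evl_concat_map cong: map_cong)
  qed
  also have "\<dots> = (\<Sum>b\<in>{1..d}. \<Sum>I\<leftarrow>words d L. \<Sum>J\<leftarrow>words d L. r / 2 * s h * ((cf I * sD s b I) * (cf J * sD s b J)))"
    by (simp add: sum_list_sum_nth sum.swap[of _ _ "{Suc 0..d}"])
  also have "\<dots> = (\<Sum>b\<in>{1..d}. r / 2 * s h * (evl s (Dl b C0))^2)"
    unfolding sum_list_product sum_list_C0[symmetric] power2_eq_square ..
  also have "\<dots> = (\<Sum>b\<in>{1..d}. (evl s (Dl b C0))^2) / 2 * (r * s h)"
    unfolding sum_distrib_left[symmetric] by simp
  finally show ?case unfolding G Cons.IH[OF h(2)] by (simp add: p distrib_left)
qed

lemma lc_over_G1:
  assumes "lc_over {0..d} x" shows "lc_over {0..d} (G1 d L cf x)"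
proof -
  have "lc_over {0..d} (if I = [] then []
      else lstar [(cf I * r, butlast I)]
             ((if last I = 0 then [(1, h)] else []) @
              (if h \<noteq> [] \<and> rho (last I) (last h) then [(1, butlast h)] else [])))"
    if "(r, h) \<in> set x" "I \<in> set (words d L)" for r h I
  proof -
    have h: "set h \<subseteq> {0..d}" using assms that by (auto simp: lc_over_def)
    have "set (butlast I) \<subseteq> {0..d}" "set (butlast h) \<subseteq> {0..d}"
      using words_over[OF that(2)] h by (auto dest!: in_set_butlastD)
    then show ?thesis using h by (auto intro!: lc_over_lstar)
  qed
  then show ?thesis unfolding G1_def by (auto intro!: lc_over_concat_map)
qed

lemma lc_over_G2:
  assumes "lc_over {0..d} x" shows "lc_over {0..d} (G2 d L cf x)"
proof -
  have "lc_over {0..d} (if I \<noteq> [] \<and> J \<noteq> [] \<and> rho (last I) (last J)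
      then lstar (lstar [(cf I * cf J * r / 2, butlast I)] [(1, butlast J)]) [(1, h)]
      else [])"
    if "(r, h) \<in> set x" "I \<in> set (words d L)" "J \<in> set (words d L)" for r h I J
  proof -
    have h: "set h \<subseteq> {0..d}" using assms that by (auto simp: lc_over_def)
    have "set (butlast I) \<subseteq> {0..d}" "set (butlast J) \<subseteq> {0..d}"
      using words_over[OF that(2)] words_over[OF that(3)] by (auto dest!: in_set_butlastD)
    then show ?thesis using h by (auto intro!: lc_over_lstar)
  qed
  then show ?thesis unfolding G2_def by (auto intro!: lc_over_concat_map)
qed

text \<open>The drift part of Ito's formula for \<open>Y^m\<close> times \<open>x\<close>. The
  factor 1/2 of the second-order term is contained in \<open>G2\<close>, so
  \<open>m * (m - 1)\<close> appears without it.\<close>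

lemma evl_G0_Pm:
  assumes s: "char_on d s" and x: "lc_over {0..d} x"
  shows "evl s (G0 (Pm m x)) = evl s C0 ^ m * evl s (G0 x)
     + real m * evl s C0 ^ (m - 1) * evl s (G1 d L cf x)
     + real m * real (m - 1) * evl s C0 ^ (m - 2) * evl s (G2 d L cf x)"
  unfolding G0_Dl
proof (induction m)
  case (Suc m)
  let ?c = "evl s C0"
  have D: "evl s (Dl b (Pm m x)) = real m * ?c ^ (m - 1) * evl s (Dl b C0) * evl s x + ?c ^ m * evl s (Dl b x)"
    if "b \<in> {1..d}" for b
    using evl_Dl_Pm[OF s x, of b m] that by simp
  have "(\<Sum>b\<in>{1..d}. evl s (Dl b C0) * evl s (Dl b (Pm m x))) =
    (\<Sum>b\<in>{1..d}. real m * ?c ^ (m - 1) * evl s x * (evl s (Dl b C0))^2 + ?c ^ m * (evl s (Dl b C0) * evl s (Dl b x)))"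
    using D by (intro sum.cong) (auto simp: power2_eq_square algebra_simps)
  \<comment> \<open>\<open>evl_G2\<close> and \<open>evl_G1\<close> are solved for the two sums; the
    2 undoes the half in \<open>G2\<close>.\<close>
  also have "\<dots> = 2 * real m * ?c ^ (m - 1) * evl s (G2 d L cf x) + ?c ^ m * (evl s (G1 d L cf x) - evl s (Dl 0 C0) * evl s x)"
    unfolding sum.distrib sum_distrib_left[symmetric] evl_G2[OF s x] evl_G1[OF s x] by simp
  finally have sum: "(\<Sum>b\<in>{1..d}. evl s (Dl b C0) * evl s (Dl b (Pm m x))) = \<dots>" .
  have "evl s (Dl 0 (Pm (Suc m) x)) = evl s (Dl 0 C0) * (?c ^ m * evl s x) + ?c * evl s (Dl 0 (Pm m x)) +
     (\<Sum>b\<in>{1..d}. evl s (Dl b C0) * evl s (Dl b (Pm m x)))"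
    by (simp add: Pm_Suc evl_Dl_lstar[OF s lc_over_C0 lc_over_Pm[OF x]] evl_Pm[OF s x])
  also have "\<dots> = ?c * evl s (Dl 0 (Pm m x)) + 2 * real m * ?c ^ (m - 1) * evl s (G2 d L cf x) + ?c ^ m * evl s (G1 d L cf x)"
    unfolding sum by (simp add: algebra_simps)
  \<comment> \<open>Uses \<open>2 * m + m * (m - 1) = (m + 1) * m\<close>; the case splits deal with
    the truncated exponents.\<close>
  also have "\<dots> = ?c ^ Suc m * evl s (Dl 0 x) + real (Suc m) * ?c ^ (Suc m - 1) * evl s (G1 d L cf x)
     + real (Suc m) * real (Suc m - 1) * ?c ^ (Suc m - 2) * evl s (G2 d L cf x)"
  proof (cases m)
    case (Suc k)
    then show ?thesis unfolding Suc.IH by (cases k) (simp_all add: algebra_simps)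
  qed (simp add: Suc.IH)
  finally show ?case .
qed simp

end

subsection \<open>Moments and Taylor expansion\<close>

lemma emptycoef_evl: "emptycoef x = evl (\<lambda>w. if w = [] then 1 else 0) x"
  unfolding emptycoef_def evl_def by (intro arg_cong[where f=sum_list] map_cong) auto

text \<open>Each step of the star recursion adds a letter, so the empty word arises only from two
  empty words. This character settles the case \<open>n = 0\<close> of
  \<open>ecoef_Pm\<close>.\<close>

lemma char_on_emptycoef: "char_on d (\<lambda>w. if w = [] then 1 else 0)"
proof -
  have "evl (\<lambda>w. if w = [] then 1 else 0) (wstar u v) = (if u = [] \<and> v = [] then 1 else 0)" for u v
  proof (cases "u = [] \<or> v = []")
    case True
    then show ?thesis by (auto simp: wstar_Nil)
  next
    case False
    then obtain i I j J where "rev u = i # I" "rev v = j # J"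
      by (metis list.exhaust rev_is_Nil_conv)
    moreover have "evl (\<lambda>w. if rev w = [] then 1 else 0) (lprep a x) = 0" for a x
      by (induction x) (auto simp: lprep_def)
    ultimately show ?thesis using False by (simp add: wstar_def evl_map_rev)
  qed
  then show ?thesis by (auto simp: char_on_def)
qed

definition ecoef :: "nat \<Rightarrow> lc \<Rightarrow> real" where
  "ecoef n x = emptycoef ((G0 ^^ n) x)"

lemma ecoef_Suc: "ecoef (Suc n) x = ecoef n (G0 x)"
  unfolding ecoef_def funpow_Suc_right by simp

text \<open>Each \<open>G0\<close> strips one final 0, so \<open>n\<close> of them produce the empty
  word only from \<open>replicate n 0\<close>.\<close>

lemma ecoef_evl: "ecoef n x = evl (\<lambda>w. if w = replicate n 0 then 1 else 0) x"
proof (induction n arbitrary: x)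
  case 0
  then show ?case by (simp add: ecoef_def emptycoef_evl)
next
  case (Suc n)
  have eq: "(h \<noteq> [] \<and> last h = 0 \<and> butlast h = replicate n 0) \<longleftrightarrow> h = replicate (Suc n) 0" for h :: "nat list"
    unfolding replicate_Suc replicate_append_same[symmetric]
    by (metis append_butlast_last_id butlast_snoc last_snoc snoc_eq_iff_butlast)
  have "ecoef (Suc n) x = evl (\<lambda>h. if h \<noteq> [] \<and> last h = 0 then if butlast h = replicate n 0 then 1 else 0 else 0) x"
    unfolding ecoef_Suc Suc.IH G0_Dl evl_Dl ..
  also have "\<dots> = evl (\<lambda>w. if w = replicate (Suc n) 0 then 1 else 0) x"
    by (rule evl_cong) (auto simp only: eq[symmetric] simp_thms split: if_splits)
  finally show ?case .
qed

text \<open>The left side is the expectation of \<open>x\<close> against the signature. It becomes a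
  polynomial in \<open>t\<close>; enlarging \<open>B\<close> beyond the word lengths only adds zero
  terms.\<close>

lemma evl_time_words:
  assumes "\<forall>(r,w)\<in>set x. length w \<le> B"
  shows "evl (\<lambda>w. if set w \<subseteq> {0} then t ^ length w / fact (length w) else 0) x
    = (\<Sum>n\<le>B. t ^ n / fact n * ecoef n x)"
  using assms
proof (induction x)
  case Nil show ?case by (simp add: ecoef_evl)
next
  case (Cons p x)
  obtain r w where p: "p = (r, w)" by (cases p)
  have w: "length w \<le> B" using Cons.prems p by auto
  have "(\<Sum>n\<le>B. t ^ n / fact n * (if w = replicate n 0 then 1 else 0)) =
    (if set w \<subseteq> {0} then t ^ length w / fact (length w) else 0)"
  proof (cases "set w \<subseteq> {0}")
    case True
    then have "w = replicate (length w) 0" by (simp add: replicate_length_same subset_iff)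
    then have "(w = replicate n 0) \<longleftrightarrow> n = length w" for n by (metis length_replicate)
    then have "(\<Sum>n\<le>B. t ^ n / fact n * (if w = replicate n 0 then 1 else 0)) =
      (\<Sum>n\<le>B. if n = length w then t ^ length w / fact (length w) else 0)"
      by (intro sum.cong) auto
    then show ?thesis using True w by simp
  next
    case False
    then have "w \<noteq> replicate n 0" for n by auto
    then show ?thesis using False by simp
  qed
  note word = this
  have "(\<Sum>n\<le>B. t ^ n / fact n * ecoef n (p # x)) =
    r * (\<Sum>n\<le>B. t ^ n / fact n * (if w = replicate n 0 then 1 else 0)) + (\<Sum>n\<le>B. t ^ n / fact n * ecoef n x)"
    unfolding sum_distrib_left sum.distrib[symmetric]
    by (intro sum.cong refl) (simp add: p ecoef_evl distrib_left)
  then show ?case unfolding word using Cons by (simp add: p)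
qed

lemma ex_length_bound: "\<exists>B. \<forall>(r,w)\<in>set (x::lc). length w \<le> B"
proof (induction x)
  case (Cons p x)
  then obtain B where "\<forall>(r,w)\<in>set x. length w \<le> B" by blast
  then show ?case by (intro exI[of _ "max B (length (snd p))"]) (fastforce simp: max_def)
qed simp

section \<open>Sequences of operators and the moments of \<open>Y\<close>\<close>

definition Kseq :: "nat \<Rightarrow> nat list set" where
  "Kseq n = {ks. length ks = n \<and> set ks \<subseteq> {0..2}}"

lemma finite_Kseq: "finite (Kseq n)"
  unfolding Kseq_def using finite_lists_length_eq[of "{0..2::nat}" n] by (simp add: conj_commute)

lemma Kseq_0: "Kseq 0 = {[]}"
  by (auto simp: Kseq_def)

text \<open>Splits by the first entry, which is the operator that \<open>Gseq\<close> applies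
  first.\<close>

lemma sum_Kseq_Suc: "(\<Sum>ks\<in>Kseq (Suc n). g ks) = (\<Sum>ks\<in>Kseq n. g (0 # ks)) + (\<Sum>ks\<in>Kseq n. g (1 # ks)) + (\<Sum>ks\<in>Kseq n. g (2 # ks))"
  for g :: "nat list \<Rightarrow> real"
proof -
  have eq: "Kseq (Suc n) = (Cons 0 ` Kseq n \<union> Cons 1 ` Kseq n) \<union> Cons 2 ` Kseq n"
  proof -
    have "{0..2::nat} = {0,1,2}" by auto
    then show ?thesis by (auto simp: Kseq_def length_Suc_conv image_iff)
  qed
  show ?thesis unfolding eq
    by (subst sum.union_disjoint, (auto simp: finite_Kseq)[3], subst sum.union_disjoint, (auto simp: finite_Kseq)[3])
      (simp add: sum.reindex)
qed

lemma sum_list_Kseq: "ks \<in> Kseq n \<Longrightarrow> sum_list ks \<le> 2 * n"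
  using sum_list_mono[of ks "\<lambda>x. x" "\<lambda>_. 2"] by (auto simp: Kseq_def sum_list_triv subset_iff)

text \<open>The empty word heads the list \<open>words d L\<close> and occurs there once.\<close>

lemma sum_list_words: "(\<Sum>I\<leftarrow>words d L. cf I * s I) = cf [] * s [] + evl s (C0 d L cf)"
proof -
  define ws where "ws = concat (map (\<lambda>k. List.n_lists k [0..<Suc d]) [1..<Suc L])"
  have w: "words d L = [] # ws"
    unfolding words_def ws_def upt_conv_Cons[of 0 "Suc L", OF zero_less_Suc] by simp
  have "I \<noteq> []" if "I \<in> set ws" for I
    using that by (auto simp: ws_def length_n_lists_elem dest!: length_n_lists_elem)
  then have f: "filter (\<lambda>I. I \<noteq> []) ws = ws" by (simp add: filter_id_conv)
  have "evl s (map (\<lambda>I. (cf I, I)) ws) = (\<Sum>I\<leftarrow>ws. cf I * s I)" by (induction ws) auto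
  then show ?thesis by (simp add: w C0_def f)
qed

context ito_signature begin

lemma S_Nil: "S [] t \<omega> = 1"
  using Sr_Nil by (simp add: Sr_def)

lemma char_on_S:
  assumes "0 < t" shows "AE \<omega> in M. char_on d (\<lambda>w. S w t \<omega>)"
  using S_product[OF assms] by eventually_elim (simp add: char_on_def S_Nil)

text \<open>Evaluations are compared only at realised signatures that are characters, which is
  almost surely the case for positive \<open>t\<close>; this already fixes the expectation as a
  polynomial in \<open>t\<close>.\<close>

lemma ecoef_cong:
  assumes x: "lc_over {0..d} x" and y: "lc_over {0..d} y"
    and eq: "\<And>t \<omega>. char_on d (\<lambda>w. S w t \<omega>) \<Longrightarrow> evl (\<lambda>w. S w t \<omega>) x = evl (\<lambda>w. S w t \<omega>) y"
  shows "ecoef n x = ecoef n y"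
proof -
  obtain B1 B2 where B: "\<forall>(r,w)\<in>set x. length w \<le> B1" "\<forall>(r,w)\<in>set y. length w \<le> B2"
    using ex_length_bound by blast
  \<comment> \<open>Includes \<open>n\<close>, so that the coefficient in question occurs in the
    sum.\<close>
  define B where "B = max n (max B1 B2)"
  have Bx: "\<forall>(r,w)\<in>set x. length w \<le> B" and By: "\<forall>(r,w)\<in>set y. length w \<le> B"
    using B by (fastforce simp: B_def)+
  have "(\<Sum>k\<le>B. (ecoef k x - ecoef k y) / fact k * t ^ k) = 0" if "0 < t" for t
  proof -
    have "AE \<omega> in M. evl (\<lambda>w. S w t \<omega>) x = evl (\<lambda>w. S w t \<omega>) y"
      using char_on_S[OF that] by eventually_elim (rule eq)
    then have "expectation (\<lambda>\<omega>. evl (\<lambda>w. S w t \<omega>) x) = expectation (\<lambda>\<omega>. evl (\<lambda>w. S w t \<omega>) y)"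
      by (intro integral_cong_AE evl_S_sq_integrable(1) that x y)
    then have "(\<Sum>k\<le>B. t ^ k / fact k * ecoef k x) = (\<Sum>k\<le>B. t ^ k / fact k * ecoef k y)"
      unfolding expectation_evl[OF that x] expectation_evl[OF that y] evl_time_words[OF Bx] evl_time_words[OF By] .
    moreover have "(\<Sum>k\<le>B. (ecoef k x - ecoef k y) / fact k * t ^ k) =
      (\<Sum>k\<le>B. t ^ k / fact k * ecoef k x) - (\<Sum>k\<le>B. t ^ k / fact k * ecoef k y)"
      unfolding sum_subtractf[symmetric] by (intro sum.cong refl) (simp add: diff_divide_distrib algebra_simps)
    ultimately show ?thesis by simp
  qed
  then have "{0<..} \<subseteq> {t. (\<Sum>k\<le>B. (ecoef k x - ecoef k y) / fact k * t ^ k) = 0}" by auto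
  then have "infinite {t. (\<Sum>k\<le>B. (ecoef k x - ecoef k y) / fact k * t ^ k) = 0}"
    using infinite_Ioi[of "0::real"] finite_subset by blast
  moreover have "n \<le> B" by (simp add: B_def)
  ultimately have "(ecoef n x - ecoef n y) / fact n = 0"
    using Transcendental.polyfun_rootbound[of "\<lambda>k. (ecoef k x - ecoef k y) / fact k" n B] by blast
  then show ?thesis by simp
qed

lemma ecoef_append: "ecoef n (x @ y) = ecoef n x + ecoef n y"
  by (simp add: ecoef_evl)

lemma ecoef_lscale: "ecoef n (lscale c x) = c * ecoef n x"
  by (simp add: ecoef_evl evl_lscale)

text \<open>Induction on \<open>n\<close>: one \<open>G0\<close> is moved inside by Ito's formula.
  Its three terms apply operator 0, 1 or 2 to \<open>x\<close> and lower the power \<open>m\<close>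
  by that number, so after \<open>n\<close> steps exactly the sequences with sum \<open>m\<close>
  survive.\<close>

lemma ecoef_Pm:
  assumes "lc_over {0..d} x"
  shows "ecoef n (Pm d L cf m x) =
    (\<Sum>ks\<in>Kseq n. (if sum_list ks = m then fact m else 0) * emptycoef (Gseq d L cf ks x))"
  using assms
proof (induction n arbitrary: m x)
  case 0
  \<comment> \<open>Having no empty word, \<open>C0\<close> is invisible to the empty coefficient,
    so only \<open>m = 0\<close> contributes.\<close>
  have "evl (\<lambda>w. if w = [] then 1 else 0) (C0 d L cf) = 0"
  proof -
    have "evl (\<lambda>w. if w = [] then 1 else 0) (map (\<lambda>I. (cf I, I)) (filter (\<lambda>I. I \<noteq> []) ws)) = 0" for ws
      by (induction ws) auto
    then show ?thesis unfolding C0_def .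
  qed
  then have "emptycoef (Pm d L cf m x) = 0 ^ m * emptycoef x"
    unfolding emptycoef_evl evl_Pm[OF char_on_emptycoef 0] by simp
  then show ?case by (simp add: ecoef_def Kseq_0 Gseq_def power_0_left)
next
  case (Suc n)
  have over: "lc_over {0..d} (G0 x)" "lc_over {0..d} (G1 d L cf x)" "lc_over {0..d} (G2 d L cf x)"
    using Suc.prems lc_over_G1 lc_over_G2 lc_over_Dl by (auto simp: G0_Dl)
  let ?y = "Pm d L cf m (G0 x) @ lscale (real m) (Pm d L cf (m - 1) (G1 d L cf x))
     @ lscale (real m * real (m - 1)) (Pm d L cf (m - 2) (G2 d L cf x))"
  have "ecoef (Suc n) (Pm d L cf m x) = ecoef n (G0 (Pm d L cf m x))" by (rule ecoef_Suc)
  also have "\<dots> = ecoef n ?y"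
  proof (rule ecoef_cong)
    show "lc_over {0..d} (G0 (Pm d L cf m x))"
      unfolding G0_Dl by (intro lc_over_Dl lc_over_Pm Suc.prems)
    show "lc_over {0..d} ?y"
      by (simp add: lc_over_lscale lc_over_Pm over)
    fix t \<omega> assume ch: "char_on d (\<lambda>w. S w t \<omega>)"
    show "evl (\<lambda>w. S w t \<omega>) (G0 (Pm d L cf m x)) = evl (\<lambda>w. S w t \<omega>) ?y"
      unfolding evl_G0_Pm[OF ch Suc.prems] evl_append evl_lscale evl_Pm[OF ch over(1)] evl_Pm[OF ch over(2)] evl_Pm[OF ch over(3)]
      by simp
  qed
  also have "\<dots> = ecoef n (Pm d L cf m (G0 x)) + real m * ecoef n (Pm d L cf (m - 1) (G1 d L cf x))
     + real m * real (m - 1) * ecoef n (Pm d L cf (m - 2) (G2 d L cf x))"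
    by (simp add: ecoef_append ecoef_lscale)
  also have "\<dots> = (\<Sum>ks\<in>Kseq n. (if sum_list ks = m then fact m else 0) * emptycoef (Gseq d L cf ks (G0 x)))
    + (\<Sum>ks\<in>Kseq n. real m * (if sum_list ks = m - 1 then fact (m - 1) else 0) * emptycoef (Gseq d L cf ks (G1 d L cf x)))
    + (\<Sum>ks\<in>Kseq n. real m * real (m - 1) * (if sum_list ks = m - 2 then fact (m - 2) else 0) * emptycoef (Gseq d L cf ks (G2 d L cf x)))"
    unfolding Suc.IH[OF over(1)] Suc.IH[OF over(2)] Suc.IH[OF over(3)] sum_distrib_left by (simp only: mult.assoc)
  also have "\<dots> = (\<Sum>ks\<in>Kseq (Suc n). (if sum_list ks = m then fact m else 0) * emptycoef (Gseq d L cf ks x))"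
  proof -
    \<comment> \<open>The falling factors complete the smaller factorials to \<open>fact m\<close>.
      When \<open>m\<close> is too small they are 0, which makes the truncated differences
      harmless.\<close>
    have 1: "real m * (if q = m - 1 then fact (m - 1) else 0) = (if 1 + q = m then fact m else 0)" for q
      by (cases m) auto
    have 2: "real m * real (m - 1) * (if q = m - 2 then fact (m - 2) else 0) = (if 2 + q = m then fact m else 0)" for q
    proof (cases m)
      case (Suc k) then show ?thesis by (cases k) (auto simp: algebra_simps)
    qed simp
    show ?thesis unfolding sum_Kseq_Suc 1 2 by (simp add: Gseq_def Gk_def)
  qed
  finally show ?case .
qed

definition Yv :: "nat \<Rightarrow> (nat list \<Rightarrow> real) \<Rightarrow> real \<Rightarrow> 'a \<Rightarrow> real" where
  "Yv L cf t \<omega> = evl (\<lambda>w. S w t \<omega>) (C0 d L cf)"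

lemma fin_mom_Yv: "0 < t \<Longrightarrow> fin_mom (Yv L cf t)"
  unfolding Yv_def[abs_def] by (intro fin_mom_evl fin_mom_S lc_over_C0)

text \<open>The inner sum of \<open>expansion\<close> grouped by the order \<open>m\<close> of the
  derivative of \<open>f\<close>.\<close>

definition acoef :: "nat \<Rightarrow> (nat list \<Rightarrow> real) \<Rightarrow> nat \<Rightarrow> nat \<Rightarrow> real" where
  "acoef L cf n m = (\<Sum>ks\<in>Kseq n. if sum_list ks = m then emptycoef (Gseq d L cf ks [(1, [])]) else 0)"

text \<open>Each operator raises the order by at most 2. This is why \<open>2 * N\<close>
  derivatives suffice and why even moments of \<open>Y\<close> vanish at 0 to half their
  order.\<close>

lemma acoef_eq_0: "2 * n < m \<Longrightarrow> acoef L cf n m = 0"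
  unfolding acoef_def by (intro sum.neutral) (use sum_list_Kseq in fastforce)

text \<open>Stated for all large \<open>B\<close>, so that several moments can share one range of
  summation.\<close>

lemma moment_Yv:
  "\<exists>B0. \<forall>B\<ge>B0. \<forall>t>0. expectation (\<lambda>\<omega>. Yv L cf t \<omega> ^ m) = (\<Sum>n\<le>B. t ^ n / fact n * (fact m * acoef L cf n m))"
proof -
  let ?x = "Pm d L cf m [(1, [])]"
  have o: "lc_over {0..d} [(1, [])]" by simp
  obtain B0 where B0: "\<forall>(r,w)\<in>set ?x. length w \<le> B0" using ex_length_bound by blast
  have e: "ecoef n ?x = fact m * acoef L cf n m" for n
    unfolding ecoef_Pm[OF o] acoef_def sum_distrib_left by (intro sum.cong) auto
  have "expectation (\<lambda>\<omega>. Yv L cf t \<omega> ^ m) = (\<Sum>n\<le>B. t ^ n / fact n * (fact m * acoef L cf n m))"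
    if "B \<ge> B0" "0 < t" for B t
  proof -
    have B: "\<forall>(r,w)\<in>set ?x. length w \<le> B" using B0 that by fastforce
    have "AE \<omega> in M. Yv L cf t \<omega> ^ m = evl (\<lambda>w. S w t \<omega>) ?x"
      using char_on_S[OF that(2)]
      by eventually_elim (simp add: Yv_def evl_Pm S_Nil)
    then have "expectation (\<lambda>\<omega>. Yv L cf t \<omega> ^ m) = expectation (\<lambda>\<omega>. evl (\<lambda>w. S w t \<omega>) ?x)"
      using fin_mom_measurable[OF fin_mom_power[OF fin_mom_Yv[OF that(2)]]]
      by (intro integral_cong_AE evl_S_sq_integrable(1) that lc_over_Pm o)
    also have "\<dots> = (\<Sum>n\<le>B. t ^ n / fact n * ecoef n ?x)"
      unfolding expectation_evl[OF that(2) lc_over_Pm[OF o]] evl_time_words[OF B] ..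
    finally show ?thesis unfolding e .
  qed
  then show ?thesis by blast
qed

text \<open>Coefficients below \<open>t^m\<close> vanish by \<open>acoef_eq_0\<close>, and for
  \<open>t \<le> 1\<close> the higher powers are dominated by \<open>t^m\<close>.\<close>

lemma even_moment_bound:
  "\<exists>C\<ge>0. \<forall>t. 0 < t \<longrightarrow> t \<le> 1 \<longrightarrow> expectation (\<lambda>\<omega>. Yv L cf t \<omega> ^ (2 * m)) \<le> C * t ^ m"
proof -
  obtain B where B: "\<And>t. t > 0 \<Longrightarrow> expectation (\<lambda>\<omega>. Yv L cf t \<omega> ^ (2*m)) = (\<Sum>n\<le>B. t ^ n / fact n * (fact (2*m) * acoef L cf n (2*m)))"
    using moment_Yv by (metis order_refl)
  let ?c = "\<lambda>n. \<bar>fact (2*m) * acoef L cf n (2*m)\<bar> / fact n"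
  have "expectation (\<lambda>\<omega>. Yv L cf t \<omega> ^ (2 * m)) \<le> (\<Sum>n\<le>B. ?c n) * t ^ m" if t: "0 < t" "t \<le> 1" for t
  proof -
    have "t ^ n / fact n * (fact (2*m) * acoef L cf n (2*m)) \<le> ?c n * t ^ m" for n
    proof (cases "n < m")
      case True
      then show ?thesis using t by (simp add: acoef_eq_0)
    next
      case False
      then have "t ^ n \<le> t ^ m" using t by (intro power_decreasing) auto
      have "t ^ n / fact n * (fact (2*m) * acoef L cf n (2*m)) \<le> t ^ n / fact n * \<bar>fact (2*m) * acoef L cf n (2*m)\<bar>"
        using t by (intro mult_left_mono) auto
      also have "\<dots> \<le> t ^ m / fact n * \<bar>fact (2*m) * acoef L cf n (2*m)\<bar>"
        using \<open>t ^ n \<le> t ^ m\<close> by (intro mult_right_mono divide_right_mono) auto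
      finally show ?thesis by (simp add: mult_ac)
    qed
    then show ?thesis unfolding B[OF t(1)] sum_distrib_right by (intro sum_mono)
  qed
  moreover have "0 \<le> (\<Sum>n\<le>B. ?c n)" by (intro sum_nonneg) auto
  ultimately show ?thesis by blast
qed

end

section \<open>Taylor remainder under polynomial growth\<close>

lemma Ckp_continuous: "Ckp k f \<Longrightarrow> j \<le> k \<Longrightarrow> continuous_on UNIV ((deriv ^^ j) f)"
proof (cases "j = k")
  case False
  assume "Ckp k f" "j \<le> k"
  with False have "((deriv ^^ j) f has_real_derivative (deriv ^^ Suc j) f x) (at x)" for x
    unfolding Ckp_def by simp
  then have "isCont ((deriv ^^ j) f) x" for x by (rule DERIV_isCont)
  then show ?thesis by (simp add: continuous_on_eq_continuous_at)
qed (auto simp: Ckp_def)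

lemma (in prob_space) integrable_poly_growth:
  fixes f :: "real \<Rightarrow> real"
  assumes "fin_mom X" "continuous_on UNIV f" "\<And>x. \<bar>f x\<bar> \<le> C * (1 + \<bar>x\<bar> ^ p)"
  shows "integrable M (\<lambda>\<omega>. f (X \<omega>))"
proof (rule Bochner_Integration.integrable_bound)
  have [measurable]: "f \<in> borel_measurable borel" "X \<in> borel_measurable M"
    using borel_measurable_continuous_onI assms by (auto simp: fin_mom_def)
  show "(\<lambda>\<omega>. f (X \<omega>)) \<in> borel_measurable M" by measurable
  show "integrable M (\<lambda>\<omega>. C * (1 + \<bar>X \<omega>\<bar> ^ p))" using assms(1) by (auto simp: fin_mom_def)
  show "AE \<omega> in M. norm (f (X \<omega>)) \<le> norm (C * (1 + \<bar>X \<omega>\<bar> ^ p))"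
    using order_trans[OF assms(3) abs_ge_self] by simp
qed

text \<open>Lagrange's form with the term of order \<open>k\<close> completed at \<open>x\<close>.
  What remains is a difference of \<open>k\<close>-th derivatives, small by continuity without a
  further derivative.\<close>

lemma Ckp_Taylor:
  assumes "Ckp k f"
  shows "\<exists>\<xi>. \<bar>\<xi> - x\<bar> \<le> \<bar>y\<bar> \<and> f (x + y) = (\<Sum>m\<le>k. (deriv ^^ m) f x / fact m * y ^ m)
     + ((deriv ^^ k) f \<xi> - (deriv ^^ k) f x) / fact k * y ^ k"
\<comment> \<open>In these degenerate cases the point \<open>x + y\<close> itself serves.\<close>
proof (cases "k = 0 \<or> y = 0")
  case True
  have "(\<Sum>m\<le>k. (deriv ^^ m) f x / fact m * 0 ^ m) = f x"
    using sum.remove[of "{..k}" 0 "\<lambda>m. (deriv ^^ m) f x / fact m * 0 ^ m"] by (simp add: power_0_left)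
  then show ?thesis using True by (intro exI[of _ "x + y"]) auto
next
  case False
  have "\<exists>t. (if x + y < x then x + y < t \<and> t < x else x < t \<and> t < x + y) \<and>
    f (x + y) = (\<Sum>m<k. (deriv ^^ m) f x / fact m * (x + y - x) ^ m) + (deriv ^^ k) f t / fact k * (x + y - x) ^ k"
    by (rule Taylor[where a="x - \<bar>y\<bar>" and b="x + \<bar>y\<bar>"])
      (use False assms in \<open>auto simp: Ckp_def abs_if split: if_splits\<close>)
  then obtain \<xi> where \<xi>: "if x + y < x then x + y < \<xi> \<and> \<xi> < x else x < \<xi> \<and> \<xi> < x + y"
    "f (x + y) = (\<Sum>m<k. (deriv ^^ m) f x / fact m * y ^ m) + (deriv ^^ k) f \<xi> / fact k * y ^ k"
    by auto
  have "(\<Sum>m\<le>k. (deriv ^^ m) f x / fact m * y ^ m) = (\<Sum>m<k. (deriv ^^ m) f x / fact m * y ^ m) + (deriv ^^ k) f x / fact k * y ^ k"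
    by (simp add: lessThan_Suc_atMost[symmetric])
  then show ?thesis using \<xi> by (intro exI[of _ \<xi>]) (auto simp: field_simps split: if_splits)
qed

text \<open>Near \<open>x\<close> continuity gives \<open>\<epsilon>\<close>. Farther away the
  growth bound is multiplied by \<open>y^2 / \<delta>^2 \<ge> 1\<close>, which buys two powers of
  \<open>y\<close>, hence one power of \<open>t\<close> in expectation. All powers are even, as
  \<open>even_moment_bound\<close> needs.\<close>

lemma Ckp_remainder:
  assumes "Ckp (2 * N) f" "0 < \<epsilon>"
  shows "\<exists>K\<ge>0. \<exists>p. \<forall>y. \<bar>f (x + y) - (\<Sum>m\<le>2*N. (deriv ^^ m) f x / fact m * y ^ m)\<bar>
     \<le> \<epsilon> * y ^ (2 * N) + K * (y ^ (2 * (N + 1)) + y ^ (2 * (N + 1 + p)))"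
proof -
  let ?g = "(deriv ^^ (2 * N)) f"
  obtain C p where C: "C > 0" "\<And>z. \<bar>?g z\<bar> \<le> C * (1 + \<bar>z\<bar> ^ p)"
    using assms(1) unfolding Ckp_def by blast
  have "isCont ?g x" using Ckp_continuous[OF assms(1), of "2 * N"] by (simp add: continuous_on_eq_continuous_at)
  then obtain \<delta> where \<delta>: "\<delta> > 0" "\<And>z. \<bar>z - x\<bar> < \<delta> \<Longrightarrow> \<bar>?g z - ?g x\<bar> < \<epsilon>"
    using assms(2) by (force simp: continuous_at_eps_delta dist_real_def)
  \<comment> \<open>The 2 in \<open>K1\<close> stands for the two derivatives, at
    \<open>\<xi>\<close> and at \<open>x\<close>; the 2 in \<open>K\<close> pays for replacing
    \<open>\<bar>y\<bar> ^ p\<close> by an even power.\<close>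
  define K1 where "K1 = 2 * C * (1 + 2 ^ p * (1 + \<bar>x\<bar> ^ p))"
  define K where "K = 2 * K1 / \<delta>^2"
  have K1: "0 \<le> K1" using C by (simp add: K1_def)
  have K: "0 \<le> K" using K1 by (simp add: K_def)
  have bound: "\<bar>?g \<xi> - ?g x\<bar> \<le> \<epsilon> + K * (y^2 + y^(2 * (1 + p)))" if "\<bar>\<xi> - x\<bar> \<le> \<bar>y\<bar>" for \<xi> y
  proof (cases "\<bar>y\<bar> < \<delta>")
    case True
    then have "\<bar>?g \<xi> - ?g x\<bar> < \<epsilon>" using \<delta>(2)[of \<xi>] that by simp
    moreover have "0 \<le> K * (y^2 + y^(2 * (1 + p)))"
      using K by (intro mult_nonneg_nonneg add_nonneg_nonneg zero_le_even_power) auto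
    ultimately show ?thesis by linarith
  next
    case False
    have zp: "\<bar>z\<bar> ^ p \<le> 2 ^ p * (\<bar>x\<bar> ^ p + \<bar>y\<bar> ^ p)" if "\<bar>z - x\<bar> \<le> \<bar>y\<bar>" for z
    proof -
      have "\<bar>z\<bar> ^ p \<le> (2 * max \<bar>x\<bar> \<bar>y\<bar>) ^ p" using that by (intro power_mono) auto
      also have "\<dots> \<le> 2 ^ p * (\<bar>x\<bar> ^ p + \<bar>y\<bar> ^ p)" by (auto simp: power_mult_distrib max_def)
      finally show ?thesis .
    qed
    have "\<bar>?g z\<bar> \<le> C * (1 + 2 ^ p * (1 + \<bar>x\<bar> ^ p)) * (1 + \<bar>y\<bar> ^ p)" if "\<bar>z - x\<bar> \<le> \<bar>y\<bar>" for z
    proof -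
      have "\<bar>?g z\<bar> \<le> C * (1 + 2 ^ p * (\<bar>x\<bar> ^ p + \<bar>y\<bar> ^ p))"
        using C(2)[of z] mult_left_mono[OF add_left_mono[OF zp[OF that], of 1], of C] C(1) by linarith
      also have "\<dots> \<le> C * ((1 + 2 ^ p * (1 + \<bar>x\<bar> ^ p)) * (1 + \<bar>y\<bar> ^ p))"
        using C(1) by (intro mult_left_mono) (auto simp: algebra_simps)
      finally show ?thesis by (simp add: mult.assoc)
    qed
    from this[OF that] this[of x] have "\<bar>?g \<xi> - ?g x\<bar> \<le> K1 * (1 + \<bar>y\<bar> ^ p)"
      unfolding K1_def by (simp only: mult.assoc) linarith
    also have "\<dots> \<le> K1 * (2 * (1 + y^(2 * p)))"
    proof (intro mult_left_mono K1)
      have "2 * \<bar>y\<bar> ^ p \<le> 1 + (\<bar>y\<bar> ^ p)^2" using sum_squares_bound[of "\<bar>y\<bar> ^ p" 1] by simp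
      also have "(\<bar>y\<bar> ^ p)^2 = y ^ (2 * p)"
        unfolding power_mult[symmetric] mult.commute[of p] by (simp add: power_even_abs)
      finally have "2 * \<bar>y\<bar> ^ p \<le> 1 + y ^ (2 * p)" .
      moreover have "0 \<le> y ^ (2 * p)" by (rule zero_le_even_power) simp
      moreover have "1 + a \<le> 2 * (1 + b)" if "2 * a \<le> 1 + b" "0 \<le> b" for a b :: real
        using that by argo
      ultimately show "1 + \<bar>y\<bar> ^ p \<le> 2 * (1 + y^(2 * p))" by blast
    qed
    also have "\<dots> = K1 * 2 * (1 + y^(2 * p)) * 1" by simp
    also have "\<dots> \<le> K1 * 2 * (1 + y^(2 * p)) * (y^2 / \<delta>^2)"
    proof (rule mult_left_mono)
      have "\<delta>^2 \<le> \<bar>y\<bar>^2" using False \<delta>(1) by (intro power_mono) auto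
      then show "1 \<le> y^2 / \<delta>^2" using \<delta>(1) by simp
      show "0 \<le> K1 * 2 * (1 + y^(2 * p))" using K1 zero_le_even_power[of "2*p" y] by simp
    qed
    also have "\<dots> = K * (y^2 + y^(2 * (1 + p)))"
      by (simp add: K_def algebra_simps power_add power2_eq_square add_divide_distrib)
    finally show ?thesis using assms(2) by linarith
  qed
  show ?thesis
  proof (intro exI[of _ K] exI[of _ p] conjI K allI)
    fix y
    obtain \<xi> where \<xi>: "\<bar>\<xi> - x\<bar> \<le> \<bar>y\<bar>" "f (x + y) = (\<Sum>m\<le>2*N. (deriv ^^ m) f x / fact m * y ^ m)
     + (?g \<xi> - ?g x) / fact (2*N) * y ^ (2*N)"
      using Ckp_Taylor[OF assms(1)] by blast
    have ev: "0 \<le> y ^ (2*N)" by (simp add: power_mult)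
    have "\<bar>f (x + y) - (\<Sum>m\<le>2*N. (deriv ^^ m) f x / fact m * y ^ m)\<bar> = \<bar>?g \<xi> - ?g x\<bar> / fact (2*N) * y ^ (2*N)"
      unfolding \<xi>(2) using ev by (simp add: abs_mult)
    also have "\<dots> \<le> \<bar>?g \<xi> - ?g x\<bar> / 1 * y ^ (2*N)"
      using ev by (intro mult_right_mono divide_left_mono) (auto simp: fact_ge_1)
    also have "\<dots> \<le> (\<epsilon> + K * (y^2 + y^(2 * (1 + p)))) * y ^ (2*N)"
      using bound[OF \<xi>(1)] ev by (intro mult_right_mono) auto
    also have "\<dots> = \<epsilon> * y ^ (2 * N) + K * (y ^ (2 * (N + 1)) + y ^ (2 * (N + 1 + p)))"
      by (simp add: algebra_simps power_add power2_eq_square)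
    finally show "\<bar>f (x + y) - (\<Sum>m\<le>2*N. (deriv ^^ m) f x / fact m * y ^ m)\<bar>
     \<le> \<epsilon> * y ^ (2 * N) + K * (y ^ (2 * (N + 1)) + y ^ (2 * (N + 1 + p)))" .
  qed
qed

section \<open>The expansion for constant coefficients\<close>

context ito_signature begin

text \<open>The term \<open>n = 0\<close> yields \<open>f (cf [])\<close>, since the empty sequence
  is the only one of length 0.\<close>

lemma expansion_acoef:
  "expansion d L N f cf t =
    (\<Sum>n\<le>N. t ^ n / fact n * (\<Sum>m\<le>2*N. (deriv ^^ m) f (cf []) * acoef L cf n m))"
proof -
  let ?g = "\<lambda>ks. emptycoef (Gseq d L cf ks [(1, [])])"
  have b: "(\<Sum>m\<le>2*N. (deriv ^^ m) f (cf []) * acoef L cf n m) =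
     (\<Sum>ks\<in>Kseq n. (deriv ^^ sum_list ks) f (cf []) * ?g ks)" if "n \<le> N" for n
  proof -
    have "(\<Sum>m\<le>2*N. (deriv ^^ m) f (cf []) * acoef L cf n m) =
      (\<Sum>ks\<in>Kseq n. \<Sum>m\<le>2*N. (deriv ^^ m) f (cf []) * (if sum_list ks = m then ?g ks else 0))"
      unfolding acoef_def sum_distrib_left by (rule sum.swap)
    also have "\<dots> = (\<Sum>ks\<in>Kseq n. (deriv ^^ sum_list ks) f (cf []) * ?g ks)"
    proof (rule sum.cong[OF refl])
      fix ks assume "ks \<in> Kseq n"
      then have "sum_list ks \<le> 2 * N" using sum_list_Kseq that by fastforce
      then show "(\<Sum>m\<le>2*N. (deriv ^^ m) f (cf []) * (if sum_list ks = m then ?g ks else 0)) =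
        (deriv ^^ sum_list ks) f (cf []) * ?g ks"
        by (simp add: if_distrib sum.delta cong: if_cong)
    qed
    finally show ?thesis .
  qed
  have "(\<Sum>n\<le>N. t ^ n / fact n * (\<Sum>m\<le>2*N. (deriv ^^ m) f (cf []) * acoef L cf n m)) =
    (\<Sum>n\<le>N. t ^ n / fact n * (\<Sum>ks\<in>Kseq n. (deriv ^^ sum_list ks) f (cf []) * ?g ks))"
    using b by (intro sum.cong) auto
  also have "\<dots> = f (cf []) + (\<Sum>n=1..N. t ^ n / fact n * (\<Sum>ks\<in>Kseq n. (deriv ^^ sum_list ks) f (cf []) * ?g ks))"
    by (simp add: atMost_atLeast0 sum.atLeast_Suc_atMost Kseq_0 Gseq_def emptycoef_def)
  also have "\<dots> = expansion d L N f cf t"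
    unfolding expansion_def Kseq_def by (simp add: mult_ac)
  finally show ?thesis ..
qed

lemma Taylor_moments:
  "\<exists>B\<ge>N. \<forall>t>0. (\<Sum>m\<le>2*N. (deriv ^^ m) f (cf []) / fact m * expectation (\<lambda>\<omega>. Yv L cf t \<omega> ^ m)) =
    (\<Sum>n\<le>B. t ^ n / fact n * (\<Sum>m\<le>2*N. (deriv ^^ m) f (cf []) * acoef L cf n m))"
proof -
  have "\<exists>Bf. \<forall>m. \<forall>B\<ge>Bf m. \<forall>t>0. expectation (\<lambda>\<omega>. Yv L cf t \<omega> ^ m) = (\<Sum>n\<le>B. t ^ n / fact n * (fact m * acoef L cf n m))"
    using moment_Yv by (intro choice allI)
  then obtain Bf where Bf: "\<And>m B t. B \<ge> Bf m \<Longrightarrow> t > 0 \<Longrightarrow>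
    expectation (\<lambda>\<omega>. Yv L cf t \<omega> ^ m) = (\<Sum>n\<le>B. t ^ n / fact n * (fact m * acoef L cf n m))" by blast
  \<comment> \<open>One range for all moments up to order \<open>2 * N\<close>, long enough to
    contain the orders of \<open>expansion\<close>.\<close>
  define B where "B = max N (Max (Bf ` {..2*N}))"
  have "(\<Sum>m\<le>2*N. (deriv ^^ m) f (cf []) / fact m * expectation (\<lambda>\<omega>. Yv L cf t \<omega> ^ m)) =
    (\<Sum>n\<le>B. t ^ n / fact n * (\<Sum>m\<le>2*N. (deriv ^^ m) f (cf []) * acoef L cf n m))" if "t > 0" for t
  proof -
    have "(\<Sum>m\<le>2*N. (deriv ^^ m) f (cf []) / fact m * expectation (\<lambda>\<omega>. Yv L cf t \<omega> ^ m)) =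
      (\<Sum>m\<le>2*N. \<Sum>n\<le>B. t ^ n / fact n * ((deriv ^^ m) f (cf []) * acoef L cf n m))"
    proof (rule sum.cong[OF refl])
      fix m assume "m \<in> {..2*N}"
      then have "Bf m \<le> B" unfolding B_def by (intro max.coboundedI2 Max_ge) auto
      then show "(deriv ^^ m) f (cf []) / fact m * expectation (\<lambda>\<omega>. Yv L cf t \<omega> ^ m) =
        (\<Sum>n\<le>B. t ^ n / fact n * ((deriv ^^ m) f (cf []) * acoef L cf n m))"
        unfolding Bf[OF \<open>Bf m \<le> B\<close> that] sum_distrib_left by (intro sum.cong) auto
    qed
    also have "\<dots> = (\<Sum>n\<le>B. \<Sum>m\<le>2*N. t ^ n / fact n * ((deriv ^^ m) f (cf []) * acoef L cf n m))"
      by (rule sum.swap)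
    finally show ?thesis by (simp add: sum_distrib_left)
  qed
  moreover have "B \<ge> N" by (simp add: B_def)
  ultimately show ?thesis by blast
qed

text \<open>The term with \<open>\<epsilon>\<close> is kept apart from the one of order
  \<open>N + 1\<close>, because \<open>K\<close> depends on \<open>\<epsilon>\<close>: first
  \<open>\<epsilon>\<close> is chosen, then \<open>t\<close> becomes small.\<close>

lemma Taylor_expectation_bound:
  assumes f: "Ckp (2 * N) f" and \<epsilon>: "0 < \<epsilon>"
  shows "\<exists>K\<ge>0. \<forall>t. 0 < t \<longrightarrow> t \<le> 1 \<longrightarrow>
    \<bar>expectation (\<lambda>\<omega>. f (x + Yv L cf t \<omega>)) - (\<Sum>m\<le>2*N. (deriv ^^ m) f x / fact m * expectation (\<lambda>\<omega>. Yv L cf t \<omega> ^ m))\<bar>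
    \<le> \<epsilon> * expectation (\<lambda>\<omega>. Yv L cf t \<omega> ^ (2*N)) + K * t ^ Suc N"
proof -
  obtain K p where K: "K \<ge> 0" "\<And>y. \<bar>f (x + y) - (\<Sum>m\<le>2*N. (deriv ^^ m) f x / fact m * y ^ m)\<bar>
     \<le> \<epsilon> * y ^ (2 * N) + K * (y ^ (2 * (N + 1)) + y ^ (2 * (N + 1 + p)))"
    using Ckp_remainder[OF f \<epsilon>] by blast
  obtain C1 where C1: "C1 \<ge> 0" "\<And>t. 0 < t \<Longrightarrow> t \<le> 1 \<Longrightarrow> expectation (\<lambda>\<omega>. Yv L cf t \<omega> ^ (2 * (N + 1))) \<le> C1 * t ^ (N + 1)"
    using even_moment_bound by blast
  obtain C2 where C2: "C2 \<ge> 0" "\<And>t. 0 < t \<Longrightarrow> t \<le> 1 \<Longrightarrow> expectation (\<lambda>\<omega>. Yv L cf t \<omega> ^ (2 * (N + 1 + p))) \<le> C2 * t ^ (N + 1 + p)"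
    using even_moment_bound by blast
  obtain C q where q: "\<And>z. \<bar>f z\<bar> \<le> C * (1 + \<bar>z\<bar> ^ q)"
    using f unfolding Ckp_def by (metis le0 funpow_0)
  show ?thesis
  proof (intro exI[of _ "K * (C1 + C2)"] conjI allI impI)
    show "0 \<le> K * (C1 + C2)" using K C1 C2 by simp
    fix t :: real assume t: "0 < t" "t \<le> 1"
    note fY = fin_mom_Yv[OF t(1), of L cf]
    have int: "integrable M (\<lambda>\<omega>. Yv L cf t \<omega> ^ m)" for m by (intro fin_mom_integrable fin_mom_power fY)
    have intf: "integrable M (\<lambda>\<omega>. f (x + Yv L cf t \<omega>))"
      using integrable_poly_growth[OF fin_mom_add[OF fin_mom_const[of x] fY], of f C q] Ckp_continuous[OF f, of 0] q by simp
    let ?P = "\<lambda>\<omega>. \<Sum>m\<le>2*N. (deriv ^^ m) f x / fact m * Yv L cf t \<omega> ^ m"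
    have intP: "integrable M ?P" using int by (intro Bochner_Integration.integrable_sum integrable_mult_right)
    have "expectation ?P = (\<Sum>m\<le>2*N. (deriv ^^ m) f x / fact m * expectation (\<lambda>\<omega>. Yv L cf t \<omega> ^ m))"
      using int by simp
    then have "\<bar>expectation (\<lambda>\<omega>. f (x + Yv L cf t \<omega>)) - (\<Sum>m\<le>2*N. (deriv ^^ m) f x / fact m * expectation (\<lambda>\<omega>. Yv L cf t \<omega> ^ m))\<bar>
      = \<bar>expectation (\<lambda>\<omega>. f (x + Yv L cf t \<omega>) - ?P \<omega>)\<bar>"
      using intf intP by simp
    also have "\<dots> \<le> expectation (\<lambda>\<omega>. \<bar>f (x + Yv L cf t \<omega>) - ?P \<omega>\<bar>)" by (rule integral_abs_bound)
    also have "\<dots> \<le> expectation (\<lambda>\<omega>. \<epsilon> * Yv L cf t \<omega> ^ (2 * N) + K * (Yv L cf t \<omega> ^ (2 * (N + 1)) + Yv L cf t \<omega> ^ (2 * (N + 1 + p))))"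
      by (intro integral_mono integrable_abs Bochner_Integration.integrable_diff
          Bochner_Integration.integrable_add integrable_mult_right intf intP int K(2))
    also have "\<dots> = \<epsilon> * expectation (\<lambda>\<omega>. Yv L cf t \<omega> ^ (2 * N)) +
       K * (expectation (\<lambda>\<omega>. Yv L cf t \<omega> ^ (2 * (N + 1))) + expectation (\<lambda>\<omega>. Yv L cf t \<omega> ^ (2 * (N + 1 + p))))"
      by (simp only: int Bochner_Integration.integral_add Bochner_Integration.integrable_add
          integrable_mult_right integral_mult_right_zero)
    also have "\<dots> \<le> \<epsilon> * expectation (\<lambda>\<omega>. Yv L cf t \<omega> ^ (2*N)) + K * (C1 * t ^ Suc N + C2 * t ^ Suc N)"
    proof (intro add_left_mono mult_left_mono add_mono K)
      show "expectation (\<lambda>\<omega>. Yv L cf t \<omega> ^ (2 * (N + 1))) \<le> C1 * t ^ Suc N" using C1(2)[OF t] by simp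
      have "t ^ (N + 1 + p) \<le> t ^ Suc N" using t by (intro power_decreasing) auto
      then show "expectation (\<lambda>\<omega>. Yv L cf t \<omega> ^ (2 * (N + 1 + p))) \<le> C2 * t ^ Suc N"
        using C2(2)[OF t] mult_left_mono[OF _ C2(1)] by (meson order_trans)
    qed
    finally show "\<bar>expectation (\<lambda>\<omega>. f (x + Yv L cf t \<omega>)) - (\<Sum>m\<le>2*N. (deriv ^^ m) f x / fact m * expectation (\<lambda>\<omega>. Yv L cf t \<omega> ^ m))\<bar>
      \<le> \<epsilon> * expectation (\<lambda>\<omega>. Yv L cf t \<omega> ^ (2*N)) + K * (C1 + C2) * t ^ Suc N"
      by (simp add: algebra_simps)
  qed
qed

lemma deterministic_expansion:
  assumes f: "Ckp (2 * N) f"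
  shows "((\<lambda>t. (expectation (\<lambda>\<omega>. f (\<Sum>I\<leftarrow>words d L. cf I * S I t \<omega>)) - expansion d L N f cf t) / t ^ N)
           \<longlongrightarrow> 0) (at_right 0)"
proof (rule tendstoI)
  fix \<eta> :: real assume \<eta>: "0 < \<eta>"
  let ?x = "cf []"
  obtain B where B: "B \<ge> N" "\<And>t. t > 0 \<Longrightarrow>
    (\<Sum>m\<le>2*N. (deriv ^^ m) f ?x / fact m * expectation (\<lambda>\<omega>. Yv L cf t \<omega> ^ m)) =
    (\<Sum>n\<le>B. t ^ n / fact n * (\<Sum>m\<le>2*N. (deriv ^^ m) f ?x * acoef L cf n m))"
    using Taylor_moments by blast
  define b where "b n = (\<Sum>m\<le>2*N. (deriv ^^ m) f ?x * acoef L cf n m)" for n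
  obtain C where C: "C \<ge> 0" "\<And>t. 0 < t \<Longrightarrow> t \<le> 1 \<Longrightarrow> expectation (\<lambda>\<omega>. Yv L cf t \<omega> ^ (2 * N)) \<le> C * t ^ N"
    using even_moment_bound by blast
  \<comment> \<open>Half of \<open>\<eta>\<close> is spent on the Taylor remainder; the 1 guards
    against \<open>C = 0\<close>.\<close>
  define \<epsilon> where "\<epsilon> = \<eta> / (2 * (C + 1))"
  have \<epsilon>: "0 < \<epsilon>" using \<eta> C by (simp add: \<epsilon>_def)
  obtain K where K: "K \<ge> 0" "\<And>t. 0 < t \<Longrightarrow> t \<le> 1 \<Longrightarrow>
    \<bar>expectation (\<lambda>\<omega>. f (?x + Yv L cf t \<omega>)) - (\<Sum>m\<le>2*N. (deriv ^^ m) f ?x / fact m * expectation (\<lambda>\<omega>. Yv L cf t \<omega> ^ m))\<bar>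
    \<le> \<epsilon> * expectation (\<lambda>\<omega>. Yv L cf t \<omega> ^ (2*N)) + K * t ^ Suc N"
    using Taylor_expectation_bound[OF f \<epsilon>] by blast
  \<comment> \<open>The polynomial built from the moments may run beyond order \<open>N\<close>;
    \<open>R\<close> collects the surplus coefficients.\<close>
  define R where "R = (\<Sum>n\<in>{N<..B}. \<bar>b n\<bar> / fact n)"
  have R: "0 \<le> R" unfolding R_def by (intro sum_nonneg) auto
  \<comment> \<open>The other half of \<open>\<eta>\<close> pays for the terms of order
    \<open>N + 1\<close>; the minimum with 1 admits the bounds valid for
    \<open>t \<le> 1\<close>.\<close>
  define \<delta> where "\<delta> = min 1 (\<eta> / (2 * (K + R + 1)))"
  have \<delta>: "0 < \<delta>" using \<eta> K R by (simp add: \<delta>_def)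
  show "\<forall>\<^sub>F t in at_right 0. dist ((expectation (\<lambda>\<omega>. f (\<Sum>I\<leftarrow>words d L. cf I * S I t \<omega>)) - expansion d L N f cf t) / t ^ N) 0 < \<eta>"
    unfolding eventually_at_right_field
  proof (intro exI[of _ \<delta>] conjI \<delta> allI impI)
    fix t :: real assume t0: "0 < t" "t < \<delta>"
    then have t: "0 < t" "t \<le> 1" by (auto simp: \<delta>_def)
    define P where "P = (\<Sum>m\<le>2*N. (deriv ^^ m) f ?x / fact m * expectation (\<lambda>\<omega>. Yv L cf t \<omega> ^ m))"
    have "P - expansion d L N f cf t = (\<Sum>n\<in>{N<..B}. t ^ n / fact n * b n)"
    proof -
      have "{..B} = {..N} \<union> {N<..B}" using B(1) by auto
      then have "(\<Sum>n\<le>B. t ^ n / fact n * b n) = (\<Sum>n\<le>N. t ^ n / fact n * b n) + (\<Sum>n\<in>{N<..B}. t ^ n / fact n * b n)"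
        by (simp only:) (rule sum.union_disjoint, auto)
      then show ?thesis
        unfolding P_def B(2)[OF t(1)] expansion_acoef b_def by simp
    qed
    then have "\<bar>P - expansion d L N f cf t\<bar> \<le> (\<Sum>n\<in>{N<..B}. \<bar>t ^ n / fact n * b n\<bar>)" by (simp only: sum_abs)
    also have "\<dots> \<le> (\<Sum>n\<in>{N<..B}. \<bar>b n\<bar> / fact n * t ^ Suc N)"
    proof (rule sum_mono)
      fix n assume "n \<in> {N<..B}"
      then have "t ^ n \<le> t ^ Suc N" using t by (intro power_decreasing) auto
      have "\<bar>t ^ n / fact n * b n\<bar> = \<bar>b n\<bar> / fact n * t ^ n" using t by (simp add: abs_mult mult_ac)
      also have "\<dots> \<le> \<bar>b n\<bar> / fact n * t ^ Suc N" using \<open>t ^ n \<le> t ^ Suc N\<close> by (intro mult_left_mono) auto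
      finally show "\<bar>t ^ n / fact n * b n\<bar> \<le> \<bar>b n\<bar> / fact n * t ^ Suc N" .
    qed
    finally have 1: "\<bar>P - expansion d L N f cf t\<bar> \<le> R * t ^ Suc N" unfolding R_def sum_distrib_right .
    have "\<epsilon> * expectation (\<lambda>\<omega>. Yv L cf t \<omega> ^ (2*N)) \<le> \<epsilon> * (C * t ^ N)"
      using C(2)[OF t] \<epsilon> by (intro mult_left_mono) auto
    with K(2)[OF t] have 2: "\<bar>expectation (\<lambda>\<omega>. f (?x + Yv L cf t \<omega>)) - P\<bar> \<le> \<epsilon> * (C * t ^ N) + K * t ^ Suc N"
      unfolding P_def by linarith
    have eq: "(\<Sum>I\<leftarrow>words d L. cf I * S I t \<omega>) = ?x + Yv L cf t \<omega>" for \<omega>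
      unfolding sum_list_words Yv_def S_Nil by simp
    have "\<bar>expectation (\<lambda>\<omega>. f (\<Sum>I\<leftarrow>words d L. cf I * S I t \<omega>)) - expansion d L N f cf t\<bar>
      \<le> \<epsilon> * (C * t ^ N) + K * t ^ Suc N + R * t ^ Suc N"
      using 1 2 unfolding eq by linarith
    also have "\<dots> = (\<epsilon> * C + (K + R) * t) * t ^ N" by (simp add: algebra_simps)
    finally have "\<bar>expectation (\<lambda>\<omega>. f (\<Sum>I\<leftarrow>words d L. cf I * S I t \<omega>)) - expansion d L N f cf t\<bar> / t ^ N
      \<le> \<epsilon> * C + (K + R) * t"
      using t by (simp add: pos_divide_le_eq)
    also have "\<dots> < \<eta>"
    proof -
      have "\<epsilon> * C \<le> \<eta> / 2" using C(1) \<eta> by (simp add: \<epsilon>_def field_simps)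
      moreover have "(K + R) * t < \<eta> / 2"
      proof -
        have "(K + R) * t \<le> (K + R + 1) * t" using t by (intro mult_right_mono) auto
        also have "\<dots> < (K + R + 1) * (\<eta> / (2 * (K + R + 1)))"
          using t0 K R by (intro mult_strict_left_mono) (auto simp: \<delta>_def)
        also have "\<dots> = \<eta> / 2" using K R by (simp add: field_simps)
        finally show ?thesis .
      qed
      ultimately show ?thesis by linarith
    qed
    finally show "dist ((expectation (\<lambda>\<omega>. f (\<Sum>I\<leftarrow>words d L. cf I * S I t \<omega>)) - expansion d L N f cf t) / t ^ N) 0 < \<eta>"
      using t by (simp add: dist_real_def)
  qed
qed

end

subsection \<open>Conditional expectation\<close>

context brownian_motion begin

text \<open>Cylinder events of the increments on a grid: with Borel sides they form an
  intersection-stable generator of the sigma-algebra of these increments.\<close>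

definition rect :: "real \<Rightarrow> nat \<Rightarrow> (nat \<Rightarrow> nat \<Rightarrow> real set) \<Rightarrow> 'a set" where
  "rect h k B = {\<omega>\<in>space M. \<forall>j<k. \<forall>i\<in>{1..d}. Del h i j \<omega> \<in> B j i}"

text \<open>Measurability is carried through the same induction as the product formula, since
  splitting off the next cell requires the event so far to lie in \<open>F\<close> at the left end
  of that cell.\<close>

lemma rect_prob:
  assumes "0 < h" "A \<in> sets (F 0)" "\<And>j i. B j i \<in> sets borel"
  shows "A \<inter> rect h k B \<in> sets (F (h * real k)) \<and>
    prob (A \<inter> rect h k B) = prob A *
      (\<Prod>j<k. \<Prod>i=1..d. measure (density lborel (normal_density 0 (sqrt h))) (B j i))"
proof (induction k)
  case 0
  have "A \<inter> rect h 0 B = A" using sets.sets_into_space[OF assms(2)] by (auto simp: rect_def space_F)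
  then show ?case using assms by simp
next
  case (Suc k)
  let ?s = "h * real k" and ?t = "h * real (Suc k)"
  let ?D = "{\<omega>\<in>space M. \<forall>i\<in>{1..d}. inc ?s ?t i \<omega> \<in> B k i}"
  have st: "0 \<le> ?s" "?s < ?t" "?t - ?s = h" using assms(1) by (auto simp: algebra_simps)
  have eq: "A \<inter> rect h (Suc k) B = (A \<inter> rect h k B) \<inter> ?D"
    by (auto simp: rect_def Del_inc less_Suc_eq)
  have D: "?D \<in> sets (F ?t)"
  proof -
    have "inc ?s ?t i -` B k i \<inter> space (F ?t) \<in> sets (F ?t)" if "i \<in> {1..d}" for i
      by (rule measurable_sets[OF inc_measurable]) (use st assms(3) that in auto)
    then have "{\<omega>\<in>space (F ?t). inc ?s ?t i \<omega> \<in> B k i} \<in> sets (F ?t)" if "i \<in> {1..d}" for i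
      using that by (simp add: vimage_def Int_def conj_commute)
    then have "{\<omega>\<in>space (F ?t). \<forall>i\<in>{1..d}. inc ?s ?t i \<omega> \<in> B k i} \<in> sets (F ?t)"
      by (rule sets.sets_Collect_finite_All) auto
    then show ?thesis by (simp only: space_F)
  qed
  have "sets (F ?s) \<subseteq> sets (F ?t)" using filt st(2) unfolding is_filtration_def by (meson less_imp_le)
  then have "A \<inter> rect h (Suc k) B \<in> sets (F ?t)" unfolding eq using Suc D by blast
  moreover have "prob (A \<inter> rect h (Suc k) B) = prob (A \<inter> rect h k B) *
     (\<Prod>i=1..d. measure (density lborel (normal_density 0 (sqrt h))) (B k i))"
    unfolding eq using inc_joint[OF st(1,2) conjunct1[OF Suc], of "B k"] assms(3) st(3) by simp
  ultimately show ?case using Suc by simp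
qed

definition rects :: "real \<Rightarrow> nat \<Rightarrow> 'a set set" where
  "rects t n = {rect (t / 4^n) (4^n) B |B. \<forall>j i. B j i \<in> sets borel}"

lemma rects_events: "0 < t \<Longrightarrow> rects t n \<subseteq> events"
proof
  fix X assume t: "0 < t" and "X \<in> rects t n"
  then obtain B where X: "X = rect (t / 4^n) (4^n) B" "\<And>j i. B j i \<in> sets borel" by (auto simp: rects_def)
  have "space M \<in> sets (F 0)" using sets.top[of "F 0"] space_F by simp
  then have "space M \<inter> X \<in> sets (F (t / 4^n * real (4^n)))"
    using rect_prob[of "t / 4^n" "space M" B "4^n"] t X by auto
  then have "space M \<inter> X \<in> events" by (rule sets_F)
  moreover have "space M \<inter> X = X" unfolding X(1) rect_def by blast
  ultimately show "X \<in> events" by simp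
qed

lemma Int_stable_rects: "Int_stable (rects t n)"
proof (rule Int_stableI)
  fix X Y assume "X \<in> rects t n" "Y \<in> rects t n"
  then obtain B C where "X = rect (t / 4^n) (4^n) B" "\<And>j i. B j i \<in> sets borel"
    "Y = rect (t / 4^n) (4^n) C" "\<And>j i. C j i \<in> sets borel" by (auto simp: rects_def)
  then show "X \<inter> Y \<in> rects t n"
    unfolding rects_def by (intro CollectI exI[of _ "\<lambda>j i. B j i \<inter> C j i"]) (auto simp: rect_def)
qed

definition Hn :: "real \<Rightarrow> nat \<Rightarrow> 'a measure" where
  "Hn t n = sigma (space M) (rects t n)"

lemma rects_Pow: "rects t n \<subseteq> Pow (space M)"
  by (auto simp: rects_def rect_def)

lemma space_Hn: "space (Hn t n) = space M"
  using rects_Pow by (simp add: Hn_def space_measure_of_conv)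

lemma sets_Hn: "sets (Hn t n) = sigma_sets (space M) (rects t n)"
  using rects_Pow by (simp add: Hn_def)

lemma Del_measurable_Hn:
  assumes "j < 4^n" "a \<le> d"
  shows "Del (t / 4^n) a j \<in> borel_measurable (Hn t n)"
proof (cases "a = 0")
  case True
  then have "Del (t / 4^n) a j = (\<lambda>\<omega>. t / 4^n)" by (simp add: fun_eq_iff Del_0)
  then show ?thesis by simp
next
  case False
  show ?thesis
  proof (rule measurableI)
    fix X :: "real set" assume X: "X \<in> sets borel"
    let ?B = "\<lambda>j' i'. if j' = j \<and> i' = a then X else UNIV"
    have "Del (t / 4^n) a j -` X \<inter> space (Hn t n) = rect (t / 4^n) (4^n) ?B"
      using assms False by (auto simp: rect_def space_Hn)
    then have "Del (t / 4^n) a j -` X \<inter> space (Hn t n) \<in> rects t n"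
      unfolding rects_def using X by (intro CollectI exI[of _ ?B]) auto
    then show "Del (t / 4^n) a j -` X \<inter> space (Hn t n) \<in> sets (Hn t n)"
      unfolding sets_Hn by (rule sigma_sets.Basic)
  qed simp
qed

text \<open>A coarse increment is the sum of four fine ones.\<close>

lemma Hn_Suc: "sets (Hn t n) \<subseteq> sets (Hn t (Suc n))"
proof -
  have "rects t n \<subseteq> sets (Hn t (Suc n))"
  proof
    fix X assume "X \<in> rects t n"
    then obtain B where X: "X = rect (t / 4^n) (4^n) B" "\<And>j i. B j i \<in> sets borel" by (auto simp: rects_def)
    have m: "Del (t / 4^n) i j \<in> borel_measurable (Hn t (Suc n))" if "j < 4^n" "i \<in> {1..d}" for i j
    proof -
      have "Del (t / 4^n) i j = (\<lambda>\<omega>. \<Sum>l<4. Del (t / 4^Suc n) i (j * 4 + l) \<omega>)"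
        using Del_refine[of 4 "t / 4^n" i j] by (simp add: fun_eq_iff mult.commute)
      moreover have "(\<lambda>\<omega>. \<Sum>l<4. Del (t / 4^Suc n) i (j * 4 + l) \<omega>) \<in> borel_measurable (Hn t (Suc n))"
        using that by (intro borel_measurable_sum Del_measurable_Hn) auto
      ultimately show ?thesis by simp
    qed
    have "X = {\<omega>\<in>space (Hn t (Suc n)). \<forall>j\<in>{..<4^n}. \<forall>i\<in>{1..d}. Del (t / 4^n) i j \<omega> \<in> B j i}"
      by (auto simp: X rect_def space_Hn)
    also have "\<dots> \<in> sets (Hn t (Suc n))"
    proof (intro sets.sets_Collect_finite_All finite_lessThan finite_atLeastAtMost)
      fix j i assume "j \<in> {..<(4::nat)^n}" "i \<in> {1..d}"
      then have "Del (t / 4^n) i j -` B j i \<inter> space (Hn t (Suc n)) \<in> sets (Hn t (Suc n))"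
        by (intro measurable_sets[OF m X(2)]) auto
      then show "{\<omega>\<in>space (Hn t (Suc n)). Del (t / 4^n) i j \<omega> \<in> B j i} \<in> sets (Hn t (Suc n))"
        by (simp add: vimage_def Int_def conj_commute)
    qed
    finally show "X \<in> sets (Hn t (Suc n))" .
  qed
  then show ?thesis
    unfolding sets_Hn[of t n] using sets.sigma_sets_subset[of "rects t n" "Hn t (Suc n)"] by (simp add: space_Hn)
qed

lemma Hn_mono: "n \<le> m \<Longrightarrow> sets (Hn t n) \<subseteq> sets (Hn t m)"
  using Hn_Suc by (rule lift_Suc_mono_le)

lemma indep_Hn:
  assumes "0 < t" shows "indep_set (sets (F 0)) (sets (Hn t n))"
proof -
  have "indep_set (sets (F 0)) (rects t n)"
  proof (rule indep_setI)
    show "sets (F 0) \<subseteq> events" using sets_F by blast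
    show "rects t n \<subseteq> events" by (rule rects_events[OF assms])
    fix A X assume A: "A \<in> sets (F 0)" and "X \<in> rects t n"
    then obtain B where X: "X = rect (t / 4^n) (4^n) B" "\<And>j i. B j i \<in> sets borel" by (auto simp: rects_def)
    have sp: "space M \<in> sets (F 0)" using sets.top[of "F 0"] space_F by simp
    have "space M \<inter> X = X" unfolding X(1) rect_def by blast
    then show "prob (A \<inter> X) = prob A * prob X"
      using rect_prob[where B=B, OF _ A X(2), of "t / 4^n" "4^n"]
        rect_prob[where B=B, OF _ sp X(2), of "t / 4^n" "4^n"] assms
      by (simp add: X(1) prob_space)
  qed
  from indep_set_sigma_sets[OF this _ Int_stable_rects] show ?thesis
    using sets.Int_stable[of "F 0"] sets.sigma_sets_eq[of "F 0"] by (simp add: sets_Hn space_F)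
qed

definition Hm :: "real \<Rightarrow> 'a measure" where
  "Hm t = sigma (space M) (\<Union>n. sets (Hn t n))"

lemma Hn_Pow: "(\<Union>n. sets (Hn t n)) \<subseteq> Pow (space M)"
  using sets.sets_into_space space_Hn by blast

lemma space_Hm: "space (Hm t) = space M"
  using Hn_Pow by (simp add: Hm_def space_measure_of_conv)

lemma sets_Hm: "sets (Hm t) = sigma_sets (space M) (\<Union>n. sets (Hn t n))"
  using Hn_Pow by (simp add: Hm_def)

lemma measurable_Hm: "X \<in> measurable (Hn t n) N \<Longrightarrow> X \<in> measurable (Hm t) N"
  unfolding measurable_def space_Hn space_Hm sets_Hm by (blast intro: sigma_sets.Basic)

text \<open>A union of increasing sigma-algebras is stable under intersection, though in general no
  sigma-algebra, so the pi-lambda argument is applied once more.\<close>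

lemma indep_Hm:
  assumes "0 < t" shows "indep_set (sets (F 0)) (sets (Hm t))"
proof -
  have "indep_set (sets (F 0)) (\<Union>n. sets (Hn t n))"
  proof (rule indep_setI)
    show "sets (F 0) \<subseteq> events" using sets_F by blast
    show "(\<Union>n. sets (Hn t n)) \<subseteq> events" using indep_setD_ev2[OF indep_Hn[OF assms]] by blast
    show "prob (A \<inter> X) = prob A * prob X" if "A \<in> sets (F 0)" "X \<in> (\<Union>n. sets (Hn t n))" for A X
      using that indep_setD[OF indep_Hn[OF assms]] by blast
  qed
  moreover have "Int_stable (\<Union>n. sets (Hn t n))"
  proof (rule Int_stableI)
    fix X Y assume "X \<in> (\<Union>n. sets (Hn t n))" "Y \<in> (\<Union>n. sets (Hn t n))"
    then obtain n m where "X \<in> sets (Hn t n)" "Y \<in> sets (Hn t m)" by blast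
    then have "X \<in> sets (Hn t (max n m))" "Y \<in> sets (Hn t (max n m))"
      using Hn_mono[of n "max n m" t] Hn_mono[of m "max n m" t] by auto
    then show "X \<inter> Y \<in> (\<Union>n. sets (Hn t n))" by blast
  qed
  ultimately show ?thesis
    using indep_set_sigma_sets sets.Int_stable[of "F 0"] sets.sigma_sets_eq[of "F 0"]
    by (fastforce simp: sets_Hm space_F)
qed

lemma Dsig_measurable_Hn:
  assumes "set w \<subseteq> {0..d}" "k \<le> 4^n"
  shows "Dsig (t / 4^n) w k \<in> borel_measurable (Hn t n)"
  using assms
proof (induction w arbitrary: k)
  case Nil
  have "Dsig (t / 4^n) [] k = (\<lambda>\<omega>. 1)" by (simp add: fun_eq_iff)
  then show ?case by simp
next
  case (Cons a w)
  have "Dsig (t / 4^n) (a # w) k = (\<lambda>\<omega>. \<Sum>j<k. Dsig (t / 4^n) w j \<omega> * Del (t / 4^n) a j \<omega>)" by (simp add: fun_eq_iff)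
  moreover have "(\<lambda>\<omega>. \<Sum>j<k. Dsig (t / 4^n) w j \<omega> * Del (t / 4^n) a j \<omega>) \<in> borel_measurable (Hn t n)"
    using Cons.prems by (intro borel_measurable_sum borel_measurable_times Cons.IH Del_measurable_Hn) auto
  ultimately show ?case by simp
qed

end

section \<open>Freezing the coefficients\<close>

context ito_signature begin

text \<open>A version of the signature that is measurable for the increments. \<open>S\<close>
  itself is known to be measurable only for \<open>M\<close>, so independence from
  \<open>F 0\<close> is obtained for this version and transferred almost surely.\<close>

definition Slim :: "real \<Rightarrow> nat list \<Rightarrow> 'a \<Rightarrow> real" where
  "Slim t I \<omega> = lim (\<lambda>n. Dn t n (rev I) \<omega>)"

lemma Slim_measurable: "set I \<subseteq> {0..d} \<Longrightarrow> Slim t I \<in> borel_measurable (Hm t)"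
  unfolding Slim_def[abs_def] Dn_def
  by (intro borel_measurable_lim_metric measurable_Hm[OF Dsig_measurable_Hn]) auto

lemma Slim_eq:
  assumes "0 < t" shows "AE \<omega> in M. \<forall>I. set I \<subseteq> {0..d} \<longrightarrow> Slim t I \<omega> = S I t \<omega>"
  using Dn_tendsto_Sr[OF assms]
proof eventually_elim
  case (elim \<omega>)
  have "Slim t I \<omega> = S I t \<omega>" if "set I \<subseteq> {0..d}" for I
    using elim[rule_format, of "rev I"] that by (simp add: Slim_def Sr_def limI)
  then show ?case by blast
qed

text \<open>Substitution of a variable independent of \<open>F 0\<close>: the joint law of the
  sample point, seen through \<open>F 0\<close>, and of the signature vector is a product, and
  Fubini integrates out the second coordinate.\<close>

lemma is_cond_exp_sigval:
  assumes t: "0 < t" and c: "\<forall>I\<in>set (words d L). c I \<in> borel_measurable (F 0)" and f: "Ckp k f"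
  shows "is_cond_exp M (F 0) (\<lambda>\<omega>. f (sigval d L c S t \<omega>))
    (\<lambda>\<omega>. expectation (\<lambda>\<omega>'. f (\<Sum>I\<leftarrow>words d L. c I \<omega> * S I t \<omega>')))"
proof -
  let ?ws = "words d L"
  let ?N = "PiM (set ?ws) (\<lambda>_. borel :: real measure)"
  define v where "v \<omega> = (\<lambda>I\<in>set ?ws. Slim t I \<omega>)" for \<omega>
  have wd: "set I \<subseteq> {0..d}" if "I \<in> set ?ws" for I using words_over that .
  have fcont: "continuous_on UNIV f" using Ckp_continuous[OF f, of 0] by simp
  have fmeas[measurable]: "f \<in> borel_measurable borel" by (rule borel_measurable_continuous_onI[OF fcont])
  have "\<exists>C>0. \<exists>p. \<forall>x. \<bar>f x\<bar> \<le> C * (1 + \<bar>x\<bar> ^ p)" using f unfolding Ckp_def by (metis le0 funpow_0)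
  then obtain C p where C: "C > 0" and fb: "\<And>z. \<bar>f z\<bar> \<le> C * (1 + \<bar>z\<bar> ^ p)" by blast

  have vH: "v \<in> measurable (Hm t) ?N"
    unfolding v_def[abs_def] by (intro measurable_restrict Slim_measurable wd)
  have HM: "sets (Hm t) \<subseteq> events" by (rule indep_setD_ev2[OF indep_Hm[OF t]])
  have vM[measurable]: "v \<in> measurable M ?N"
    using vH HM unfolding measurable_def space_Hm by blast
  \<comment> \<open>The identity read as a map into \<open>F 0\<close>: its law is the restriction
    of \<open>M\<close> to that sigma-algebra.\<close>
  have idM[measurable]: "(\<lambda>\<omega>. \<omega>) \<in> measurable M (F 0)"
  proof (rule measurableI)
    fix A assume A: "A \<in> sets (F 0)"
    then have "(\<lambda>\<omega>. \<omega>) -` A \<inter> space M = A" using sets.sets_into_space[OF A] by (auto simp: space_F)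
    then show "(\<lambda>\<omega>. \<omega>) -` A \<inter> space M \<in> events" using sets_F[OF A] by simp
  qed (simp add: space_F)
  interpret P1: prob_space "distr M (F 0) (\<lambda>\<omega>. \<omega>)" by (rule prob_space_distr[OF idM])
  interpret P2: prob_space "distr M ?N v" by (rule prob_space_distr[OF vM])
  interpret PP: pair_sigma_finite "distr M (F 0) (\<lambda>\<omega>. \<omega>)" "distr M ?N v" ..
  have prod: "distr M (F 0) (\<lambda>\<omega>. \<omega>) \<Otimes>\<^sub>M distr M ?N v = distr M (F 0 \<Otimes>\<^sub>M ?N) (\<lambda>\<omega>. (\<omega>, v \<omega>))"
  proof (rule pair_measure_eqI)
    show "sigma_finite_measure (distr M (F 0) (\<lambda>\<omega>. \<omega>))" "sigma_finite_measure (distr M ?N v)"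
      by unfold_locales
    show "sets (distr M (F 0) (\<lambda>\<omega>. \<omega>) \<Otimes>\<^sub>M distr M ?N v) = sets (distr M (F 0 \<Otimes>\<^sub>M ?N) (\<lambda>\<omega>. (\<omega>, v \<omega>)))"
      by (simp cong: sets_pair_measure_cong)
    fix A B assume "A \<in> sets (distr M (F 0) (\<lambda>\<omega>. \<omega>))" "B \<in> sets (distr M ?N v)"
    then have A: "A \<in> sets (F 0)" and B: "B \<in> sets ?N" by auto
    have vB: "v -` B \<inter> space M \<in> sets (Hm t)" using measurable_sets[OF vH B] by (simp add: space_Hm)
    have AM: "A \<subseteq> space M" using sets.sets_into_space[OF A] by (simp add: space_F)
    have "emeasure (distr M (F 0) (\<lambda>\<omega>. \<omega>)) A * emeasure (distr M ?N v) B = emeasure M A * emeasure M (v -` B \<inter> space M)"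
      using A B AM by (simp add: emeasure_distr Int_absorb2)
    also have "\<dots> = emeasure M (A \<inter> (v -` B \<inter> space M))"
      using indep_setD[OF indep_Hm[OF t] A vB] by (simp add: emeasure_eq_measure ennreal_mult)
    also have "A \<inter> (v -` B \<inter> space M) = (\<lambda>\<omega>. (\<omega>, v \<omega>)) -` (A \<times> B) \<inter> space M"
      by auto
    also have "emeasure M \<dots> = emeasure (distr M (F 0 \<Otimes>\<^sub>M ?N) (\<lambda>\<omega>. (\<omega>, v \<omega>))) (A \<times> B)"
      using A B by (subst emeasure_distr) auto
    finally show "emeasure (distr M (F 0) (\<lambda>\<omega>. \<omega>)) A * emeasure (distr M ?N v) B =
      emeasure (distr M (F 0 \<Otimes>\<^sub>M ?N) (\<lambda>\<omega>. (\<omega>, v \<omega>))) (A \<times> B)" .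
  qed

  have lin[measurable]: "(\<lambda>(\<omega>, y). \<Sum>I\<leftarrow>ws. c I \<omega> * y I) \<in> borel_measurable (F 0 \<Otimes>\<^sub>M ?N)" if "set ws \<subseteq> set ?ws" for ws
    using that
  proof (induction ws)
    case (Cons I ws)
    have [measurable]: "c I \<in> borel_measurable (F 0)" using c Cons.prems by auto
    have [measurable]: "(\<lambda>y. y I) \<in> borel_measurable ?N" using Cons.prems by (intro measurable_component_singleton) auto
    have [measurable]: "(\<lambda>(\<omega>, y). \<Sum>I\<leftarrow>ws. c I \<omega> * y I) \<in> borel_measurable (F 0 \<Otimes>\<^sub>M ?N)" using Cons by auto
    show ?case by (simp add: case_prod_unfold) measurable
  qed simp
  define \<Phi> where "\<Phi> \<omega> y = f (\<Sum>I\<leftarrow>?ws. c I \<omega> * y I)" for \<omega> y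
  have \<Phi>m[measurable]: "case_prod \<Phi> \<in> borel_measurable (F 0 \<Otimes>\<^sub>M ?N)"
    unfolding \<Phi>_def using measurable_compose[OF lin[OF order_refl] fmeas] by (simp add: case_prod_unfold)

  define Y where "Y \<omega> = expectation (\<lambda>\<omega>'. f (\<Sum>I\<leftarrow>?ws. c I \<omega> * S I t \<omega>'))" for \<omega>
  have vS: "AE \<omega>' in M. \<forall>\<omega>. \<Phi> \<omega> (v \<omega>') = f (\<Sum>I\<leftarrow>?ws. c I \<omega> * S I t \<omega>')"
    using Slim_eq[OF t]
  proof eventually_elim
    case (elim \<omega>')
    have "(\<Sum>I\<leftarrow>?ws. c I \<omega> * v \<omega>' I) = (\<Sum>I\<leftarrow>?ws. c I \<omega> * S I t \<omega>')" for \<omega>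
      using elim wd by (intro arg_cong[where f=sum_list] map_cong) (auto simp: v_def)
    then show ?case by (simp add: \<Phi>_def)
  qed
  have Sm: "S I t \<in> borel_measurable M" if "I \<in> set ?ws" for I
    using that wd t by (intro S_measurable) auto
  have \<Phi>\<omega>: "\<Phi> \<omega> \<in> borel_measurable ?N" if "\<omega> \<in> space M" for \<omega>
    using measurable_Pair2[OF \<Phi>m, of \<omega>] that by (simp add: space_F)
  have sumS: "(\<lambda>\<omega>'. \<Sum>I\<leftarrow>ws. g I \<omega>' * S I t \<omega>') \<in> borel_measurable M"
    if "set ws \<subseteq> set ?ws" "\<And>I. I \<in> set ?ws \<Longrightarrow> g I \<in> borel_measurable M" for g ws
    using that(1) by (induction ws) (auto intro!: borel_measurable_add borel_measurable_times Sm that(2))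
  have YP: "Y \<omega> = (\<integral>y. \<Phi> \<omega> y \<partial>distr M ?N v)" if "\<omega> \<in> space M" for \<omega>
  proof -
    have "(\<integral>y. \<Phi> \<omega> y \<partial>distr M ?N v) = expectation (\<lambda>\<omega>'. \<Phi> \<omega> (v \<omega>'))"
      by (rule integral_distr[OF vM \<Phi>\<omega>[OF that]])
    also have "\<dots> = Y \<omega>"
      unfolding Y_def
    proof (rule integral_cong_AE)
      show "(\<lambda>\<omega>'. \<Phi> \<omega> (v \<omega>')) \<in> borel_measurable M" by (rule measurable_compose[OF vM \<Phi>\<omega>[OF that]])
      show "(\<lambda>\<omega>'. f (\<Sum>I\<leftarrow>?ws. c I \<omega> * S I t \<omega>')) \<in> borel_measurable M"
        by (rule measurable_compose[OF sumS fmeas]) auto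
      show "AE \<omega>' in M. \<Phi> \<omega> (v \<omega>') = f (\<Sum>I\<leftarrow>?ws. c I \<omega> * S I t \<omega>')" using vS by eventually_elim blast
    qed
    finally show ?thesis ..
  qed
  have "(\<lambda>\<omega>. \<integral>y. \<Phi> \<omega> y \<partial>distr M ?N v) \<in> borel_measurable (F 0)"
    by (rule P2.borel_measurable_lebesgue_integral) (use \<Phi>m in \<open>simp cong: measurable_cong_sets\<close>)
  then have Ym: "Y \<in> borel_measurable (F 0)"
    by (subst measurable_cong[where g="\<lambda>\<omega>. \<integral>y. \<Phi> \<omega> y \<partial>distr M ?N v"]) (use YP space_F in auto)

  \<comment> \<open>The exhausting sets bound the coefficients, which need not be integrable. On
    \<open>A n\<close> the growth of \<open>f\<close> is dominated by a power of the sum of the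
    absolute iterated integrals, which has all moments.\<close>
  define A where "A n = {\<omega>\<in>space M. \<forall>I\<in>set ?ws. \<bar>c I \<omega>\<bar> \<le> real n}" for n :: nat
  have cF: "c I \<in> borel_measurable (F 0)" if "I \<in> set ?ws" for I using c that by blast
  have AF: "A n \<in> sets (F 0)" for n
  proof -
    have "A n = {\<omega>\<in>space (F 0). \<forall>I\<in>set ?ws. \<bar>c I \<omega>\<bar> \<le> real n}" by (simp add: A_def space_F)
    also have "\<dots> \<in> sets (F 0)"
    proof (intro sets.sets_Collect_finite_All finite_set)
      fix I assume "I \<in> set ?ws"
      then have [measurable]: "c I \<in> borel_measurable (F 0)" by (rule cF)
      show "{\<omega>\<in>space (F 0). \<bar>c I \<omega>\<bar> \<le> real n} \<in> sets (F 0)" by measurable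
    qed
    finally show ?thesis .
  qed
  have bound: "integrable M (\<lambda>\<omega>. C * (1 + \<bar>real n * (\<Sum>I\<leftarrow>?ws. \<bar>S I t \<omega>\<bar>)\<bar> ^ p))" for n
  proof -
    have "fin_mom (\<lambda>\<omega>. \<Sum>I\<leftarrow>ws. \<bar>S I t \<omega>\<bar>)" if "set ws \<subseteq> set ?ws" for ws
      using that
    proof (induction ws)
      case (Cons I ws)
      have "fin_mom (S I t)" using Cons.prems wd t by (intro fin_mom_S) auto
      then have "fin_mom (\<lambda>\<omega>. \<bar>S I t \<omega>\<bar>)" by (simp add: fin_mom_def borel_measurable_abs)
      then show ?case using fin_mom_add[of "\<lambda>\<omega>. \<bar>S I t \<omega>\<bar>" "\<lambda>\<omega>. \<Sum>I\<leftarrow>ws. \<bar>S I t \<omega>\<bar>"] Cons by simp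
    qed (simp add: fin_mom_const)
    from fin_mom_mult[OF fin_mom_const this[OF order_refl]] show ?thesis unfolding fin_mom_def by auto
  qed
  have cM: "c I \<in> borel_measurable M" if "I \<in> set ?ws" for I using measurable_F[OF cF[OF that]] .
  have Xm: "(\<lambda>\<omega>. f (\<Sum>I\<leftarrow>?ws. c I \<omega> * S I t \<omega>)) \<in> borel_measurable M"
    by (rule measurable_compose[OF sumS fmeas]) (auto intro: cM)
  have Xint: "integrable M (\<lambda>\<omega>. indicator (A n) \<omega> * f (\<Sum>I\<leftarrow>?ws. c I \<omega> * S I t \<omega>))" for n
  proof (rule Bochner_Integration.integrable_bound[OF bound[of n]])
    show "(\<lambda>\<omega>. indicator (A n) \<omega> * f (\<Sum>I\<leftarrow>?ws. c I \<omega> * S I t \<omega>)) \<in> borel_measurable M"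
      using sets_F[OF AF] Xm by (intro borel_measurable_times borel_measurable_indicator) auto
    have dom: "\<bar>indicator (A n) \<omega> * f (\<Sum>I\<leftarrow>?ws. c I \<omega> * S I t \<omega>)\<bar> \<le> C * (1 + \<bar>real n * (\<Sum>I\<leftarrow>?ws. \<bar>S I t \<omega>\<bar>)\<bar> ^ p)" for \<omega>
    proof (cases "\<omega> \<in> A n")
      case True
      have "\<bar>\<Sum>I\<leftarrow>ws. c I \<omega> * S I t \<omega>\<bar> \<le> real n * (\<Sum>I\<leftarrow>ws. \<bar>S I t \<omega>\<bar>)" if "set ws \<subseteq> set ?ws" for ws
        using that
      proof (induction ws)
        case (Cons I ws)
        have "\<bar>c I \<omega> * S I t \<omega>\<bar> \<le> real n * \<bar>S I t \<omega>\<bar>"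
          unfolding abs_mult using True Cons.prems by (intro mult_right_mono) (auto simp: A_def)
        then show ?case using Cons by (simp add: distrib_left)
      qed simp
      from this[OF order_refl] have "\<bar>\<Sum>I\<leftarrow>?ws. c I \<omega> * S I t \<omega>\<bar> \<le> \<bar>real n * (\<Sum>I\<leftarrow>?ws. \<bar>S I t \<omega>\<bar>)\<bar>" by linarith
      then have "C * (1 + \<bar>\<Sum>I\<leftarrow>?ws. c I \<omega> * S I t \<omega>\<bar> ^ p) \<le> C * (1 + \<bar>real n * (\<Sum>I\<leftarrow>?ws. \<bar>S I t \<omega>\<bar>)\<bar> ^ p)"
        using C by (intro mult_left_mono add_left_mono power_mono) auto
      then show ?thesis using True fb[of "\<Sum>I\<leftarrow>?ws. c I \<omega> * S I t \<omega>"] by simp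
    next
      case False
      then show ?thesis using C by simp
    qed
    show "AE \<omega> in M. norm (indicator (A n) \<omega> * f (\<Sum>I\<leftarrow>?ws. c I \<omega> * S I t \<omega>)) \<le>
      norm (C * (1 + \<bar>real n * (\<Sum>I\<leftarrow>?ws. \<bar>S I t \<omega>\<bar>)\<bar> ^ p))"
      unfolding real_norm_def by (intro AE_I2 order_trans[OF dom abs_ge_self])
  qed

  \<comment> \<open>Taking \<open>D\<close> inside \<open>A n\<close> serves both the integrability
    on \<open>A n\<close> and the identity on \<open>A n \<inter> B\<close>.\<close>
  have main: "integrable M (\<lambda>\<omega>. indicator D \<omega> * Y \<omega>) \<and>
     (\<integral>\<omega>. indicator D \<omega> * f (\<Sum>I\<leftarrow>?ws. c I \<omega> * S I t \<omega>) \<partial>M) = (\<integral>\<omega>. indicator D \<omega> * Y \<omega> \<partial>M)"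
    if D: "D \<in> sets (F 0)" "D \<subseteq> A n" for D n
  proof -
    define \<Psi> where "\<Psi> = (\<lambda>z. indicator D (fst z) * case_prod \<Phi> z)"
    have \<Psi>m: "\<Psi> \<in> borel_measurable (F 0 \<Otimes>\<^sub>M ?N)"
      unfolding \<Psi>_def using D(1) by (intro borel_measurable_times \<Phi>m measurable_compose[OF measurable_fst] borel_measurable_indicator)
    have pm: "(\<lambda>\<omega>. (\<omega>, v \<omega>)) \<in> measurable M (F 0 \<Otimes>\<^sub>M ?N)" by measurable
    have ae: "AE \<omega> in M. indicator D \<omega> * f (\<Sum>I\<leftarrow>?ws. c I \<omega> * S I t \<omega>) = \<Psi> (\<omega>, v \<omega>)"
      using vS by eventually_elim (simp add: \<Psi>_def)
    have DX: "integrable M (\<lambda>\<omega>. indicator D \<omega> * f (\<Sum>I\<leftarrow>?ws. c I \<omega> * S I t \<omega>))"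
    proof (rule Bochner_Integration.integrable_bound[OF Xint[of n]])
      show "(\<lambda>\<omega>. indicator D \<omega> * f (\<Sum>I\<leftarrow>?ws. c I \<omega> * S I t \<omega>)) \<in> borel_measurable M"
        using sets_F[OF D(1)] Xm by (intro borel_measurable_times borel_measurable_indicator) auto
    qed (use D(2) in \<open>auto simp: indicator_def\<close>)
    have \<Psi>i: "integrable M (\<lambda>\<omega>. \<Psi> (\<omega>, v \<omega>))"
      by (rule integrable_cong_AE_imp[OF DX]) (use ae measurable_compose[OF pm \<Psi>m] in auto)
    then have "integrable (distr M (F 0 \<Otimes>\<^sub>M ?N) (\<lambda>\<omega>. (\<omega>, v \<omega>))) \<Psi>"
      using integrable_distr_eq[OF pm \<Psi>m] by simp
    then have P\<Psi>: "integrable (distr M (F 0) (\<lambda>\<omega>. \<omega>) \<Otimes>\<^sub>M distr M ?N v) \<Psi>" unfolding prod .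
    have inner: "(\<integral>y. \<Psi> (\<omega>, y) \<partial>distr M ?N v) = indicator D \<omega> * Y \<omega>" if "\<omega> \<in> space M" for \<omega>
      using YP[OF that] by (simp add: \<Psi>_def)
    have im: "(\<lambda>\<omega>. \<integral>y. \<Psi> (\<omega>, y) \<partial>distr M ?N v) \<in> borel_measurable (F 0)"
      by (rule P2.borel_measurable_lebesgue_integral) (use \<Psi>m in \<open>simp add: case_prod_unfold cong: measurable_cong_sets\<close>)
    have "integrable (distr M (F 0) (\<lambda>\<omega>. \<omega>)) (\<lambda>\<omega>. \<integral>y. \<Psi> (\<omega>, y) \<partial>distr M ?N v)"
      by (rule PP.integrable_fst'[OF P\<Psi>])
    then have "integrable M (\<lambda>\<omega>. \<integral>y. \<Psi> (\<omega>, y) \<partial>distr M ?N v)"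
      using integrable_distr_eq[OF idM im] by simp
    then have int: "integrable M (\<lambda>\<omega>. indicator D \<omega> * Y \<omega>)"
      by (subst (asm) Bochner_Integration.integrable_cong[OF refl inner])
    have "(\<integral>\<omega>. indicator D \<omega> * f (\<Sum>I\<leftarrow>?ws. c I \<omega> * S I t \<omega>) \<partial>M) = (\<integral>\<omega>. \<Psi> (\<omega>, v \<omega>) \<partial>M)"
      by (rule integral_cong_AE) (use ae DX measurable_compose[OF pm \<Psi>m] in auto)
    also have "\<dots> = (\<integral>z. \<Psi> z \<partial>(distr M (F 0) (\<lambda>\<omega>. \<omega>) \<Otimes>\<^sub>M distr M ?N v))"
      unfolding prod using integral_distr[OF pm \<Psi>m] by simp
    also have "\<dots> = (\<integral>\<omega>. (\<integral>y. \<Psi> (\<omega>, y) \<partial>distr M ?N v) \<partial>distr M (F 0) (\<lambda>\<omega>. \<omega>))"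
      using PP.integral_fst'[OF P\<Psi>] by simp
    also have "\<dots> = (\<integral>\<omega>. (\<integral>y. \<Psi> (\<omega>, y) \<partial>distr M ?N v) \<partial>M)"
      by (rule integral_distr[OF idM im])
    also have "\<dots> = (\<integral>\<omega>. indicator D \<omega> * Y \<omega> \<partial>M)"
      by (intro Bochner_Integration.integral_cong refl inner)
    finally show ?thesis using int by simp
  qed

  show ?thesis
    unfolding is_cond_exp_def sigval_def Y_def[symmetric]
  proof (intro conjI Ym exI[of _ A] allI ballI AF Xint)
    show "incseq A" by (auto simp: incseq_def A_def intro: order_trans)
    show "(\<Union>n. A n) = space M"
    proof (intro equalityI subsetI)
      fix \<omega> assume w: "\<omega> \<in> space M"
      obtain n :: nat where n: "(\<Sum>I\<in>set ?ws. \<bar>c I \<omega>\<bar>) \<le> real n" using real_arch_simple by blast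
      have "\<bar>c I \<omega>\<bar> \<le> real n" if "I \<in> set ?ws" for I
        using member_le_sum[of I "set ?ws" "\<lambda>I. \<bar>c I \<omega>\<bar>"] that n by simp
      then show "\<omega> \<in> (\<Union>n. A n)" using w by (auto simp: A_def)
    qed (auto simp: A_def)
    show "integrable M (\<lambda>\<omega>. indicator (A n) \<omega> * Y \<omega>)" for n using main[OF AF order_refl] by blast
    show "(\<integral>\<omega>. indicator (A n \<inter> B) \<omega> * f (\<Sum>I\<leftarrow>?ws. c I \<omega> * S I t \<omega>) \<partial>M) = (\<integral>\<omega>. indicator (A n \<inter> B) \<omega> * Y \<omega> \<partial>M)"
      if "B \<in> sets (F 0)" for n B
      using main[of "A n \<inter> B" n] AF that by blast
  qed
qed

end

theorem theorem1:
  fixes M :: "'a measure" and F :: "real \<Rightarrow> 'a measure"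
    and d L N :: nat and W :: "nat \<Rightarrow> real \<Rightarrow> 'a \<Rightarrow> real"
    and S :: "nat list \<Rightarrow> real \<Rightarrow> 'a \<Rightarrow> real"
    and c :: "nat list \<Rightarrow> 'a \<Rightarrow> real" and f :: "real \<Rightarrow> real"
  assumes "prob_space M"
    and "is_filtration M F"
    and "is_std_BM M F d W"
    and "is_signature M d W S"
    and "\<forall>I\<in>set (words d L). c I \<in> borel_measurable (F 0)"
    and "Ckp (2 * N) f"
  shows "\<exists>Y :: real \<Rightarrow> 'a \<Rightarrow> real.
           (\<forall>t>0. is_cond_exp M (F 0) (\<lambda>\<omega>. f (sigval d L c S t \<omega>)) (Y t)) \<and>
           (AE \<omega> in M. ((\<lambda>t. (Y t \<omega> - expansion d L N f (\<lambda>I. c I \<omega>) t) / t ^ N)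
                          \<longlongrightarrow> 0) (at_right 0))"
proof -
  interpret prob_space M by fact
  interpret ito_signature M F d W S by unfold_locales fact+
  show ?thesis
    using is_cond_exp_sigval[OF _ assms(5,6)] deterministic_expansion[OF assms(6)]
    \<comment> \<open>With the coefficients frozen at \<open>\<omega>\<close>, the deterministic
      expansion applies at each sample point, so the limit holds everywhere and in particular almost
      surely.\<close>
    by (intro exI[of _ "\<lambda>t \<omega>. expectation (\<lambda>\<omega>'. f (\<Sum>I\<leftarrow>words d L. c I \<omega> * S I t \<omega>'))"]) auto
qed

end
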